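(* Let $n\ge1$, $\rho\in\mathbb{R}$ and $\lambda=-\frac{n+1}{2}+i\rho$. Then the transform of even functions on the unit sphere $S^n\subset\mathbb{R}^{n+1}$ $$(J_\lambda f)(\xi)=\int_{S^n}f(\omega)\,\frac{|\langle\xi,\omega\rangle|^\lambda}{\Gamma\left(\frac{\lambda+1}{2}\right)}\,d\omega$$ is a generalized Fourier transform (GFT). That is, for a suitable normalization (by positive constants) of the invariant measures $d\omega$ and $d\xi$, for all smooth even $f,g$ on $S^n$, $$f(\omega)=\int_{S^n}(J_\lambda f)(\xi)\,\overline{\left(\frac{|\langle\xi,\omega\rangle|^{\lambda}}{\Gamma\left(\frac{\lambda+1}{2}\right)}\right)}\,d\xi,\qquad \int_{S^n}f\,\overline{g}\,d\omega=\int_{S^n}J_\lambda f\;\overline{J_\lambda g}\,d\xi .$$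
   Context: $d\omega$, $d\xi$ denote rotation-invariant measures on $S^n$. The integral defining $J_\lambda f$, for smooth even $f$, converges for $\operatorname{Re}\lambda>-1$ and is defined for every $\lambda\in\mathbb{C}$ by analytic continuation in $\lambda$; equivalently $|t|^\lambda/\Gamma(\frac{\lambda+1}{2})$ is regarded as an entire family of generalized functions of $t\in\mathbb{R}$. The integral with the conjugate kernel is understood in the same way, with $\overline{\lambda}$ in place of $\lambda$. Generalized Fourier transform: an integral transform $F:f(x)\mapsto\hat f(y)=\int_X f(x)e(x,y)\,dx$ between functions on spaces $X$, $\hat X$ with fixed measures $dx$, $dy$, where $e(x,y)$ is a generalized function on $X\times\hat X$, is a GFT if the inversion formula $f(x)=\int\hat f(y)\overline{e(x,y)}\,dy$, and hence the Plancherel formula $\int f\overline g\,dx=\int\hat f\,\overline{\hat g}\,dy$, is valid. Even functions on $S^n$ are functions on the space $X=\hat X=S^n/\{\pm1\}$. Numerical coefficients in front of integrals are absorbed into the normalization of the measures. *)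

theory Defs
  imports "HOL-Complex_Analysis.Complex_Analysis"
begin

primrec k_times_differentiable_on ::
    "nat \<Rightarrow> 'a::real_normed_vector set \<Rightarrow> ('a \<Rightarrow> 'b::real_normed_vector) \<Rightarrow> bool" where
  "k_times_differentiable_on 0 U f \<longleftrightarrow> continuous_on U f"
| "k_times_differentiable_on (Suc k) U f \<longleftrightarrow>
     (\<forall>x\<in>U. f differentiable (at x)) \<and>
     (\<forall>v. k_times_differentiable_on k U (\<lambda>x. frechet_derivative f (at x) v))"

definition smooth_on_open :: "'a::real_normed_vector set \<Rightarrow> ('a \<Rightarrow> 'b::real_normed_vector) \<Rightarrow> bool" where
  "smooth_on_open U f \<longleftrightarrow> open U \<and> (\<forall>k. k_times_differentiable_on k U f)"

text \<open>Functions on the sphere are functions on the ambient space of which only the values on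
  \<open>sphere 0 1\<close> matter; smoothness is that of a function on an embedded submanifold.\<close>

definition smooth_on_sphere :: "(real^'n \<Rightarrow> complex) \<Rightarrow> bool" where
  "smooth_on_sphere f \<longleftrightarrow>
     (\<exists>U h. sphere 0 1 \<subseteq> U \<and> smooth_on_open U h \<and> (\<forall>x\<in>sphere 0 1. h x = f x))"

definition even_on_sphere :: "(real^'n \<Rightarrow> complex) \<Rightarrow> bool" where
  "even_on_sphere f \<longleftrightarrow> (\<forall>x\<in>sphere 0 1. f (- x) = f x)"

text \<open>Rotation-invariant measures on the sphere: finite, nonzero Borel measures.\<close>

definition invariant_sphere_measure :: "(real^'n) measure \<Rightarrow> bool" where
  "invariant_sphere_measure M \<longleftrightarrow>
     sets M = sets (restrict_space borel (sphere 0 1)) \<and>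
     0 < emeasure M (sphere 0 1) \<and> emeasure M (sphere 0 1) < \<infinity> \<and>
     (\<forall>Q. rotation_matrix Q \<longrightarrow> distr M M ((*v) Q) = M)"

definition abs_power_kernel :: "complex \<Rightarrow> real \<Rightarrow> complex" where
  "abs_power_kernel s t = complex_of_real \<bar>t\<bar> powr s / Gamma ((s + 1) / 2)"

text \<open>The conjugate kernel is the kernel with the conjugate exponent.\<close>

lemma cnj_abs_power_kernel: "cnj (abs_power_kernel s t) = abs_power_kernel (cnj s) t"
proof -
  have "cnj (complex_of_real \<bar>t\<bar> powr s) = complex_of_real \<bar>t\<bar> powr cnj s"
    by (cases "t = 0") (simp_all add: cnj_powr)
  moreover have "cnj (Gamma ((s + 1) / 2)) = Gamma ((cnj s + 1) / 2)"
    by (simp add: cnj_Gamma)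
  ultimately show ?thesis
    by (simp add: abs_power_kernel_def)
qed

definition entire_continuation_of :: "(complex \<Rightarrow> complex) \<Rightarrow> (complex \<Rightarrow> complex) \<Rightarrow> bool" where
  "entire_continuation_of F I \<longleftrightarrow> F holomorphic_on UNIV \<and> (\<forall>s. Re s > -1 \<longrightarrow> F s = I s)"

lemma entire_continuation_of_unique:
  assumes "entire_continuation_of F I" "entire_continuation_of G I"
  shows "F = G"
proof
  fix z
  have "open {s. Re s > -1}"
    by (rule open_halfspace_Re_gt)
  moreover have "(0::complex) \<in> {s. Re s > -1}"
    by simp
  ultimately show "F z = G z"
    using assms analytic_continuation_open[of "{s. Re s > -1}" UNIV F G z]
    unfolding entire_continuation_of_def by (metis UNIV_I connected_UNIV empty_iff mem_Collect_eq open_UNIV subset_UNIV)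
qed

text \<open>The transform \<open>J\<close> in the measure \<open>M\<close>; the integral itself is only meaningful for
  \<open>Re s > -1\<close>.\<close>

definition J_transform ::
    "(real^'n) measure \<Rightarrow> complex \<Rightarrow> (real^'n \<Rightarrow> complex) \<Rightarrow> real^'n \<Rightarrow> complex" where
  "J_transform M s f \<xi> =
     (THE F. entire_continuation_of F
        (\<lambda>z. \<integral>\<omega>. f \<omega> * abs_power_kernel z (\<xi> \<bullet> \<omega>) \<partial>M)) s"

text \<open>The same integral with the conjugate kernel, by \<open>cnj_abs_power_kernel\<close>.\<close>

definition J_conj_transform ::
    "(real^'n) measure \<Rightarrow> complex \<Rightarrow> (real^'n \<Rightarrow> complex) \<Rightarrow> real^'n \<Rightarrow> complex" where
  "J_conj_transform M s = J_transform M (cnj s)"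

end

theory Submission
  imports Defs
begin

text \<open>
  Rotation invariance of the measure alone yields integration by parts for the infinitesimal rotations,
  hence for the Laplacian \<open>\<Delta>\<close> of the sphere.  With \<open>d = n + 1\<close> and \<open>t = \<langle>\<xi>, \<omega>\<rangle>\<close>, the identity
  \<open>\<Delta> |t|^(z+2) = (z+2) ((z+1) |t|^z - (z+d) |t|^(z+2))\<close> gives
  \<open>2 (z+2) J_z f = (z+2) (z+d) J_(z+2) f + J_(z+2) (\<Delta> f)\<close>, from which \<open>J_z f\<close> is continued step by step;
  the spurious pole at \<open>z = -2\<close> is absent because \<open>\<integral> \<Delta> f = 0\<close>.  Only this weak form of \<open>\<Delta> f\<close>, with a kernel
  in place of a test function, is needed, and it is inherited by \<open>J_z f\<close>, so that transforms can be iterated.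

  If \<open>f\<close> is even and \<open>\<Delta> f = - 2k (2k + d - 2) f\<close>, the recursion makes the quotient of \<open>J_z f\<close> by
  \<open>J_z 1 * (\<Prod>i<k. (z - 2i) / (z + d + 2i))\<close> periodic under \<open>z \<mapsto> z + 2\<close>, and it tends to \<open>f\<close> because \<open>|t|^(z+2j)\<close>
  concentrates at \<open>\<plusminus>\<xi>\<close>.  The product at \<open>-d - z\<close> is the inverse of that at \<open>z\<close>, and \<open>-d - \<lambda>\<close> is the conjugate
  of \<open>\<lambda>\<close>.  So by self-adjointness the difference of \<open>J' (J f)\<close> and a multiple of \<open>f\<close> is orthogonal to all such
  eigenfunctions; these span the functions \<open>\<langle>a, \<omega>\<rangle>^(2k)\<close>, which concentrate at \<open>\<plusminus>a\<close>.
\<close>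

section \<open>Rotation derivatives and integration by parts\<close>

text \<open>Uniqueness of the invariant measure is never invoked, so \<open>M\<close> and
  \<open>N\<close> are not known to be proportional. Instead self-adjointness pairs a transform in
  \<open>M\<close> with one in \<open>N\<close>, and pairing 1 with 1 already yields the ratio of
  the two constants. Nor is a closed formula for the transform of 1 computed: its recursion and its
  nonvanishing suffice, and the normalization is expressed through its value \<alpha>. Scaling the
  measures multiplies the inversion constant by the product of the two factors, so one factor stays
  1 and the other is read off. The line \<open>Re lam = - d / 2\<close> has two effects: conjugation
  becomes the reflection of the exponent that inverts the eigenvalue ratio, and the zeros of the
  factors \<open>z + d + 2i\<close>, whose real parts are at most \<open>- d\<close>, stay off the
  line, so every division is legitimate. Neither surface measure nor coordinates on the sphere
  appear; even the integrability of \<open>|t|^a\<close> for \<open>a > - 1\<close> has to be won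
  from rotation invariance.\<close>

locale sphere_measure =
  fixes M :: "(real^'n) measure"
  assumes invariant: "invariant_sphere_measure M" and card_ge_2: "CARD('n) \<ge> 2"
begin

lemma sets_M: "sets M = sets (restrict_space borel (sphere 0 1))"
  using invariant by (simp add: invariant_sphere_measure_def)

lemma space_M: "space M = sphere 0 1"
  using sets_eq_imp_space_eq[OF sets_M] by (simp add: space_restrict_space)

sublocale finite_measure M
proof
  show "emeasure M (space M) \<noteq> \<infinity>"
    using invariant unfolding invariant_sphere_measure_def space_M by auto
qed

lemma measure_pos: "measure M (sphere 0 1) > 0"
proof -
  have "0 < emeasure M (sphere 0 1)"
    using invariant unfolding invariant_sphere_measure_def by blast
  then show ?thesis
    unfolding emeasure_eq_measure by simp
qed

lemma measurable_continuous_on_sphere: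
  fixes f :: "real^'n \<Rightarrow> 'b::topological_space"
  assumes "continuous_on (sphere 0 1) f"
  shows "f \<in> borel_measurable M"
  using borel_measurable_continuous_on_restrict[OF assms] sets_M
  by (simp cong: measurable_cong_sets)

lemma bounded_continuous_on_sphere:
  fixes f :: "real^'n \<Rightarrow> 'b::real_normed_vector"
  assumes "continuous_on (sphere 0 1) f"
  obtains B where "\<And>x. x \<in> sphere 0 1 \<Longrightarrow> norm (f x) \<le> B" "B > 0"
proof -
  have "bounded (f ` sphere 0 1)"
    by (intro compact_imp_bounded compact_continuous_image assms) simp
  then show ?thesis
    using that unfolding bounded_pos by blast
qed

lemma integrable_continuous_on_sphere:
  fixes f :: "real^'n \<Rightarrow> 'b::{banach,second_countable_topology}"
  assumes "continuous_on (sphere 0 1) f"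
  shows "integrable M f"
proof -
  obtain B where "\<And>x. x \<in> sphere 0 1 \<Longrightarrow> norm (f x) \<le> B"
    using bounded_continuous_on_sphere[OF assms] by blast
  then show ?thesis
    by (intro integrable_const_bound[where B = B] measurable_continuous_on_sphere assms AE_I2)
      (simp add: space_M)
qed

lemma measurable_rotation:
  assumes "rotation_matrix Q"
  shows "(*v) Q \<in> measurable M M"
proof -
  have orth: "orthogonal_matrix Q"
    using assms by (simp add: rotation_matrix_def)
  have "norm (Q *v x) = norm x" for x
    using orth orthogonal_transformation_matrix[of "(*v) Q"] by (simp add: orthogonal_transformation)
  then have "(*v) Q \<in> sphere 0 1 \<rightarrow> sphere 0 1"
    by simp
  then have "(*v) Q \<in> measurable (restrict_space borel (sphere 0 1)) (restrict_space borel (sphere 0 1))"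
    by (intro measurable_restrict_space3 borel_measurable_continuous_onI)
      (auto intro!: continuous_intros simp: matrix_vector_mult_linear_continuous_on)
  then show "(*v) Q \<in> measurable M M"
    using sets_M by (simp cong: measurable_cong_sets)
qed

lemma integral_rotation:
  fixes f :: "real^'n \<Rightarrow> 'b::{banach,second_countable_topology}"
  assumes "rotation_matrix Q" "f \<in> borel_measurable M"
  shows "(\<integral>\<omega>. f (Q *v \<omega>) \<partial>M) = (\<integral>\<omega>. f \<omega> \<partial>M)"
proof -
  have "(\<integral>\<omega>. f (Q *v \<omega>) \<partial>M) = (\<integral>\<omega>. f \<omega> \<partial>distr M M ((*v) Q))"
    by (intro integral_distr[symmetric] measurable_rotation assms)
  also have "distr M M ((*v) Q) = M"
    using invariant assms(1) by (simp add: invariant_sphere_measure_def)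
  finally show ?thesis .
qed

text \<open>Here the dimension enters: for \<open>CARD('n) = 1\<close> the identity is the only
  rotation matrix, and it does not exchange the two points of the sphere.\<close>

lemma rotation_to:
  fixes a b :: "real^'n"
  assumes "a \<in> sphere 0 1" "b \<in> sphere 0 1"
  obtains Q where "rotation_matrix Q" "Q *v a = b"
proof -
  obtain f where "orthogonal_transformation f" "det (matrix f) = 1" "f a = b"
    using rotation_exists[of a b] card_ge_2 assms by auto
  then have "rotation_matrix (matrix f)" "matrix f *v a = b"
    by (auto simp: rotation_matrix_def orthogonal_transformation_matrix matrix_works orthogonal_transformation_linear)
  then show thesis
    using that by blast
qed

end

text \<open>A rotation only if \<open>u\<close> and \<open>v\<close> are orthonormal.\<close>

definition plane_rotation :: "'a::real_inner \<Rightarrow> 'a \<Rightarrow> real \<Rightarrow> 'a \<Rightarrow> 'a" where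
  "plane_rotation u v \<theta> x =
     x + ((cos \<theta> - 1) * (u \<bullet> x) - sin \<theta> * (v \<bullet> x)) *\<^sub>R u
       + ((cos \<theta> - 1) * (v \<bullet> x) + sin \<theta> * (u \<bullet> x)) *\<^sub>R v"

text \<open>The one-parameter group law transports derivatives from angle 0 to every angle, and
  halving the angle will settle the sign of the determinant.\<close>

lemma plane_rotation_add:
  assumes "norm u = 1" "norm v = 1" "u \<bullet> v = 0"
  shows "plane_rotation u v a (plane_rotation u v b x) = plane_rotation u v (a + b) x"
proof -
  have [simp]: "u \<bullet> u = 1" "v \<bullet> v = 1" "v \<bullet> u = 0"
    using assms by (simp_all add: dot_square_norm inner_commute)
  have u: "u \<bullet> plane_rotation u v b x = cos b * (u \<bullet> x) - sin b * (v \<bullet> x)"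
    and v: "v \<bullet> plane_rotation u v b x = cos b * (v \<bullet> x) + sin b * (u \<bullet> x)"
    using assms by (simp_all add: plane_rotation_def inner_simps algebra_simps)
  show ?thesis
    unfolding plane_rotation_def[of _ _ a] plane_rotation_def[of _ _ "a + b"] u v
    unfolding plane_rotation_def cos_add sin_add
    by (simp add: algebra_simps)
qed

lemma plane_rotation_0 [simp]: "plane_rotation u v 0 x = x"
  by (simp add: plane_rotation_def)

lemma linear_plane_rotation: "linear (plane_rotation u v \<theta>)"
  by (rule linearI) (simp_all add: plane_rotation_def inner_simps algebra_simps)

lemma norm_plane_rotation:
  assumes "norm u = 1" "norm v = 1" "u \<bullet> v = 0"
  shows "norm (plane_rotation u v a x) = norm x"
proof -
  have [simp]: "u \<bullet> u = 1" "v \<bullet> v = 1" "v \<bullet> u = 0"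
    using assms by (simp_all add: dot_square_norm inner_commute)
  define p q where "p = u \<bullet> x" and "q = v \<bullet> x"
  define c s where "c = cos a" and "s = sin a"
  have cs: "s\<^sup>2 + c\<^sup>2 = 1"
    by (simp add: c_def s_def)
  have "plane_rotation u v a x \<bullet> plane_rotation u v a x
      = x \<bullet> x + 2 * ((c - 1) * p - s * q) * p + 2 * ((c - 1) * q + s * p) * q
        + ((c - 1) * p - s * q)\<^sup>2 + ((c - 1) * q + s * p)\<^sup>2"
    using assms
    by (simp add: plane_rotation_def inner_simps p_def[symmetric] q_def[symmetric]
        c_def[symmetric] s_def[symmetric] inner_commute[of x u] inner_commute[of x v])
      (simp add: algebra_simps power2_eq_square)
  also have "\<dots> = x \<bullet> x"
    using cs by algebra
  finally show ?thesis
    by (simp add: norm_eq_sqrt_inner)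
qed

text \<open>Orthogonality leaves the determinant 1 or -1; the matrix is the square of the one for
  half the angle, so its determinant is a square.\<close>

lemma rotation_matrix_plane_rotation:
  fixes u v :: "real^'n"
  assumes "norm u = 1" "norm v = 1" "u \<bullet> v = 0"
  shows "rotation_matrix (matrix (plane_rotation u v a))"
proof -
  have orth: "orthogonal_matrix (matrix (plane_rotation u v b))" for b
    using orthogonal_transformation[of "plane_rotation u v b"]
    by (simp add: orthogonal_transformation_matrix linear_plane_rotation norm_plane_rotation[OF assms])
  have "matrix (plane_rotation u v a)
      = matrix (plane_rotation u v (a/2)) ** matrix (plane_rotation u v (a/2))"
    using matrix_compose[OF linear_plane_rotation linear_plane_rotation, of u v "a/2" u v "a/2"]
    by (simp add: o_def plane_rotation_add[OF assms])
  then have "det (matrix (plane_rotation u v a)) = det (matrix (plane_rotation u v (a/2))) * det (matrix (plane_rotation u v (a/2)))"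
    by (simp add: det_mul)
  with det_orthogonal_matrix[OF orth[of "a/2"]] orth[of a] show ?thesis
    by (auto simp: rotation_matrix_def)
qed

lemma plane_rotation_in_sphere [simp]:
  assumes "norm u = 1" "norm v = 1" "u \<bullet> v = 0"
  shows "plane_rotation u v a x \<in> sphere 0 1 \<longleftrightarrow> x \<in> sphere 0 1"
  by (simp add: norm_plane_rotation[OF assms])

lemma plane_rotation_has_vector_derivative:
  "((\<lambda>\<theta>. plane_rotation u v \<theta> x) has_vector_derivative ((u \<bullet> x) *\<^sub>R v - (v \<bullet> x) *\<^sub>R u)) (at 0)"
  unfolding plane_rotation_def
  by (auto intro!: derivative_eq_intros simp: algebra_simps)

text \<open>The derivative along the field
  \<open>x \<mapsto> (u \<bullet> x) v - (v \<bullet> x) u\<close>. For orthonormal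
  \<open>u\<close>, \<open>v\<close> the orbit stays on the sphere, so only values there enter. A
  relation, since powers of \<open>|t|\<close> have only finitely many derivatives.\<close>

definition rotation_derivative ::
    "real^'n \<Rightarrow> real^'n \<Rightarrow> (real^'n \<Rightarrow> complex) \<Rightarrow> (real^'n \<Rightarrow> complex) \<Rightarrow> bool" where
  "rotation_derivative u v F G \<longleftrightarrow>
     (\<forall>x\<in>sphere 0 1. ((\<lambda>\<theta>. F (plane_rotation u v \<theta> x)) has_vector_derivative G x) (at 0))"

lemma vector_derivative_quotient_tendsto:
  assumes "(f has_vector_derivative D) (at (0::real))"
  shows "((\<lambda>t. (f t - f 0) /\<^sub>R t) \<longlongrightarrow> D) (at 0)"
proof (rule Lim_null[THEN iffD2], rule tendsto_norm_zero_cancel)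
  have "((\<lambda>t. norm (f (0 + t) - f 0 - t *\<^sub>R D) / norm t) \<longlongrightarrow> 0) (at 0)"
    using assms unfolding has_vector_derivative_def has_derivative_at by blast
  then show "((\<lambda>t. norm ((f t - f 0) /\<^sub>R t - D)) \<longlongrightarrow> 0) (at 0)"
  proof (rule Lim_transform_eventually)
    have "norm (f (0 + t) - f 0 - t *\<^sub>R D) / norm t = norm ((f t - f 0) /\<^sub>R t - D)" if "t \<noteq> 0" for t
    proof -
      have "(f t - f 0) /\<^sub>R t - D = (f (0 + t) - f 0 - t *\<^sub>R D) /\<^sub>R t"
        using that by (simp add: scaleR_diff_right)
      then show ?thesis
        by (simp add: divide_inverse_commute)
    qed
    then show "\<forall>\<^sub>F t in at 0. norm (f (0 + t) - f 0 - t *\<^sub>R D) / norm t = norm ((f t - f 0) /\<^sub>R t - D)"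
      by (simp add: eventually_at_filter)
  qed
qed

lemma rotation_derivative_mult:
  assumes "rotation_derivative u v F F'" "rotation_derivative u v G G'"
  shows "rotation_derivative u v (\<lambda>x. F x * G x) (\<lambda>x. F x * G' x + F' x * G x)"
  unfolding rotation_derivative_def
proof
  fix x :: "real^'a" assume "x \<in> sphere 0 1"
  then show "((\<lambda>\<theta>. F (plane_rotation u v \<theta> x) * G (plane_rotation u v \<theta> x)) has_vector_derivative
      F x * G' x + F' x * G x) (at 0)"
    using has_vector_derivative_mult[of "\<lambda>\<theta>. F (plane_rotation u v \<theta> x)" "F' x" 0 UNIV
        "\<lambda>\<theta>. G (plane_rotation u v \<theta> x)" "G' x"] assms
    by (simp add: rotation_derivative_def)
qed

lemma rotation_derivative_diff:
  assumes "rotation_derivative u v F F'" "rotation_derivative u v G G'"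
  shows "rotation_derivative u v (\<lambda>x. F x - G x) (\<lambda>x. F' x - G' x)"
  using assms by (auto simp: rotation_derivative_def intro!: derivative_intros)

lemma rotation_derivative_at:
  assumes uv: "norm u = 1" "norm v = 1" "u \<bullet> v = 0"
    and "rotation_derivative u v F G" "x \<in> sphere 0 1"
  shows "((\<lambda>\<theta>. F (plane_rotation u v \<theta> x)) has_vector_derivative G (plane_rotation u v a x)) (at a)"
proof -
  define y where "y = plane_rotation u v a x"
  have "y \<in> sphere 0 1"
    using assms(5) plane_rotation_in_sphere[OF uv] by (simp only: y_def)
  then have "((\<lambda>\<theta>. F (plane_rotation u v \<theta> y)) has_vector_derivative G y) (at (a - a))"
    using assms(4) by (simp add: rotation_derivative_def)
  then have "((\<lambda>\<theta>. F (plane_rotation u v \<theta> y)) \<circ> (\<lambda>\<theta>. \<theta> - a) has_vector_derivative (1::real) *\<^sub>R G y) (at a)"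
    by (intro vector_diff_chain_at) (auto intro!: derivative_eq_intros)
  then show ?thesis
    by (simp add: o_def y_def plane_rotation_add[OF uv])
qed

context sphere_measure
begin

text \<open>Invariance makes the integral of every difference quotient of \<open>F\<close> along the
  rotation 0, and the quotients converge to \<open>G\<close> under a uniform bound.\<close>

lemma integral_rotation_derivative_eq_0:
  assumes uv: "norm u = 1" "norm v = 1" "u \<bullet> v = 0"
    and FG: "rotation_derivative u v F G"
    and F: "continuous_on (sphere 0 1) F" and G: "continuous_on (sphere 0 1) G"
  shows "(\<integral>\<omega>. G \<omega> \<partial>M) = 0"
proof -
  obtain B where B: "\<And>x. x \<in> sphere 0 1 \<Longrightarrow> norm (G x) \<le> B"
    using bounded_continuous_on_sphere[OF G] by blast
  define h where "h k x = (F (plane_rotation u v (inverse (real (Suc k))) x) - F x) * of_nat (Suc k)" for k x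
  have R: "continuous_on (sphere 0 1) (\<lambda>x. F (plane_rotation u v a x))" for a
    by (rule continuous_on_compose2[OF F])
      (auto simp: linear_continuous_on linear_conv_bounded_linear[symmetric] linear_plane_rotation
        norm_plane_rotation[OF uv])
  have h0: "(\<integral>x. h k x \<partial>M) = 0" for k
  proof -
    let ?a = "inverse (real (Suc k))"
    have "(\<integral>x. F (plane_rotation u v ?a x) \<partial>M) = (\<integral>x. F x \<partial>M)"
      using integral_rotation[OF rotation_matrix_plane_rotation[OF uv, of ?a] measurable_continuous_on_sphere[OF F]]
      by (simp add: matrix_works linear_plane_rotation)
    then show ?thesis
      unfolding h_def
      by (simp add: integrable_continuous_on_sphere[OF R] integrable_continuous_on_sphere[OF F])
  qed
  have "(\<lambda>k. \<integral>x. h k x \<partial>M) \<longlonglongrightarrow> (\<integral>x. G x \<partial>M)"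
  proof (rule integral_dominated_convergence)
    show "AE x in M. (\<lambda>k. h k x) \<longlonglongrightarrow> G x"
    proof (rule AE_I2)
      fix x assume "x \<in> space M"
      then have "((\<lambda>\<theta>. F (plane_rotation u v \<theta> x)) has_vector_derivative G x) (at 0)"
        using FG by (simp add: rotation_derivative_def space_M)
      then have "((\<lambda>t. (F (plane_rotation u v t x) - F (plane_rotation u v 0 x)) /\<^sub>R t) \<longlongrightarrow> G x) (at 0)"
        by (rule vector_derivative_quotient_tendsto)
      then have "(\<lambda>k. (F (plane_rotation u v (inverse (real (Suc k))) x) - F (plane_rotation u v 0 x)) /\<^sub>R (inverse (real (Suc k)))) \<longlonglongrightarrow> G x"
        by (rule tendsto_compose_eventually[OF _ LIMSEQ_inverse_real_of_nat]) (auto intro!: always_eventually)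
      then show "(\<lambda>k. h k x) \<longlonglongrightarrow> G x"
        by (simp add: h_def scaleR_conv_of_real mult.commute)
    qed
    show "AE x in M. norm (h k x) \<le> B" for k
    proof (rule AE_I2)
      fix x assume x: "x \<in> space M"
      let ?a = "inverse (real (Suc k))"
      \<comment> \<open>The mean value inequality along the orbit bounds all quotients by the
        supremum \<open>B\<close> of \<open>G\<close>.\<close>
      have "norm (F (plane_rotation u v ?a x) - F (plane_rotation u v 0 x)) \<le> B * norm (?a - 0)"
      proof (rule differentiable_bound[where S = UNIV])
        show "((\<lambda>\<theta>. F (plane_rotation u v \<theta> x)) has_derivative (\<lambda>h. h *\<^sub>R G (plane_rotation u v a x))) (at a within UNIV)" for a
          using rotation_derivative_at[OF uv FG] x by (simp add: space_M has_vector_derivative_def)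
        show "onorm (\<lambda>h. h *\<^sub>R G (plane_rotation u v a x)) \<le> B" for a
          using x B[of "plane_rotation u v a x"]
          by (intro onorm_le) (simp add: space_M norm_plane_rotation[OF uv] mult.commute[of B] mult_left_mono)
      qed auto
      then show "norm (h k x) \<le> B"
        unfolding h_def norm_mult norm_of_nat by (simp add: field_simps del: of_nat_Suc)
    qed
    show "integrable M (\<lambda>x. B)"
      by simp
    show "G \<in> borel_measurable M"
      by (intro measurable_continuous_on_sphere G)
    show "h k \<in> borel_measurable M" for k
      unfolding h_def[abs_def]
      by (intro measurable_continuous_on_sphere continuous_intros R F)
  qed
  then show ?thesis
    using h0 by (simp add: LIMSEQ_const_iff)
qed

end

section \<open>The Laplacian on the sphere\<close>

definition angular_derivatives ::
    "(real^'n \<Rightarrow> complex) \<Rightarrow> ('n \<Rightarrow> 'n \<Rightarrow> real^'n \<Rightarrow> complex) \<Rightarrow> ('n \<Rightarrow> 'n \<Rightarrow> real^'n \<Rightarrow> complex) \<Rightarrow> bool" where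
  "angular_derivatives f D DD \<longleftrightarrow> continuous_on (sphere 0 1) f \<and>
     (\<forall>i j. i \<noteq> j \<longrightarrow> continuous_on (sphere 0 1) (D i j) \<and> continuous_on (sphere 0 1) (DD i j) \<and>
        rotation_derivative (axis i 1) (axis j 1) f (D i j) \<and>
        rotation_derivative (axis i 1) (axis j 1) (D i j) (DD i j))"

text \<open>The Casimir element of the rotation group, which acts on the sphere as its Laplacian.
  The half compensates for each plane occurring as \<open>(i, j)\<close> and as
  \<open>(j, i)\<close>; the diagonal has no plane.\<close>

definition has_laplacian :: "(real^'n \<Rightarrow> complex) \<Rightarrow> (real^'n \<Rightarrow> complex) \<Rightarrow> bool" where
  "has_laplacian f L \<longleftrightarrow> (\<exists>D DD. angular_derivatives f D DD \<and>
     (\<forall>x\<in>sphere 0 1. L x = (\<Sum>i\<in>UNIV. \<Sum>j\<in>UNIV. if i = j then 0 else DD i j x) / 2))"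

lemma has_laplacianI:
  assumes "continuous_on (sphere 0 1) f"
    and "\<And>i j. i \<noteq> j \<Longrightarrow> continuous_on (sphere 0 1) (D i j)"
    and "\<And>i j. i \<noteq> j \<Longrightarrow> continuous_on (sphere 0 1) (DD i j)"
    and "\<And>i j. i \<noteq> j \<Longrightarrow> rotation_derivative (axis i 1) (axis j 1) f (D i j)"
    and "\<And>i j. i \<noteq> j \<Longrightarrow> rotation_derivative (axis i 1) (axis j 1) (D i j) (DD i j)"
    and "\<And>x. x \<in> sphere 0 1 \<Longrightarrow> L x = (\<Sum>i\<in>UNIV. \<Sum>j\<in>UNIV. if i = j then 0 else DD i j x) / 2"
  shows "has_laplacian f L"
  unfolding has_laplacian_def angular_derivatives_def
  by (intro exI[of _ D] exI[of _ DD] conjI allI impI ballI assms)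

lemma has_laplacian_continuous:
  assumes "has_laplacian f L"
  shows "continuous_on (sphere 0 1) f" "continuous_on (sphere 0 1) L"
proof -
  obtain D DD where D: "angular_derivatives f D DD"
    and L: "\<forall>x\<in>sphere 0 1. L x = (\<Sum>i\<in>UNIV. \<Sum>j\<in>UNIV. if i = j then 0 else DD i j x) / 2"
    using assms unfolding has_laplacian_def by blast
  show "continuous_on (sphere 0 1) f"
    using D by (simp add: angular_derivatives_def)
  have "continuous_on (sphere 0 1) (\<lambda>x. if i = j then 0 else DD i j x)" for i j
    using D by (cases "i = j") (auto simp: angular_derivatives_def)
  then have "continuous_on (sphere 0 1) (\<lambda>x. (\<Sum>i\<in>UNIV. \<Sum>j\<in>UNIV. if i = j then 0 else DD i j x) / 2)"
    by (intro continuous_intros) auto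
  then show "continuous_on (sphere 0 1) L"
    by (rule continuous_on_eq) (rule L[THEN bspec, symmetric])
qed

lemma orthonormal_axis:
  assumes "i \<noteq> j"
  shows "norm (axis i (1::real)) = 1" "norm (axis j (1::real)) = 1" "axis i (1::real) \<bullet> axis j 1 = 0"
  using assms by (auto simp: inner_axis_axis)

context sphere_measure
begin

text \<open>Plane by plane: \<open>D i j x * q x - f x * E i j x\<close> has the rotation derivative
  \<open>D2 i j x * q x - f x * E2 i j x\<close>, because the mixed terms cancel, and that
  derivative has integral 0.\<close>

lemma green_identity:
  fixes f L q K :: "real^'n \<Rightarrow> complex"
  assumes f: "has_laplacian f L" and q: "has_laplacian q K"
  shows "(\<integral>\<omega>. L \<omega> * q \<omega> \<partial>M) = (\<integral>\<omega>. f \<omega> * K \<omega> \<partial>M)"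
proof -
  note [continuous_intros] = has_laplacian_continuous(1)[OF f] has_laplacian_continuous(1)[OF q]
  obtain D DD where D: "angular_derivatives f D DD"
    and L: "\<forall>x\<in>sphere 0 1. L x = (\<Sum>i\<in>UNIV. \<Sum>j\<in>UNIV. if i = j then 0 else DD i j x) / 2"
    using f unfolding has_laplacian_def by blast
  obtain E EE where E: "angular_derivatives q E EE"
    and K: "\<forall>x\<in>sphere 0 1. K x = (\<Sum>i\<in>UNIV. \<Sum>j\<in>UNIV. if i = j then 0 else EE i j x) / 2"
    using q unfolding has_laplacian_def by blast
  define D2 where "D2 i j = (\<lambda>x. if i = j then 0 else DD i j x)" for i j
  define E2 where "E2 i j = (\<lambda>x. if i = j then 0 else EE i j x)" for i j
  have [continuous_intros]: "continuous_on (sphere 0 1) (D2 i j)" "continuous_on (sphere 0 1) (E2 i j)" for i j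
    using D E by (cases "i = j"; simp add: D2_def E2_def angular_derivatives_def)+
  have L': "L x = (\<Sum>i\<in>UNIV. \<Sum>j\<in>UNIV. D2 i j x) / 2"
    and K': "K x = (\<Sum>i\<in>UNIV. \<Sum>j\<in>UNIV. E2 i j x) / 2" if "x \<in> space M" for x
    using L K that unfolding D2_def E2_def space_M by blast+
  have *: "(\<integral>\<omega>. D2 i j \<omega> * q \<omega> \<partial>M) = (\<integral>\<omega>. f \<omega> * E2 i j \<omega> \<partial>M)" for i j
  proof (cases "i = j")
    case False
    then have [continuous_intros]: "continuous_on (sphere 0 1) (D i j)" "continuous_on (sphere 0 1) (E i j)"
      and rot: "rotation_derivative (axis i 1) (axis j 1) f (D i j)"
        "rotation_derivative (axis i 1) (axis j 1) (D i j) (D2 i j)"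
        "rotation_derivative (axis i 1) (axis j 1) q (E i j)"
        "rotation_derivative (axis i 1) (axis j 1) (E i j) (E2 i j)"
      using D E by (auto simp: angular_derivatives_def D2_def E2_def)
    have "rotation_derivative (axis i 1) (axis j 1) (\<lambda>x. D i j x * q x - f x * E i j x)
       (\<lambda>x. (D i j x * E i j x + D2 i j x * q x) - (f x * E2 i j x + D i j x * E i j x))"
      by (intro rotation_derivative_diff rotation_derivative_mult rot)
    then have "(\<integral>x. (D i j x * E i j x + D2 i j x * q x) - (f x * E2 i j x + D i j x * E i j x) \<partial>M) = 0"
      by (rule integral_rotation_derivative_eq_0[OF orthonormal_axis[OF False]]) (intro continuous_intros)+
    also have "(\<lambda>x. (D i j x * E i j x + D2 i j x * q x) - (f x * E2 i j x + D i j x * E i j x))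
        = (\<lambda>x. D2 i j x * q x - f x * E2 i j x)"
      by (simp add: fun_eq_iff)
    finally show ?thesis
      by (simp add: integrable_continuous_on_sphere continuous_intros)
  qed (simp add: D2_def E2_def)
  have "(\<integral>\<omega>. L \<omega> * q \<omega> \<partial>M) = (\<integral>\<omega>. (\<Sum>i\<in>UNIV. \<Sum>j\<in>UNIV. D2 i j \<omega> * q \<omega>) / 2 \<partial>M)"
    by (intro Bochner_Integration.integral_cong refl) (simp add: L' sum_distrib_right)
  also have "\<dots> = (\<Sum>i\<in>UNIV. \<Sum>j\<in>UNIV. (\<integral>\<omega>. D2 i j \<omega> * q \<omega> \<partial>M)) / 2"
    by (simp add: integrable_continuous_on_sphere continuous_intros)
  also have "\<dots> = (\<Sum>i\<in>UNIV. \<Sum>j\<in>UNIV. (\<integral>\<omega>. f \<omega> * E2 i j \<omega> \<partial>M)) / 2"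
    by (simp add: *)
  also have "\<dots> = (\<integral>\<omega>. (\<Sum>i\<in>UNIV. \<Sum>j\<in>UNIV. f \<omega> * E2 i j \<omega>) / 2 \<partial>M)"
    by (simp add: integrable_continuous_on_sphere continuous_intros)
  also have "\<dots> = (\<integral>\<omega>. f \<omega> * K \<omega> \<partial>M)"
    by (intro Bochner_Integration.integral_cong refl) (simp add: K' sum_distrib_left)
  finally show ?thesis .
qed

lemma has_laplacian_const: "has_laplacian (\<lambda>x::real^'n. c) (\<lambda>x. 0)"
  by (rule has_laplacianI[where D = "\<lambda>i j x. 0" and DD = "\<lambda>i j x. 0"])
    (auto simp: rotation_derivative_def)

lemma integral_laplacian_eq_0:
  "has_laplacian f L \<Longrightarrow> (\<integral>\<omega>. L \<omega> \<partial>M) = 0"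
  using green_identity[OF _ has_laplacian_const, of f L 1] by simp

end

text \<open>Under rotation in the plane \<open>(i, j)\<close> the argument
  \<open>\<xi> \<bullet> x\<close> moves with speed \<open>s i j x\<close>, so the chain rule leaves
  two sums over all planes: of the squared speeds, with \<phi>'', and of the derivatives of the
  speeds, with \<phi>'.\<close>

lemma has_laplacian_zonal:
  fixes \<xi> :: "real^'n"
  assumes \<xi>: "\<xi> \<in> sphere 0 1"
    and d1: "\<And>t. (\<phi> has_vector_derivative \<phi>' t) (at t)"
    and d2: "\<And>t. (\<phi>' has_vector_derivative \<phi>'' t) (at t)"
    and cont: "continuous_on UNIV \<phi>''"
  shows "has_laplacian (\<lambda>x. \<phi> (\<xi> \<bullet> x))
    (\<lambda>x. of_real (1 - (\<xi> \<bullet> x)\<^sup>2) * \<phi>'' (\<xi> \<bullet> x)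
        - of_real ((real CARD('n) - 1) * (\<xi> \<bullet> x)) * \<phi>' (\<xi> \<bullet> x))"
proof (rule has_laplacianI)
  define s where "s i j x = x $ i * \<xi> $ j - x $ j * \<xi> $ i" for i j and x :: "real^'n"
  define D1 where "D1 i j x = of_real (s i j x) * \<phi>' (\<xi> \<bullet> x)" for i j and x :: "real^'n"
  define D2 where "D2 i j x = of_real (s i j x) * (of_real (s i j x) * \<phi>'' (\<xi> \<bullet> x))
      + of_real (- x $ j * \<xi> $ j - x $ i * \<xi> $ i) * \<phi>' (\<xi> \<bullet> x)" for i j and x :: "real^'n"
  have c0: "continuous_on UNIV \<phi>" and c1: "continuous_on UNIV \<phi>'"
    using has_vector_derivative_continuous[OF d1] has_vector_derivative_continuous[OF d2]
    by (auto intro!: continuous_at_imp_continuous_on)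
  have cc: "continuous_on (sphere 0 1) (\<lambda>x. \<phi> (\<xi> \<bullet> x))" "continuous_on (sphere 0 1) (\<lambda>x. \<phi>' (\<xi> \<bullet> x))"
    "continuous_on (sphere 0 1) (\<lambda>x. \<phi>'' (\<xi> \<bullet> x))"
    using continuous_on_compose2[OF c0 continuous_on_inner[OF continuous_on_const continuous_on_id]]
      continuous_on_compose2[OF c1 continuous_on_inner[OF continuous_on_const continuous_on_id]]
      continuous_on_compose2[OF cont continuous_on_inner[OF continuous_on_const continuous_on_id]]
    by auto
  then show "continuous_on (sphere 0 1) (\<lambda>x. \<phi> (\<xi> \<bullet> x))"
    by simp
  show "continuous_on (sphere 0 1) (D1 i j)" "continuous_on (sphere 0 1) (D2 i j)" for i j
    unfolding D1_def[abs_def] D2_def[abs_def] s_def by (intro continuous_intros cc)+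
  have chain: "((\<lambda>\<theta>. \<psi> (\<xi> \<bullet> plane_rotation (axis i 1) (axis j 1) \<theta> x)) has_vector_derivative
      of_real (s i j x) * \<psi>' (\<xi> \<bullet> x)) (at 0)"
    if "\<And>t. (\<psi> has_vector_derivative \<psi>' t) (at t)" for \<psi> \<psi>' :: "real \<Rightarrow> complex" and i j x
  proof -
    have "((\<lambda>\<theta>. \<xi> \<bullet> plane_rotation (axis i 1) (axis j 1) \<theta> x) has_vector_derivative
        \<xi> \<bullet> ((axis i 1 \<bullet> x) *\<^sub>R axis j 1 - (axis j 1 \<bullet> x) *\<^sub>R axis i 1)) (at 0)"
      by (intro bounded_linear.has_vector_derivative[OF bounded_linear_inner_right]
          plane_rotation_has_vector_derivative)
    then have "((\<lambda>\<theta>. \<xi> \<bullet> plane_rotation (axis i 1) (axis j 1) \<theta> x) has_vector_derivative s i j x) (at 0)"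
      by (simp add: s_def inner_diff_right inner_axis inner_axis')
    from vector_diff_chain_at[OF this, of \<psi> "\<psi>' (\<xi> \<bullet> x)"] that show ?thesis
      by (simp add: o_def scaleR_conv_of_real)
  qed
  show "rotation_derivative (axis i 1) (axis j 1) (\<lambda>x. \<phi> (\<xi> \<bullet> x)) (D1 i j)" for i j
    unfolding rotation_derivative_def D1_def using chain[of \<phi> \<phi>'] d1 by blast
  show "rotation_derivative (axis i 1) (axis j 1) (D1 i j) (D2 i j)" if "i \<noteq> j" for i j
    unfolding D1_def[abs_def] D2_def[abs_def]
  proof (rule rotation_derivative_mult)
    show "rotation_derivative (axis i 1) (axis j 1) (\<lambda>x. \<phi>' (\<xi> \<bullet> x)) (\<lambda>x. of_real (s i j x) * \<phi>'' (\<xi> \<bullet> x))"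
      unfolding rotation_derivative_def using chain[of \<phi>' \<phi>''] d2 by blast
    have "((\<lambda>\<theta>. s i j (plane_rotation (axis i 1) (axis j 1) \<theta> x)) has_vector_derivative
        - x $ j * \<xi> $ j - x $ i * \<xi> $ i) (at 0)" for x
    proof -
      have s_eq: "s i j y = (\<xi> $ j *\<^sub>R axis i 1 - \<xi> $ i *\<^sub>R axis j 1) \<bullet> y" for y
        by (simp add: s_def inner_diff_left inner_axis')
      have [simp]: "axis i (1::real) $ j = 0" "axis j (1::real) $ i = 0"
        using that by (simp_all add: axis_def)
      show ?thesis
        unfolding s_eq
        by (rule has_vector_derivative_eq_rhs[OF bounded_linear.has_vector_derivative[OF bounded_linear_inner_right
                plane_rotation_has_vector_derivative]])
          (use that in \<open>simp add: inner_diff_left inner_diff_right inner_axis_axis inner_axis' algebra_simps\<close>)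
    qed
    then show "rotation_derivative (axis i 1) (axis j 1) (\<lambda>x. complex_of_real (s i j x))
        (\<lambda>x. complex_of_real (- x $ j * \<xi> $ j - x $ i * \<xi> $ i))"
      unfolding rotation_derivative_def
      by (intro ballI bounded_linear.has_vector_derivative[OF bounded_linear_of_real])
  qed
  show "of_real (1 - (\<xi> \<bullet> x)\<^sup>2) * \<phi>'' (\<xi> \<bullet> x) - of_real ((real CARD('n) - 1) * (\<xi> \<bullet> x)) * \<phi>' (\<xi> \<bullet> x)
      = (\<Sum>i\<in>UNIV. \<Sum>j\<in>UNIV. if i = j then 0 else D2 i j x) / 2"
    if x: "x \<in> sphere 0 1" for x
  proof -
    have t: "\<xi> \<bullet> x = (\<Sum>i\<in>UNIV. x $ i * \<xi> $ i)"
      by (simp add: inner_vec_def mult.commute)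
    have nx: "(\<Sum>i\<in>UNIV. x $ i * x $ i) = 1" and n\<xi>: "(\<Sum>i\<in>UNIV. \<xi> $ i * \<xi> $ i) = 1"
      using x \<xi> by (simp_all add: norm_eq_1 inner_vec_def)
    \<comment> \<open>Lagrange's identity for the 2 by 2 minors of two unit vectors.\<close>
    have "(\<Sum>i\<in>UNIV. \<Sum>j\<in>UNIV. (s i j x)\<^sup>2)
        = (\<Sum>i\<in>UNIV. \<Sum>j\<in>UNIV. (x$i * x$i) * (\<xi>$j * \<xi>$j)) + (\<Sum>i\<in>UNIV. \<Sum>j\<in>UNIV. (\<xi>$i * \<xi>$i) * (x$j * x$j))
          - 2 * (\<Sum>i\<in>UNIV. \<Sum>j\<in>UNIV. (x$i * \<xi>$i) * (x$j * \<xi>$j))"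
      by (simp add: s_def sum_distrib_left sum.distrib[symmetric] sum_subtractf[symmetric]
          power2_eq_square algebra_simps)
    also have "\<dots> = 2 * (1 - (\<xi> \<bullet> x)\<^sup>2)"
      by (simp add: sum_product[symmetric] nx n\<xi> t power2_eq_square)
    finally have A: "(\<Sum>i\<in>UNIV. \<Sum>j\<in>UNIV. (s i j x)\<^sup>2) = 2 * (1 - (\<xi> \<bullet> x)\<^sup>2)" .
    \<comment> \<open>Filling in the diagonal and correcting for it decouples the double sum; the
      correction turns \<open>CARD('n)\<close> into \<open>CARD('n) - 1\<close>.\<close>
    have "(\<Sum>i\<in>UNIV. \<Sum>j\<in>UNIV. if i = j then 0 else - x $ j * \<xi> $ j - x $ i * \<xi> $ i)
        = (\<Sum>i\<in>UNIV. \<Sum>j\<in>UNIV. (- x $ j * \<xi> $ j - x $ i * \<xi> $ i) + (if i = j then 2 * (x $ i * \<xi> $ i) else 0))"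
      by (intro sum.cong refl) auto
    also have "\<dots> = - 2 * real CARD('n) * (\<xi> \<bullet> x) + 2 * (\<xi> \<bullet> x)"
      by (simp add: sum.distrib sum_subtractf sum_negf t sum_distrib_left[symmetric])
    finally have B: "(\<Sum>i\<in>UNIV. \<Sum>j\<in>UNIV. if i = j then 0 else - x $ j * \<xi> $ j - x $ i * \<xi> $ i)
        = - 2 * (real CARD('n) - 1) * (\<xi> \<bullet> x)"
      by (simp add: algebra_simps)
    have "(\<Sum>i\<in>UNIV. \<Sum>j\<in>UNIV. if i = j then 0 else D2 i j x)
        = (\<Sum>i\<in>UNIV. \<Sum>j\<in>UNIV. of_real ((s i j x)\<^sup>2) * \<phi>'' (\<xi> \<bullet> x)
            + of_real (if i = j then 0 else - x $ j * \<xi> $ j - x $ i * \<xi> $ i) * \<phi>' (\<xi> \<bullet> x))"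
      by (intro sum.cong refl) (auto simp: D2_def s_def power2_eq_square)
    also have "\<dots> = of_real (\<Sum>i\<in>UNIV. \<Sum>j\<in>UNIV. (s i j x)\<^sup>2) * \<phi>'' (\<xi> \<bullet> x)
        + of_real (\<Sum>i\<in>UNIV. \<Sum>j\<in>UNIV. if i = j then 0 else - x $ j * \<xi> $ j - x $ i * \<xi> $ i) * \<phi>' (\<xi> \<bullet> x)"
      by (simp only: of_real_sum sum_distrib_right sum.distrib)
    finally show ?thesis
      unfolding A B by (simp add: algebra_simps)
  qed
qed

section \<open>Closure of smoothness under rotation derivatives\<close>

lemma k_times_differentiable_on_cong:
  assumes "open U" "\<And>x. x \<in> U \<Longrightarrow> f x = g x" "k_times_differentiable_on k U f"
  shows "k_times_differentiable_on k U g"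
  using assms(2,3)
proof (induction k arbitrary: f g)
  case 0
  then show ?case
    by (simp cong: continuous_on_cong)
next
  case (Suc k)
  have d: "f differentiable (at x)" if "x \<in> U" for x
    using Suc.prems that by simp
  have "g differentiable (at x)" if "x \<in> U" for x
    using d[OF that] assms(1) that Suc.prems(1)
    unfolding differentiable_def by (metis has_derivative_transform_within_open)
  moreover have "k_times_differentiable_on k U (\<lambda>x. frechet_derivative g (at x) v)" for v
  proof (rule Suc.IH)
    show "k_times_differentiable_on k U (\<lambda>x. frechet_derivative f (at x) v)"
      using Suc.prems(2) by simp
    show "frechet_derivative f (at x) v = frechet_derivative g (at x) v" if "x \<in> U" for x
      using frechet_derivative_transform_within_open[OF d[OF that] assms(1) that Suc.prems(1)] by simp
  qed
  ultimately show ?case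
    by simp
qed

lemma k_times_differentiable_on_SucD:
  "k_times_differentiable_on (Suc k) U f \<Longrightarrow> k_times_differentiable_on k U f"
proof (induction k arbitrary: f)
  case 0
  then show ?case
    by (auto intro!: continuous_at_imp_continuous_on differentiable_imp_continuous_within)
next
  case (Suc k)
  then show ?case
    by (metis k_times_differentiable_on.simps(2))
qed

lemma k_times_differentiable_on_add:
  assumes "open U" "k_times_differentiable_on k U f" "k_times_differentiable_on k U g"
  shows "k_times_differentiable_on k U (\<lambda>x. f x + g x)"
  using assms(2,3)
proof (induction k arbitrary: f g)
  case 0
  then show ?case
    by (simp add: continuous_on_add)
next
  case (Suc k)
  have "k_times_differentiable_on k U (\<lambda>x. frechet_derivative (\<lambda>x. f x + g x) (at x) v)" for v
  proof (rule k_times_differentiable_on_cong[OF assms(1)])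
    show "k_times_differentiable_on k U (\<lambda>x. frechet_derivative f (at x) v + frechet_derivative g (at x) v)"
      using Suc by simp
    show "frechet_derivative f (at x) v + frechet_derivative g (at x) v = frechet_derivative (\<lambda>x. f x + g x) (at x) v"
      if "x \<in> U" for x
      using Suc.prems that
      using frechet_derivative_at[OF has_derivative_add[OF frechet_derivative_works[THEN iffD1]
            frechet_derivative_works[THEN iffD1]], of f x g]
      by (auto dest!: fun_cong[where x = v])
  qed
  then show ?case
    using Suc.prems by simp
qed

text \<open>Rotation fields have linear coefficients, so affine factors are the only products that
  occur. Their derivative is constant, hence affine again with slope 0, which closes the
  induction.\<close>

lemma k_times_differentiable_on_scaleR_affine:
  assumes "open U" "k_times_differentiable_on k U f"
  shows "k_times_differentiable_on k U (\<lambda>x. (c + a \<bullet> x) *\<^sub>R f x)"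
  using assms(2)
proof (induction k arbitrary: f a c)
  case 0
  then show ?case
    by (auto intro!: continuous_intros)
next
  case (Suc k)
  have der: "((\<lambda>x. (c + a \<bullet> x) *\<^sub>R f x) has_derivative
      (\<lambda>v. (c + a \<bullet> x) *\<^sub>R frechet_derivative f (at x) v + (a \<bullet> v) *\<^sub>R f x)) (at x)"
    if "x \<in> U" for x
  proof -
    have "((\<lambda>x. c + a \<bullet> x) has_derivative (\<lambda>v. a \<bullet> v)) (at x)"
      by (auto intro!: derivative_eq_intros)
    moreover have "(f has_derivative frechet_derivative f (at x)) (at x)"
      using Suc.prems that by (auto simp: frechet_derivative_works)
    ultimately show ?thesis
      by (rule has_derivative_scaleR)
  qed
  have "k_times_differentiable_on k U (\<lambda>x. frechet_derivative (\<lambda>x. (c + a \<bullet> x) *\<^sub>R f x) (at x) v)" for v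
  proof (rule k_times_differentiable_on_cong[OF assms(1)])
    have "k_times_differentiable_on k U (\<lambda>x. (a \<bullet> v + 0 \<bullet> x) *\<^sub>R f x)"
      by (rule Suc.IH[OF k_times_differentiable_on_SucD[OF Suc.prems]])
    then show "k_times_differentiable_on k U (\<lambda>x. (c + a \<bullet> x) *\<^sub>R frechet_derivative f (at x) v + (a \<bullet> v) *\<^sub>R f x)"
      using Suc.IH[of "\<lambda>x. frechet_derivative f (at x) v" c a] Suc.prems
      by (intro k_times_differentiable_on_add assms) simp_all
    show "(c + a \<bullet> x) *\<^sub>R frechet_derivative f (at x) v + (a \<bullet> v) *\<^sub>R f x
        = frechet_derivative (\<lambda>x. (c + a \<bullet> x) *\<^sub>R f x) (at x) v"
      if "x \<in> U" for x
      using frechet_derivative_at[OF der[OF that]] by metis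
  qed
  moreover have "(\<lambda>x. (c + a \<bullet> x) *\<^sub>R f x) differentiable (at x)" if "x \<in> U" for x
    using der[OF that] by (rule differentiableI)
  ultimately show ?case
    by simp
qed

lemma smooth_on_open_add:
  "smooth_on_open U f \<Longrightarrow> smooth_on_open U g \<Longrightarrow> smooth_on_open U (\<lambda>x. f x + g x)"
  by (auto simp: smooth_on_open_def intro: k_times_differentiable_on_add)

lemma smooth_on_open_scaleR_affine:
  "smooth_on_open U f \<Longrightarrow> smooth_on_open U (\<lambda>x. (c + a \<bullet> x) *\<^sub>R f x)"
  by (auto simp: smooth_on_open_def intro: k_times_differentiable_on_scaleR_affine)

lemma smooth_on_open_zero:
  assumes "open U"
  shows "smooth_on_open U (\<lambda>x. 0 :: 'b::real_normed_vector)"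
proof -
  have "k_times_differentiable_on k U (\<lambda>x. 0 :: 'b)" for k
    by (induction k) auto
  then show ?thesis
    using assms by (simp add: smooth_on_open_def)
qed

lemma smooth_on_open_sum:
  assumes "open U" "\<And>i. i \<in> I \<Longrightarrow> smooth_on_open U (f i)"
  shows "smooth_on_open U (\<lambda>x. \<Sum>i\<in>I. f i x)"
  using assms(2)
  by (induction I rule: infinite_finite_induct) (auto intro: smooth_on_open_zero smooth_on_open_add assms(1))

lemma smooth_on_open_cong:
  "smooth_on_open U f \<Longrightarrow> (\<And>x. x \<in> U \<Longrightarrow> f x = g x) \<Longrightarrow> smooth_on_open U g"
  unfolding smooth_on_open_def using k_times_differentiable_on_cong by blast

lemma smooth_on_open_has_derivative:
  "smooth_on_open U f \<Longrightarrow> x \<in> U \<Longrightarrow> (f has_derivative frechet_derivative f (at x)) (at x)"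
  unfolding smooth_on_open_def
  by (metis frechet_derivative_works k_times_differentiable_on.simps(2))

lemma smooth_on_open_continuous_on: "smooth_on_open U f \<Longrightarrow> continuous_on U f"
  unfolding smooth_on_open_def by (metis k_times_differentiable_on.simps(1))

definition angular_derivative :: "'n \<Rightarrow> 'n \<Rightarrow> (real^'n \<Rightarrow> complex) \<Rightarrow> real^'n \<Rightarrow> complex" where
  "angular_derivative i j f x = frechet_derivative f (at x) (x $ i *\<^sub>R axis j 1 - x $ j *\<^sub>R axis i 1)"

lemma smooth_on_open_angular_derivative:
  assumes "smooth_on_open U f"
  shows "smooth_on_open U (angular_derivative i j f)"
proof -
  have v: "smooth_on_open U (\<lambda>x. frechet_derivative f (at x) v)" for v
    using assms unfolding smooth_on_open_def by (metis k_times_differentiable_on.simps(2))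
  have "smooth_on_open U (\<lambda>x. (0 + axis i 1 \<bullet> x) *\<^sub>R frechet_derivative f (at x) (axis j 1)
      + (0 + (- axis j 1) \<bullet> x) *\<^sub>R frechet_derivative f (at x) (axis i 1))"
    by (intro smooth_on_open_add smooth_on_open_scaleR_affine v)
  then show ?thesis
  proof (rule smooth_on_open_cong)
    fix x assume "x \<in> U"
    then have "linear (frechet_derivative f (at x))"
      using smooth_on_open_has_derivative[OF assms] has_derivative_linear by blast
    then show "(0 + axis i 1 \<bullet> x) *\<^sub>R frechet_derivative f (at x) (axis j 1)
        + (0 + (- axis j 1) \<bullet> x) *\<^sub>R frechet_derivative f (at x) (axis i 1) = angular_derivative i j f x"
      by (simp add: angular_derivative_def linear_diff linear_scale inner_axis')
  qed
qed

lemma rotation_derivative_angular_derivative: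
  assumes "smooth_on_open U f" "sphere 0 1 \<subseteq> U"
  shows "rotation_derivative (axis i 1) (axis j 1) f (angular_derivative i j f)"
  unfolding rotation_derivative_def
proof
  fix x :: "real^'a" assume x: "x \<in> sphere 0 1"
  have "(f has_derivative frechet_derivative f (at x)) (at (plane_rotation (axis i 1) (axis j 1) 0 x))"
    using smooth_on_open_has_derivative[OF assms(1)] x assms(2) by auto
  from has_derivative_compose[OF plane_rotation_has_vector_derivative[unfolded has_vector_derivative_def] this]
  show "((\<lambda>\<theta>. f (plane_rotation (axis i 1) (axis j 1) \<theta> x)) has_vector_derivative angular_derivative i j f x) (at 0)"
    using has_derivative_linear[OF smooth_on_open_has_derivative[OF assms(1)]] x assms(2)
    by (auto simp: has_vector_derivative_def angular_derivative_def inner_axis' linear_scale)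
qed

text \<open>An operator on functions near the sphere, in contrast to the relation
  \<open>has_laplacian\<close>, so that it can be iterated.\<close>

definition laplacian :: "(real^'n \<Rightarrow> complex) \<Rightarrow> real^'n \<Rightarrow> complex" where
  "laplacian f x = (\<Sum>i\<in>UNIV. \<Sum>j\<in>UNIV. if i = j then 0 else angular_derivative i j (angular_derivative i j f) x) / 2"

lemma smooth_on_open_laplacian:
  assumes "smooth_on_open U f"
  shows "smooth_on_open U (laplacian f)"
proof -
  have op: "open U"
    using assms by (simp add: smooth_on_open_def)
  have "smooth_on_open U (\<lambda>x. (1/2 + 0 \<bullet> x) *\<^sub>R (\<Sum>i\<in>UNIV. \<Sum>j\<in>UNIV. if i = j then 0
      else angular_derivative i j (angular_derivative i j f) x))"
  proof (intro smooth_on_open_scaleR_affine smooth_on_open_sum op)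
    show "smooth_on_open U (\<lambda>x. if i = j then 0 else angular_derivative i j (angular_derivative i j f) x)" for i j
      using smooth_on_open_angular_derivative[OF smooth_on_open_angular_derivative[OF assms], of i j i j]
        smooth_on_open_zero[OF op]
      by (cases "i = j") auto
  qed
  then show ?thesis
    by (rule smooth_on_open_cong) (simp add: laplacian_def scaleR_conv_of_real)
qed

lemma has_laplacian_smooth:
  assumes "smooth_on_open U f" "sphere 0 1 \<subseteq> U"
  shows "has_laplacian f (laplacian f)"
proof (rule has_laplacianI)
  note s1 = smooth_on_open_angular_derivative[OF assms(1)]
  note s2 = smooth_on_open_angular_derivative[OF s1]
  show "continuous_on (sphere 0 1) f"
    using smooth_on_open_continuous_on[OF assms(1)] assms(2) continuous_on_subset by blast
  show "continuous_on (sphere 0 1) (angular_derivative i j f)" for i j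
    using smooth_on_open_continuous_on[OF s1] assms(2) continuous_on_subset by blast
  show "continuous_on (sphere 0 1) (angular_derivative i j (angular_derivative i j f))" for i j
    using smooth_on_open_continuous_on[OF s2] assms(2) continuous_on_subset by blast
  show "rotation_derivative (axis i 1) (axis j 1) f (angular_derivative i j f)" for i j
    by (rule rotation_derivative_angular_derivative[OF assms])
  show "rotation_derivative (axis i 1) (axis j 1) (angular_derivative i j f)
     (angular_derivative i j (angular_derivative i j f))" for i j
    by (rule rotation_derivative_angular_derivative[OF s1 assms(2)])
qed (simp add: laplacian_def)

section \<open>Linearity of the Laplacian\<close>

lemma has_laplacian_cong:
  assumes "has_laplacian f L" "\<And>x. x \<in> sphere 0 1 \<Longrightarrow> L x = L' x"
  shows "has_laplacian f L'"
proof -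
  obtain D DD where D: "angular_derivatives f D DD"
    and L: "\<forall>x\<in>sphere 0 1. L x = (\<Sum>i\<in>UNIV. \<Sum>j\<in>UNIV. if i = j then 0 else DD i j x) / 2"
    using assms(1) unfolding has_laplacian_def by blast
  have "L' x = (\<Sum>i\<in>UNIV. \<Sum>j\<in>UNIV. if i = j then 0 else DD i j x) / 2" if "x \<in> sphere 0 1" for x
    using L[THEN bspec, OF that] assms(2)[OF that] by (simp only:)
  with D show ?thesis
    unfolding has_laplacian_def by blast
qed

lemma has_laplacian_add:
  assumes "has_laplacian f L" "has_laplacian g K"
  shows "has_laplacian (\<lambda>x. f x + g x) (\<lambda>x. L x + K x)"
proof -
  obtain D DD where D: "angular_derivatives f D DD"
    and L: "\<forall>x\<in>sphere 0 1. L x = (\<Sum>i\<in>UNIV. \<Sum>j\<in>UNIV. if i = j then 0 else DD i j x) / 2"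
    using assms(1) unfolding has_laplacian_def by blast
  obtain E EE where E: "angular_derivatives g E EE"
    and K: "\<forall>x\<in>sphere 0 1. K x = (\<Sum>i\<in>UNIV. \<Sum>j\<in>UNIV. if i = j then 0 else EE i j x) / 2"
    using assms(2) unfolding has_laplacian_def by blast
  show ?thesis
  proof (rule has_laplacianI)
    show "continuous_on (sphere 0 1) (\<lambda>x. f x + g x)"
      using D E by (auto simp: angular_derivatives_def intro!: continuous_intros)
    fix i j :: 'a assume ij: "i \<noteq> j"
    show "continuous_on (sphere 0 1) (\<lambda>x. D i j x + E i j x)" "continuous_on (sphere 0 1) (\<lambda>x. DD i j x + EE i j x)"
      using D E ij by (auto simp: angular_derivatives_def intro!: continuous_intros)
    show "rotation_derivative (axis i 1) (axis j 1) (\<lambda>x. f x + g x) (\<lambda>x. D i j x + E i j x)"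
      "rotation_derivative (axis i 1) (axis j 1) (\<lambda>x. D i j x + E i j x) (\<lambda>x. DD i j x + EE i j x)"
      using D E ij by (auto simp: angular_derivatives_def rotation_derivative_def intro!: has_vector_derivative_add)
  next
    fix x :: "real^'a" assume x: "x \<in> sphere 0 1"
    have "(\<Sum>i\<in>UNIV. \<Sum>j\<in>UNIV. if i = j then 0 else DD i j x + EE i j x)
      = (\<Sum>i\<in>UNIV. \<Sum>j\<in>UNIV. (if i = j then 0 else DD i j x) + (if i = j then 0 else EE i j x))"
      by (intro sum.cong refl) auto
    then show "L x + K x = (\<Sum>i\<in>UNIV. \<Sum>j\<in>UNIV. if i = j then 0 else DD i j x + EE i j x) / 2"
      unfolding L[THEN bspec, OF x] K[THEN bspec, OF x] by (simp add: sum.distrib add_divide_distrib)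
  qed
qed

lemma has_laplacian_cmult:
  assumes "has_laplacian f L"
  shows "has_laplacian (\<lambda>x. c * f x) (\<lambda>x. c * L x)"
proof -
  obtain D DD where D: "angular_derivatives f D DD"
    and L: "\<forall>x\<in>sphere 0 1. L x = (\<Sum>i\<in>UNIV. \<Sum>j\<in>UNIV. if i = j then 0 else DD i j x) / 2"
    using assms(1) unfolding has_laplacian_def by blast
  show ?thesis
  proof (rule has_laplacianI)
    show "continuous_on (sphere 0 1) (\<lambda>x. c * f x)"
      using D by (auto simp: angular_derivatives_def intro!: continuous_intros)
    fix i j :: 'a assume ij: "i \<noteq> j"
    show "continuous_on (sphere 0 1) (\<lambda>x. c * D i j x)" "continuous_on (sphere 0 1) (\<lambda>x. c * DD i j x)"
      using D ij by (auto simp: angular_derivatives_def intro!: continuous_intros)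
    show "rotation_derivative (axis i 1) (axis j 1) (\<lambda>x. c * f x) (\<lambda>x. c * D i j x)"
      "rotation_derivative (axis i 1) (axis j 1) (\<lambda>x. c * D i j x) (\<lambda>x. c * DD i j x)"
      using D ij by (auto simp: angular_derivatives_def rotation_derivative_def intro!: has_vector_derivative_mult_right)
  next
    fix x :: "real^'a" assume x: "x \<in> sphere 0 1"
    have "(\<Sum>i\<in>UNIV. \<Sum>j\<in>UNIV. if i = j then 0 else c * DD i j x)
      = (\<Sum>i\<in>UNIV. \<Sum>j\<in>UNIV. c * (if i = j then 0 else DD i j x))"
      by (intro sum.cong refl) auto
    then show "c * L x = (\<Sum>i\<in>UNIV. \<Sum>j\<in>UNIV. if i = j then 0 else c * DD i j x) / 2"
      unfolding L[THEN bspec, OF x] by (simp add: sum_distrib_left)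
  qed
qed

lemma has_laplacian_inner_power:
  fixes \<xi> :: "real^'n"
  assumes "\<xi> \<in> sphere 0 1"
  shows "has_laplacian (\<lambda>x. of_real (\<xi> \<bullet> x) ^ m)
    (\<lambda>x. of_nat m * (of_nat m - 1) * of_real (\<xi> \<bullet> x) ^ (m - 2)
      - of_nat m * (of_nat m + of_nat CARD('n) - 2) * of_real (\<xi> \<bullet> x) ^ m)"
proof -
  have d: "((\<lambda>t::real. complex_of_real t ^ m) has_vector_derivative of_nat m * of_real t ^ (m - 1)) (at t)" for t m
    by (rule has_vector_derivative_real_field[of "\<lambda>w. w ^ m"]) (auto intro!: derivative_eq_intros)
  have "has_laplacian (\<lambda>x. of_real (\<xi> \<bullet> x) ^ m)
    (\<lambda>x. of_real (1 - (\<xi> \<bullet> x)\<^sup>2) * (of_nat m * (of_nat (m - 1) * of_real (\<xi> \<bullet> x) ^ (m - 1 - 1)))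
        - of_real ((real CARD('n) - 1) * (\<xi> \<bullet> x)) * (of_nat m * of_real (\<xi> \<bullet> x) ^ (m - 1)))"
  proof (rule has_laplacian_zonal[OF assms d])
    show "((\<lambda>t. of_nat m * complex_of_real t ^ (m - 1)) has_vector_derivative
        of_nat m * (of_nat (m - 1) * of_real t ^ (m - 1 - 1))) (at t)" for t
      by (rule has_vector_derivative_mult_right[OF d])
  qed (intro continuous_intros)
  then show ?thesis
  proof (rule has_laplacian_cong)
    fix x :: "real^'n"
    \<comment> \<open>For small \<open>m\<close> the truncated exponents \<open>m - 1\<close> and
      \<open>m - 2\<close> are wrong, but there the coefficients \<open>m\<close> and
      \<open>m * (m - 1)\<close> vanish.\<close>
    consider "m = 0" | "m = 1" | k where "m = Suc (Suc k)"
      by (metis One_nat_def not0_implies_Suc)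
    then show "of_real (1 - (\<xi> \<bullet> x)\<^sup>2) * (of_nat m * (of_nat (m - 1) * of_real (\<xi> \<bullet> x) ^ (m - 1 - 1)))
        - of_real ((real CARD('n) - 1) * (\<xi> \<bullet> x)) * (of_nat m * of_real (\<xi> \<bullet> x) ^ (m - 1))
      = of_nat m * (of_nat m - 1) * complex_of_real (\<xi> \<bullet> x) ^ (m - 2)
      - of_nat m * (of_nat m + of_nat CARD('n) - 2) * of_real (\<xi> \<bullet> x) ^ m"
      by cases (simp_all add: algebra_simps power2_eq_square)
  qed
qed

section \<open>Powers of the absolute value\<close>

text \<open>The kernel without its Gamma factor. By the convention \<open>0 powr z = 0\<close> it
  vanishes at \<open>t = 0\<close> for every exponent, even for \<open>z = 0\<close>; hence the
  separate treatment of \<open>t = 0\<close> in what follows.\<close>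

definition abs_power :: "complex \<Rightarrow> real \<Rightarrow> complex" where
  "abs_power z t = complex_of_real \<bar>t\<bar> powr z"

lemma abs_power_0 [simp]: "abs_power z 0 = 0"
  by (simp add: abs_power_def)

lemma abs_power_1 [simp]: "abs_power z 1 = 1"
  by (simp add: abs_power_def)

lemma abs_power_minus [simp]: "abs_power z (- t) = abs_power z t"
  by (simp add: abs_power_def)

lemma norm_abs_power: "norm (abs_power z t) = \<bar>t\<bar> powr Re z"
  by (simp add: abs_power_def norm_powr_real_powr)

lemma abs_power_add: "abs_power (z + w) t = abs_power z t * abs_power w t"
  by (simp add: abs_power_def powr_add)

lemma abs_power_of_nat: "t \<noteq> 0 \<Longrightarrow> abs_power (of_nat k) t = of_real (\<bar>t\<bar> ^ k)"
  by (simp add: abs_power_def powr_nat)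

lemma abs_power_add2: "abs_power (z + 2) t = of_real (t\<^sup>2) * abs_power z t"
  using abs_power_of_nat[of t 2] by (cases "t = 0") (simp_all add: abs_power_add)

lemma abs_power_add1: "abs_power (z + 1) t = of_real \<bar>t\<bar> * abs_power z t"
  using abs_power_of_nat[of t 1] by (cases "t = 0") (simp_all add: abs_power_add)

lemma holomorphic_on_abs_power [holomorphic_intros]:
  "f holomorphic_on A \<Longrightarrow> (\<lambda>z. abs_power (f z) t) holomorphic_on A"
  unfolding abs_power_def by (cases "t = 0") (auto intro!: holomorphic_intros)

lemma continuous_on_abs_power [continuous_intros]:
  assumes "continuous_on A f" "continuous_on A g" "\<And>x. x \<in> A \<Longrightarrow> Re (g x) > 0"
  shows "continuous_on A (\<lambda>x. abs_power (g x) (f x))"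
  unfolding abs_power_def using assms
  by (intro continuous_on_powr_complex continuous_intros) auto

lemma borel_measurable_abs_power [measurable]: "abs_power z \<in> borel_measurable borel"
proof -
  have "(\<lambda>t::real. if t = 0 then 0 else exp (z * of_real (ln \<bar>t\<bar>))) \<in> borel_measurable borel"
    by measurable
  also have "(\<lambda>t::real. if t = 0 then 0 else exp (z * of_real (ln \<bar>t\<bar>))) = abs_power z"
    by (auto simp: abs_power_def powr_def Ln_of_real fun_eq_iff)
  finally show ?thesis .
qed

text \<open>\<open>c = 1\<close> gives \<open>|t|^z\<close> and \<open>c = - 1\<close> gives
  \<open>sgn t * |t|^z\<close>. Differentiation lowers the exponent and flips \<open>c\<close>, so
  one lemma covers both derivatives of \<open>|t|^(z + 2)\<close>.\<close>

definition sided_abs_power :: "complex \<Rightarrow> complex \<Rightarrow> real \<Rightarrow> complex" where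
  "sided_abs_power c z t = (if t < 0 then c else 1) * abs_power z t"

lemma sided_abs_power_has_vector_derivative:
  assumes "Re z > 1"
  shows "(sided_abs_power c z has_vector_derivative z * sided_abs_power (- c) (z - 1) t) (at t)"
proof -
  have pos: "(abs_power z has_vector_derivative z * abs_power (z - 1) s) (at s)" if "s > 0" for s
  proof -
    have "((\<lambda>w. w powr z) has_field_derivative z * of_real s powr (z - 1)) (at (of_real s))"
      using that by (intro has_field_derivative_powr) (auto simp: complex_nonpos_Reals_iff)
    then have "((\<lambda>s. of_real s powr z) has_vector_derivative z * abs_power (z - 1) s) (at s)"
      using that by (auto intro!: has_vector_derivative_real_field simp: abs_power_def)
    then show ?thesis
      by (rule has_vector_derivative_transform_within_open[where S = "{0<..}"])
        (use that in \<open>auto simp: abs_power_def\<close>)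
  qed
  consider "t > 0" | "t < 0" | "t = 0"
    by linarith
  then show ?thesis
  proof cases
    case 1
    show ?thesis
      using 1 pos[OF 1] has_vector_derivative_transform_within_open[OF pos[OF 1], of "{0<..}" "sided_abs_power c z"]
      by (auto simp: sided_abs_power_def)
  next
    case 2
    have "(abs_power z \<circ> uminus has_vector_derivative (- 1) *\<^sub>R (z * abs_power (z - 1) (- t))) (at t)"
      using 2 by (intro vector_diff_chain_at pos) (auto intro!: derivative_eq_intros)
    then have "((\<lambda>s. c * abs_power z s) has_vector_derivative c * ((- 1) *\<^sub>R (z * abs_power (z - 1) (- t)))) (at t)"
      by (intro has_vector_derivative_mult_right) (simp add: o_def)
    then have "((\<lambda>s. c * abs_power z s) has_vector_derivative z * sided_abs_power (- c) (z - 1) t) (at t)"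
      using 2 by (simp add: sided_abs_power_def mult_ac)
    then show ?thesis
      by (rule has_vector_derivative_transform_within_open[where S = "{..<0}"])
        (use 2 in \<open>auto simp: sided_abs_power_def\<close>)
  next
    case 3
    \<comment> \<open>This function dominates the difference quotient at 0; \<open>Re z > 1\<close>
      makes it tend to 0.\<close>
    have "((\<lambda>h::real. max 1 (norm c) * \<bar>h\<bar> powr (Re z - 1)) \<longlongrightarrow> max 1 (norm c) * 0) (at 0)"
    proof (intro tendsto_intros)
      have "((\<lambda>h::real. \<bar>h\<bar> powr (Re z - 1)) \<longlongrightarrow> \<bar>0\<bar> powr (Re z - 1)) (at 0)"
        using assms by (intro tendsto_powr' tendsto_intros) auto
      then show "((\<lambda>h::real. \<bar>h\<bar> powr (Re z - 1)) \<longlongrightarrow> 0) (at 0)"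
        by simp
    qed
    then have lim: "((\<lambda>h::real. max 1 (norm c) * \<bar>h\<bar> powr (Re z - 1)) \<longlongrightarrow> 0) (at 0)"
      by simp
    have "((\<lambda>h. norm (sided_abs_power c z (0 + h) - sided_abs_power c z 0 - h *\<^sub>R 0) / norm h) \<longlongrightarrow> 0) (at 0)"
    proof (rule tendsto_sandwich[OF _ _ tendsto_const lim])
      show "\<forall>\<^sub>F h in at 0. norm (sided_abs_power c z (0 + h) - sided_abs_power c z 0 - h *\<^sub>R 0) / norm h
          \<le> max 1 (norm c) * \<bar>h\<bar> powr (Re z - 1)"
        unfolding eventually_at_filter
      proof (intro always_eventually allI impI)
        fix h :: real assume "h \<noteq> 0"
        then have "\<bar>h\<bar> powr Re z / \<bar>h\<bar> = \<bar>h\<bar> powr (Re z - 1)"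
          by (simp add: powr_diff)
        moreover have "norm (sided_abs_power c z h) \<le> max 1 (norm c) * \<bar>h\<bar> powr Re z"
          unfolding sided_abs_power_def norm_mult norm_abs_power by (intro mult_right_mono) auto
        ultimately show "norm (sided_abs_power c z (0 + h) - sided_abs_power c z 0 - h *\<^sub>R 0) / norm h
          \<le> max 1 (norm c) * \<bar>h\<bar> powr (Re z - 1)"
          using \<open>h \<noteq> 0\<close> by (simp add: sided_abs_power_def field_simps)
      qed
    qed auto
    then have "(sided_abs_power c z has_vector_derivative 0) (at 0)"
      unfolding has_vector_derivative_def has_derivative_at
      by (auto intro: bounded_linear_scaleR_left)
    then show ?thesis
      using 3 by (simp add: sided_abs_power_def)
  qed
qed

text \<open>The zonal formula for \<open>|t|^(z + 2)\<close>; \<open>Re z > 0\<close> keeps the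
  second derivative continuous across \<open>t = 0\<close>.\<close>

lemma has_laplacian_abs_power:
  fixes \<xi> :: "real^'n"
  assumes "\<xi> \<in> sphere 0 1" "Re z > 0"
  shows "has_laplacian (\<lambda>x. abs_power (z + 2) (\<xi> \<bullet> x))
    (\<lambda>x. (z + 2) * ((z + 1) * abs_power z (\<xi> \<bullet> x) - (z + of_nat CARD('n)) * abs_power (z + 2) (\<xi> \<bullet> x)))"
proof -
  have eq1: "abs_power w = sided_abs_power 1 w" for w
    by (auto simp: sided_abs_power_def)
  have "has_laplacian (\<lambda>x. abs_power (z + 2) (\<xi> \<bullet> x))
    (\<lambda>x. of_real (1 - (\<xi> \<bullet> x)\<^sup>2) * ((z + 2) * ((z + 1) * abs_power z (\<xi> \<bullet> x)))
        - of_real ((real CARD('n) - 1) * (\<xi> \<bullet> x)) * ((z + 2) * sided_abs_power (- 1) (z + 1) (\<xi> \<bullet> x)))"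
  proof (rule has_laplacian_zonal[OF assms(1)])
    show "(abs_power (z + 2) has_vector_derivative (z + 2) * sided_abs_power (- 1) (z + 1) t) (at t)" for t
      using sided_abs_power_has_vector_derivative[of "z + 2" 1 t] assms unfolding eq1 by (simp add: algebra_simps)
    show "((\<lambda>t. (z + 2) * sided_abs_power (- 1) (z + 1) t) has_vector_derivative (z + 2) * ((z + 1) * abs_power z t)) (at t)" for t
      using sided_abs_power_has_vector_derivative[of "z + 1" "-1" t] assms unfolding eq1
      by (intro has_vector_derivative_mult_right) simp
    show "continuous_on UNIV (\<lambda>t. (z + 2) * ((z + 1) * abs_power z t))"
      using assms by (intro continuous_intros) auto
  qed
  then show ?thesis
  proof (rule has_laplacian_cong)
    fix x :: "real^'n"
    have "of_real t * sided_abs_power (- 1) (z + 1) t = abs_power (z + 2) t" for t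
      using abs_power_add1[of "z + 1" t] by (auto simp: sided_abs_power_def add.commute[of 2])
    then show "of_real (1 - (\<xi> \<bullet> x)\<^sup>2) * ((z + 2) * ((z + 1) * abs_power z (\<xi> \<bullet> x)))
        - of_real ((real CARD('n) - 1) * (\<xi> \<bullet> x)) * ((z + 2) * sided_abs_power (- 1) (z + 1) (\<xi> \<bullet> x))
      = (z + 2) * ((z + 1) * abs_power z (\<xi> \<bullet> x) - (z + of_nat CARD('n)) * abs_power (z + 2) (\<xi> \<bullet> x))"
      using abs_power_add2[of z "\<xi> \<bullet> x"]
      by (simp add: algebra_simps)
  qed
qed

section \<open>The weak Laplacian\<close>

text \<open>Green's identity with the kernels as the only test functions. Vanishing of the integral
  of \<open>L\<close> corresponds to the test function 1, the kernel of exponent 0, which the range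
  \<open>Re z > 0\<close> does not reach; hence its separate mention.\<close>

definition weak_laplacian :: "(real^'n) measure \<Rightarrow> (real^'n \<Rightarrow> complex) \<Rightarrow> (real^'n \<Rightarrow> complex) \<Rightarrow> bool" where
  "weak_laplacian M f L \<longleftrightarrow> continuous_on (sphere 0 1) f \<and> continuous_on (sphere 0 1) L \<and>
     (\<integral>\<omega>. L \<omega> \<partial>M) = 0 \<and>
     (\<forall>\<xi>\<in>sphere 0 1. \<forall>z. Re z > 0 \<longrightarrow>
        (\<integral>\<omega>. L \<omega> * abs_power (z + 2) (\<xi> \<bullet> \<omega>) \<partial>M)
        = (\<integral>\<omega>. f \<omega> * ((z + 2) * ((z + 1) * abs_power z (\<xi> \<bullet> \<omega>)
             - (z + of_nat CARD('n)) * abs_power (z + 2) (\<xi> \<bullet> \<omega>))) \<partial>M))"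

text \<open>A whole chain, because each step of the continuation moves the half-plane by 2 to the
  left and consumes one Laplacian.\<close>

definition weakly_smooth :: "(real^'n) measure \<Rightarrow> (real^'n \<Rightarrow> complex) \<Rightarrow> bool" where
  "weakly_smooth M f \<longleftrightarrow> (\<exists>F. F 0 = f \<and> (\<forall>k. weak_laplacian M (F k) (F (Suc k))))"

lemma (in sphere_measure) weak_laplacian_if_has_laplacian:
  "has_laplacian f L \<Longrightarrow> weak_laplacian M f L"
  unfolding weak_laplacian_def
  using has_laplacian_continuous integral_laplacian_eq_0 green_identity[OF _ has_laplacian_abs_power]
  by blast

lemma (in sphere_measure) weakly_smooth_if_smooth_on_sphere:
  assumes "smooth_on_sphere f"
  shows "weakly_smooth M f"
proof -
  obtain U h where h: "sphere 0 1 \<subseteq> U" "smooth_on_open U h" "\<And>x. x \<in> sphere 0 1 \<Longrightarrow> h x = f x"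
    using assms unfolding smooth_on_sphere_def by blast
  have sm: "smooth_on_open U ((laplacian ^^ k) h)" for k
    by (induction k) (auto intro: h smooth_on_open_laplacian)
  have W: "weak_laplacian M ((laplacian ^^ k) h) ((laplacian ^^ (Suc k)) h)" for k
    using has_laplacian_smooth[OF sm h(1)] by (simp add: weak_laplacian_if_has_laplacian)
  \<comment> \<open>\<open>f\<close> and \<open>h\<close> agree only on the sphere, which is all
    that the weak notion sees; so \<open>f\<close> can replace \<open>h\<close> at the head of the
    chain.\<close>
  have "weak_laplacian M f (laplacian h)"
  proof -
    have "weak_laplacian M h (laplacian h)"
      using W[of 0] by simp
    moreover have "continuous_on (sphere 0 1) h \<longleftrightarrow> continuous_on (sphere 0 1) f"
      using h(3) by (intro continuous_on_cong) auto
    moreover have "(\<integral>\<omega>. h \<omega> * g \<omega> \<partial>M) = (\<integral>\<omega>. f \<omega> * g \<omega> \<partial>M)" for g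
      by (intro Bochner_Integration.integral_cong) (auto simp: space_M h(3))
    ultimately show ?thesis
      unfolding weak_laplacian_def by simp
  qed
  then have "weak_laplacian M ((if k = 0 then f else (laplacian ^^ k) h)) ((laplacian ^^ (Suc k)) h)" for k
    using W[of k] by auto
  then show ?thesis
    unfolding weakly_smooth_def
    by (intro exI[of _ "\<lambda>k. if k = 0 then f else (laplacian ^^ k) h"]) simp
qed

lemma weak_laplacian_continuous:
  "weak_laplacian M f L \<Longrightarrow> continuous_on (sphere 0 1) f"
  "weak_laplacian M f L \<Longrightarrow> continuous_on (sphere 0 1) L"
  by (auto simp: weak_laplacian_def)

lemma weakly_smooth_continuous: "weakly_smooth M f \<Longrightarrow> continuous_on (sphere 0 1) f"
  unfolding weakly_smooth_def weak_laplacian_def by blast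

lemma weakly_smoothE:
  assumes "weakly_smooth M f"
  obtains L where "weak_laplacian M f L" "weakly_smooth M L"
proof -
  obtain F where F: "F 0 = f" "\<And>k. weak_laplacian M (F k) (F (Suc k))"
    using assms unfolding weakly_smooth_def by blast
  have "weakly_smooth M (F (Suc 0))"
    unfolding weakly_smooth_def by (intro exI[of _ "\<lambda>k. F (Suc k)"]) (simp add: F)
  then show ?thesis
    using that F(1) F(2)[of 0] by auto
qed

section \<open>Parameter integrals and integrability of the kernel\<close>

text \<open>Cauchy's inequality turns the bound \<open>B\<close> on a disc into the bound
  \<open>B / (r / 2)\<close> for the derivative on the half disc. This dominates the difference
  quotients in the parameter, and the limit passes under the integral.\<close>

lemma holomorphic_on_integral:
  fixes K :: "complex \<Rightarrow> 'a \<Rightarrow> complex"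
  assumes U: "open U"
    and hol: "\<And>x. x \<in> space M \<Longrightarrow> (\<lambda>z. K z x) holomorphic_on U"
    and meas: "\<And>z. z \<in> U \<Longrightarrow> K z \<in> borel_measurable M"
    and dom: "\<And>z. z \<in> U \<Longrightarrow> \<exists>r B. r > 0 \<and> cball z r \<subseteq> U \<and> integrable M B \<and>
        (\<forall>w\<in>cball z r. \<forall>x\<in>space M. norm (K w x) \<le> B x)"
  shows "(\<lambda>z. \<integral>x. K z x \<partial>M) holomorphic_on U"
proof -
  have "(\<lambda>z. \<integral>x. K z x \<partial>M) field_differentiable (at z)" if z: "z \<in> U" for z
  proof -
    obtain r B where r: "r > 0" "cball z r \<subseteq> U" and B: "integrable M B"
      and le: "\<And>w x. w \<in> cball z r \<Longrightarrow> x \<in> space M \<Longrightarrow> norm (K w x) \<le> B x"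
      using dom[OF z] by blast
    have inU: "w \<in> U" if "w \<in> ball z r" for w
      using that r by auto
    have intK: "integrable M (K w)" if "w \<in> ball z r" for w
      using that by (intro Bochner_Integration.integrable_bound[OF B meas[OF inU[OF that]]] AE_I2)
        (auto intro: order_trans[OF le])
    define D where "D x = deriv (\<lambda>w. K w x) z" for x
    have der: "((\<lambda>w. K w x) has_field_derivative deriv (\<lambda>w. K w x) w) (at w)" if "x \<in> space M" "w \<in> U" for x w
      using holomorphic_derivI[OF hol[OF that(1)] U that(2)] by simp
    have lip: "norm (K w x - K z x) \<le> B x / (r / 2) * norm (w - z)" if x: "x \<in> space M" and w: "w \<in> ball z (r/2)" for x w
    proof (rule field_differentiable_bound[of "ball z (r/2)"])
      fix v assume v: "v \<in> ball z (r/2)"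
      have sub: "cball v (r/2) \<subseteq> cball z r"
        using v by (intro cball_subset_cball_iff[THEN iffD2]) (auto simp: dist_commute)
      then have subU: "cball v (r/2) \<subseteq> U"
        using r by blast
      show "((\<lambda>w. K w x) has_field_derivative deriv (\<lambda>w. K w x) v) (at v within ball z (r/2))"
        using der[OF x subsetD[OF subU, of v]] r by (auto intro: has_field_derivative_at_within)
      have "norm ((deriv ^^ 1) (\<lambda>w. K w x) v) \<le> fact 1 * B x / (r/2) ^ 1"
      proof (rule Cauchy_inequality)
        show "(\<lambda>w. K w x) holomorphic_on ball v (r/2)"
          using subU by (intro holomorphic_on_subset[OF hol[OF x]]) auto
        show "continuous_on (cball v (r/2)) (\<lambda>w. K w x)"
          using subU by (intro holomorphic_on_imp_continuous_on holomorphic_on_subset[OF hol[OF x]])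
        show "norm (K w x) \<le> B x" if "norm (v - w) = r / 2" for w
          using le[OF _ x, of w] sub that by (auto simp: dist_norm subset_iff)
      qed (use r in auto)
      then show "norm (deriv (\<lambda>w. K w x) v) \<le> B x / (r / 2)"
        by simp
    qed (use w r in auto)
    have "((\<lambda>h. ((\<integral>x. K (z + h) x \<partial>M) - (\<integral>x. K z x \<partial>M)) / h) \<longlongrightarrow> (\<integral>x. D x \<partial>M)) (at 0)"
      unfolding tendsto_at_iff_sequentially o_def
    proof (intro allI impI)
      fix X :: "nat \<Rightarrow> complex" assume X: "\<forall>i. X i \<in> UNIV - {0}" and lim: "X \<longlonglongrightarrow> 0"
      \<comment> \<open>Finitely many terms are dropped so that every \<open>z + Y n\<close> lies in
        the half disc where the Lipschitz bound holds.\<close>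
      obtain k0 where k0: "\<And>n. n \<ge> k0 \<Longrightarrow> norm (X n) < r / 2"
        using LIMSEQ_D[OF lim, of "r/2"] r by auto
      define Y where "Y n = X (n + k0)" for n
      have Y0: "Y n \<noteq> 0" and Yr: "norm (Y n) < r / 2" for n
        using X k0[of "n + k0"] by (auto simp: Y_def)
      have Ylim: "Y \<longlonglongrightarrow> 0"
        unfolding Y_def by (rule LIMSEQ_ignore_initial_segment[OF lim])
      have Yb: "z + Y n \<in> ball z (r/2)" "z + Y n \<in> ball z r" for n
        using Yr[of n] norm_ge_zero[of "Y n"] by (auto simp: dist_norm simp del: norm_ge_zero)
      have quot: "(\<lambda>n. (K (z + Y n) x - K z x) / Y n) \<longlonglongrightarrow> D x" if x: "x \<in> space M" for x
      proof -
        have "((\<lambda>h. (K (z + h) x - K z x) / h) \<longlongrightarrow> D x) (at 0)"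
          using der[OF x z] unfolding DERIV_def D_def .
        then show ?thesis
          using Ylim Y0 unfolding tendsto_at_iff_sequentially o_def by auto
      qed
      have mq: "(\<lambda>x. (K (z + Y n) x - K z x) / Y n) \<in> borel_measurable M" for n
        using meas[OF inU[OF Yb(2)[of n]]] meas[OF z] by measurable
      have "(\<lambda>n. \<integral>x. (K (z + Y n) x - K z x) / Y n \<partial>M) \<longlonglongrightarrow> (\<integral>x. D x \<partial>M)"
      proof (rule integral_dominated_convergence)
        show "D \<in> borel_measurable M"
          by (rule borel_measurable_LIMSEQ_metric[OF mq quot])
        show "AE x in M. (\<lambda>n. (K (z + Y n) x - K z x) / Y n) \<longlonglongrightarrow> D x"
          by (intro AE_I2 quot)
        show "integrable M (\<lambda>x. B x / (r / 2))"
          using B by simp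
        show "AE x in M. norm ((K (z + Y n) x - K z x) / Y n) \<le> B x / (r / 2)" for n
          using lip[OF _ Yb(1)[of n]] Y0[of n]
          by (intro AE_I2) (simp add: norm_divide pos_divide_le_eq)
      qed (rule mq)
      then have "(\<lambda>n. ((\<integral>x. K (z + Y n) x \<partial>M) - (\<integral>x. K z x \<partial>M)) / Y n) \<longlonglongrightarrow> (\<integral>x. D x \<partial>M)"
        using intK Yb(2) r by (simp add: intK)
      then show "(\<lambda>n. ((\<integral>x. K (z + X n) x \<partial>M) - (\<integral>x. K z x \<partial>M)) / X n) \<longlonglongrightarrow> (\<integral>x. D x \<partial>M)"
        unfolding Y_def by (rule LIMSEQ_offset)
    qed
    then show ?thesis
      unfolding field_differentiable_def DERIV_def by blast
  qed
  then show ?thesis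
    unfolding holomorphic_on_def by (auto intro: field_differentiable_at_within)
qed

text \<open>The value at \<open>a\<close> is the one that removes the singularity; by the maximum principle the quotient
  depends on the parameter as continuously near \<open>a\<close> as on a circle around \<open>a\<close>.\<close>

lemma removable_quotient_family:
  fixes G :: "'p::metric_space \<Rightarrow> complex \<Rightarrow> complex" and a :: complex
  defines "Q \<equiv> \<lambda>p z. if z = a then deriv (G p) a else G p z / (z - a)"
  assumes U: "open U" and P: "compact P"
    and hol: "\<And>p. p \<in> P \<Longrightarrow> G p holomorphic_on U"
    and cont: "continuous_on (P \<times> U) (\<lambda>(p, z). G p z)"
    and zero: "\<And>p. p \<in> P \<Longrightarrow> a \<in> U \<Longrightarrow> G p a = 0"
  shows "p \<in> P \<Longrightarrow> Q p holomorphic_on U" "continuous_on (P \<times> U) (\<lambda>(p, z). Q p z)"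
proof -
  show holQ: "Q p holomorphic_on U" if "p \<in> P" for p
  proof (cases "a \<in> U")
    case True
    show ?thesis
      by (rule pole_theorem_open_0[OF hol[OF that] U, of a]) (use zero[OF that True] in \<open>auto simp: Q_def\<close>)
  next
    case False
    have "(\<lambda>z. G p z / (z - a)) holomorphic_on U"
      using False by (intro holomorphic_intros hol that) auto
    then show ?thesis
      by (rule holomorphic_transform) (use False in \<open>auto simp: Q_def\<close>)
  qed
  have off: "continuous_on (P \<times> (U - {a})) (\<lambda>(p, z). Q p z)"
  proof -
    have "continuous_on (P \<times> (U - {a})) (\<lambda>x. (case x of (p, z) \<Rightarrow> G p z) / (snd x - a))"
      by (intro continuous_intros continuous_on_subset[OF cont]) auto
    then show ?thesis
      by (rule continuous_on_eq) (auto simp: Q_def split: if_splits)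
  qed
  show "continuous_on (P \<times> U) (\<lambda>(p, z). Q p z)"
  proof (cases "a \<in> U")
    case False
    with off show ?thesis
      by simp
  next
    case True
    obtain r where r: "r > 0" "cball a r \<subseteq> U"
      using U True open_contains_cball by blast
    have near: "continuous_on (P \<times> ball a r) (\<lambda>(p, z). Q p z)"
      unfolding continuous_on_iff
    proof (clarsimp simp del: mem_ball)
      fix p z and e :: real assume p: "p \<in> P" and z: "z \<in> ball a r" and e: "e > 0"
      have "uniformly_continuous_on (P \<times> sphere a r) (\<lambda>(p, z). G p z)"
        using r by (intro compact_uniformly_continuous compact_Times P compact_sphere continuous_on_subset[OF cont]) auto
      \<comment> \<open>On the circle the denominator has modulus \<open>r\<close>, so the tolerance
        \<open>e / 2 * r\<close> for \<open>G\<close> is \<open>e / 2\<close> for the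
        quotient.\<close>
      then obtain d1 where d1: "d1 > 0" and unif: "\<And>x y. x \<in> P \<times> sphere a r \<Longrightarrow> y \<in> P \<times> sphere a r \<Longrightarrow>
          dist y x < d1 \<Longrightarrow> dist (case y of (p, z) \<Rightarrow> G p z) (case x of (p, z) \<Rightarrow> G p z) < e / 2 * r"
        using e r unfolding uniformly_continuous_on_def by (metis half_gt_zero mult_pos_pos)
      have G': "norm (G p' w - G p w) \<le> e / 2 * r" if "p' \<in> P" "dist p' p < d1" "w \<in> sphere a r" for p' w
        using unif[of "(p, w)" "(p', w)"] that p by (auto simp: dist_Pair_Pair dist_norm)
      have diff: "norm (Q p' w - Q p w) \<le> e / 2" if p': "p' \<in> P" "dist p' p < d1" and w: "w \<in> ball a r" for p' w
      proof (rule maximum_modulus_frontier[of "\<lambda>w. Q p' w - Q p w" "ball a r"])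
        show "(\<lambda>w. Q p' w - Q p w) holomorphic_on interior (ball a r)"
          using r by (intro holomorphic_intros holomorphic_on_subset[OF holQ] p p') auto
        show "continuous_on (closure (ball a r)) (\<lambda>w. Q p' w - Q p w)"
          using r by (intro holomorphic_on_imp_continuous_on holomorphic_intros holomorphic_on_subset[OF holQ] p p') auto
        fix v assume "v \<in> frontier (ball a r)"
        then have v: "v \<in> sphere a r" "v \<noteq> a"
          using r by auto
        have "norm (Q p' v - Q p v) = norm (G p' v - G p v) / r"
          using v by (simp add: Q_def diff_divide_distrib[symmetric] norm_divide dist_norm norm_minus_commute)
        then show "norm (Q p' v - Q p v) \<le> e / 2"
          using divide_right_mono[OF G'[OF p' v(1)], of r] r by simp
      qed (use w in auto)
      have "continuous_on U (Q p)"
        by (intro holomorphic_on_imp_continuous_on holQ p)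
      then have "isCont (Q p) z"
        using U z r by (metis ball_subset_cball continuous_on_eq_continuous_at subsetD)
      then obtain d2 where d2: "d2 > 0" "\<And>w. dist w z < d2 \<Longrightarrow> dist (Q p w) (Q p z) < e / 2"
        using e unfolding continuous_at_eps_delta dist_norm by (metis half_gt_zero)
      show "\<exists>d>0. \<forall>p'\<in>P. \<forall>z'\<in>ball a r. dist (p', z') (p, z) < d \<longrightarrow> dist (Q p' z') (Q p z) < e"
      proof (intro exI[of _ "min d1 d2"] conjI ballI impI)
        fix p' z' assume p': "p' \<in> P" and z': "z' \<in> ball a r" and "dist (p', z') (p, z) < min d1 d2"
        then have "dist p' p < d1" "dist z' z < d2"
          using dist_fst_le[of "(p', z')" "(p, z)"] dist_snd_le[of "(p', z')" "(p, z)"] by auto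
        then have "dist (Q p' z') (Q p z') \<le> e / 2" "dist (Q p z') (Q p z) < e / 2"
          using diff[OF p' _ z'] d2 by (auto simp: dist_norm)
        then show "dist (Q p' z') (Q p z) < e"
          using dist_triangle[of "Q p' z'" "Q p z" "Q p z'"] by linarith
      qed (use d1 d2 in auto)
    qed
    have "continuous_on (P \<times> (U - {a}) \<union> P \<times> ball a r) (\<lambda>(p, z). Q p z)"
    proof (rule continuous_on_Un_local_open[OF _ _ off near])
      have "P \<times> (U - {a}) = (P \<times> (U - {a}) \<union> P \<times> ball a r) \<inter> (UNIV \<times> (U - {a}))" by auto
      moreover have "open ((UNIV :: 'p set) \<times> (U - {a}))"
        using U by (intro open_Times) auto
      ultimately show "openin (top_of_set (P \<times> (U - {a}) \<union> P \<times> ball a r)) (P \<times> (U - {a}))"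
        unfolding openin_open by blast
      have "P \<times> ball a r = (P \<times> (U - {a}) \<union> P \<times> ball a r) \<inter> (UNIV \<times> ball a r)" by auto
      moreover have "open ((UNIV :: 'p set) \<times> ball a r)"
        by (intro open_Times) auto
      ultimately show "openin (top_of_set (P \<times> (U - {a}) \<union> P \<times> ball a r)) (P \<times> ball a r)"
        unfolding openin_open by blast
    qed
    moreover have "P \<times> (U - {a}) \<union> P \<times> ball a r = P \<times> U"
      using r True by auto
    ultimately show ?thesis
      by simp
  qed
qed

context sphere_measure
begin

text \<open>Checked along sequences: a convergent sequence together with its limit is compact, so
  the integrand is bounded on it times the sphere, which gives the dominating constant.\<close>

lemma continuous_on_integral_param:
  fixes K :: "'p::heine_borel \<Rightarrow> real^'n \<Rightarrow> complex"
  assumes K: "continuous_on (P \<times> sphere 0 1) (\<lambda>(p, \<omega>). K p \<omega>)"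
  shows "continuous_on P (\<lambda>p. \<integral>\<omega>. K p \<omega> \<partial>M)"
proof (rule continuous_on_sequentiallyI)
  fix u a assume u: "\<forall>n. u n \<in> P" and a: "a \<in> P" and lim: "u \<longlonglongrightarrow> a"
  define C where "C = insert a (range u)"
  have C: "compact C" "C \<subseteq> P"
    using compact_sequence_with_limit[OF lim] u a by (auto simp: C_def)
  have slice: "continuous_on (sphere 0 1) (K p)" if "p \<in> P" for p
    using that by (intro continuous_on_compose2[OF K, of _ "\<lambda>\<omega>. (p, \<omega>)", simplified]) (auto intro!: continuous_intros)
  have "bounded ((\<lambda>(p, \<omega>). K p \<omega>) ` (C \<times> sphere 0 1))"
    using C by (intro compact_imp_bounded compact_continuous_image continuous_on_subset[OF K] compact_Times) auto
  then obtain B where B: "\<And>p \<omega>. p \<in> C \<Longrightarrow> \<omega> \<in> sphere 0 1 \<Longrightarrow> norm (K p \<omega>) \<le> B"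
    unfolding bounded_iff by fastforce
  show "(\<lambda>n. \<integral>\<omega>. K (u n) \<omega> \<partial>M) \<longlonglongrightarrow> (\<integral>\<omega>. K a \<omega> \<partial>M)"
  proof (rule integral_dominated_convergence)
    show "AE \<omega> in M. (\<lambda>n. K (u n) \<omega>) \<longlonglongrightarrow> K a \<omega>"
    proof (rule AE_I2)
      fix \<omega> assume "\<omega> \<in> space M"
      then have "continuous_on P (\<lambda>p. K p \<omega>)"
        by (intro continuous_on_compose2[OF K, of _ "\<lambda>p. (p, \<omega>)", simplified])
          (auto intro!: continuous_intros simp: space_M)
      then show "(\<lambda>n. K (u n) \<omega>) \<longlonglongrightarrow> K a \<omega>"
        using u a lim unfolding continuous_on_sequentially o_def by blast
    qed
    show "AE \<omega> in M. norm (K (u n) \<omega>) \<le> B" for n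
      by (intro AE_I2 B) (auto simp: C_def space_M)
    show "integrable M (\<lambda>\<omega>. B)"
      by simp
  qed (use u a slice in \<open>auto intro: measurable_continuous_on_sphere\<close>)
qed

lemma holomorphic_on_integral_continuous:
  assumes U: "open U"
    and hol: "\<And>\<omega>. \<omega> \<in> sphere 0 1 \<Longrightarrow> (\<lambda>z. K z \<omega>) holomorphic_on U"
    and K: "continuous_on (U \<times> sphere 0 1) (\<lambda>(z, \<omega>). K z \<omega>)"
  shows "(\<lambda>z. \<integral>\<omega>. K z \<omega> \<partial>M) holomorphic_on U"
proof (rule holomorphic_on_integral[OF U])
  show "(\<lambda>z. K z \<omega>) holomorphic_on U" if "\<omega> \<in> space M" for \<omega>
    using that hol by (simp add: space_M)
  show "K z \<in> borel_measurable M" if "z \<in> U" for z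
    using that by (intro measurable_continuous_on_sphere continuous_on_compose2[OF K, of _ "\<lambda>\<omega>. (z, \<omega>)", simplified])
      (auto intro!: continuous_intros)
  fix z assume "z \<in> U"
  then obtain r where r: "r > 0" "cball z r \<subseteq> U"
    using U open_contains_cball by blast
  have "bounded ((\<lambda>(z, \<omega>). K z \<omega>) ` (cball z r \<times> sphere 0 1))"
    using r by (intro compact_imp_bounded compact_continuous_image continuous_on_subset[OF K] compact_Times) auto
  then obtain B where "\<And>w \<omega>. w \<in> cball z r \<Longrightarrow> \<omega> \<in> sphere 0 1 \<Longrightarrow> norm (K w \<omega>) \<le> B"
    unfolding bounded_iff by fastforce
  then show "\<exists>r B. r > 0 \<and> cball z r \<subseteq> U \<and> integrable M B \<and>
      (\<forall>w\<in>cball z r. \<forall>x\<in>space M. norm (K w x) \<le> B x)"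
    using r by (intro exI[of _ r] exI[of _ "\<lambda>_. B"]) (auto simp: space_M)
qed

section \<open>Integrability of negative powers of the inner product\<close>

lemma inner_sphere_le_1:
  fixes \<xi> \<omega> :: "real^'n"
  shows "\<xi> \<in> sphere 0 1 \<Longrightarrow> \<omega> \<in> sphere 0 1 \<Longrightarrow> \<bar>\<xi> \<bullet> \<omega>\<bar> \<le> 1"
  using Cauchy_Schwarz_ineq2[of \<xi> \<omega>] by simp

text \<open>Apply the Laplacian to a second antiderivative of \<open>(t\<^sup>2 + e\<^sup>2) powr (a / 2)\<close>, up to lower order terms.\<close>

lemma integral_regularized_abs_power_le:
  fixes \<xi> :: "real^'n"
  assumes \<xi>: "\<xi> \<in> sphere 0 1" and a: "- 1 < a" "a \<le> 0"
  shows "\<exists>C. \<forall>e\<in>{0<..1}. (\<integral>\<omega>. ((\<xi> \<bullet> \<omega>)\<^sup>2 + e\<^sup>2) powr (a / 2) \<partial>M) \<le> C"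
proof (intro exI ballI)
  define m where "m = measure M (sphere 0 1)"
  fix e :: real assume "e \<in> {0<..1}"
  then have e: "0 < e" "e \<le> 1"
    by auto
  have pos: "t\<^sup>2 + e\<^sup>2 > 0" for t
    using e by (simp add: add_nonneg_pos)
  define g where "g t = (t\<^sup>2 + e\<^sup>2) powr (a / 2)" for t
  \<comment> \<open>The derivative of \<open>t * g t\<close>, not of \<open>g\<close>;
    \<open>t * g t\<close> is in turn the derivative of the function to which the Laplacian is
    applied.\<close>
  define g' where "g' t = g t + a * t\<^sup>2 * (t\<^sup>2 + e\<^sup>2) powr (a / 2 - 1)" for t
  have [continuous_intros]: "continuous_on A (\<lambda>x. g (f x))" "continuous_on A (\<lambda>x. g' (f x))"
    if "continuous_on A f" for A and f :: "'b::topological_space \<Rightarrow> real"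
    unfolding g_def g'_def using pos by (auto intro!: continuous_intros that simp: less_imp_neq[symmetric])
  have d1: "((\<lambda>t. (t\<^sup>2 + e\<^sup>2) powr (a / 2 + 1) / (a + 2)) has_real_derivative t * g t) (at t)" for t
  proof (rule DERIV_cong)
    show "((\<lambda>t. (t\<^sup>2 + e\<^sup>2) powr (a / 2 + 1) / (a + 2)) has_real_derivative
        ((a / 2 + 1) * (t\<^sup>2 + e\<^sup>2) powr (a / 2 + 1 - 1) * (2 * t)) / (a + 2)) (at t)"
      using pos[of t] by (intro DERIV_cdivide DERIV_fun_powr) (auto intro!: derivative_eq_intros)
    have "(a / 2 + 1) * g t * (2 * t) = (a + 2) * (t * g t)"
      by (simp add: algebra_simps)
    then show "((a / 2 + 1) * (t\<^sup>2 + e\<^sup>2) powr (a / 2 + 1 - 1) * (2 * t)) / (a + 2) = t * g t"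
      by (simp only: add_diff_cancel_right' g_def[symmetric]) (use a in simp)
  qed
  have d2: "((\<lambda>t. t * g t) has_real_derivative g' t) (at t)" for t
    unfolding g_def g'_def using pos[of t]
    by (auto intro!: derivative_eq_intros simp: field_simps power2_eq_square)
  have "has_laplacian (\<lambda>x. complex_of_real (((\<xi> \<bullet> x)\<^sup>2 + e\<^sup>2) powr (a / 2 + 1) / (a + 2)))
    (\<lambda>x. of_real (1 - (\<xi> \<bullet> x)\<^sup>2) * of_real (g' (\<xi> \<bullet> x))
        - of_real ((real CARD('n) - 1) * (\<xi> \<bullet> x)) * of_real ((\<xi> \<bullet> x) * g (\<xi> \<bullet> x)))"
    using d1 d2
    by (intro has_laplacian_zonal[OF \<xi>, where \<phi> = "\<lambda>t. complex_of_real ((t\<^sup>2 + e\<^sup>2) powr (a / 2 + 1) / (a + 2))"]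
        has_vector_derivative_of_real continuous_intros)
      (auto simp: has_real_derivative_iff_has_vector_derivative)
  from integral_laplacian_eq_0[OF this]
  have "(\<integral>x. complex_of_real ((1 - (\<xi> \<bullet> x)\<^sup>2) * g' (\<xi> \<bullet> x)
      - (real CARD('n) - 1) * (\<xi> \<bullet> x) * ((\<xi> \<bullet> x) * g (\<xi> \<bullet> x))) \<partial>M) = 0"
    by simp
  then have zero: "(\<integral>x. (1 - (\<xi> \<bullet> x)\<^sup>2) * g' (\<xi> \<bullet> x)
      - (real CARD('n) - 1) * (\<xi> \<bullet> x) * ((\<xi> \<bullet> x) * g (\<xi> \<bullet> x)) \<partial>M) = 0"
    by (simp only: integral_complex_of_real of_real_eq_0_iff)
  \<comment> \<open>The first-order term of the Laplacian carries \<open>t\<^sup>2 * g t\<close>,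
    which stays bounded as \<open>e\<close> tends to 0.\<close>
  have t2g: "t\<^sup>2 * g t \<le> 2" if "\<bar>t\<bar> \<le> 1" for t
  proof -
    have t1: "t\<^sup>2 \<le> 1"
      using that by (simp add: abs_square_le_1)
    have e1: "e\<^sup>2 \<le> 1"
      using e by (simp add: abs_square_le_1)
    have "t\<^sup>2 * g t \<le> (t\<^sup>2 + e\<^sup>2) * g t"
      by (intro mult_right_mono) (auto simp: g_def)
    also have "\<dots> = (t\<^sup>2 + e\<^sup>2) powr (1 + a / 2)"
      using pos[of t] by (simp add: g_def powr_add)
    also have "\<dots> \<le> 2 powr (1 + a / 2)"
      using t1 e1 pos[of t] a by (intro powr_mono2) auto
    also have "\<dots> \<le> 2 powr 1"
      using a by (intro powr_mono) auto
    finally show ?thesis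
      by simp
  qed
  \<comment> \<open>Here \<open>a > - 1\<close> matters: the main term controls a positive multiple
    of \<open>g\<close>.\<close>
  have g'_ge: "(1 + a) * g t \<le> g' t" for t
  proof -
    have "t\<^sup>2 * (t\<^sup>2 + e\<^sup>2) powr (a / 2 - 1) \<le> (t\<^sup>2 + e\<^sup>2) * (t\<^sup>2 + e\<^sup>2) powr (a / 2 - 1)"
      by (intro mult_right_mono) auto
    also have "\<dots> = g t"
      using pos[of t] by (simp add: g_def powr_diff)
    finally show ?thesis
      using mult_left_mono_neg[of "t\<^sup>2 * (t\<^sup>2 + e\<^sup>2) powr (a / 2 - 1)" "g t" a] a
      by (simp add: g'_def algebra_simps)
  qed
  \<comment> \<open>The factor \<open>1 - t\<^sup>2\<close> is at least 1/2 for
    \<open>t\<^sup>2 \<le> 1 / 2\<close>; beyond that \<open>g\<close> itself is at most 2, whence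
    the summand 2.\<close>
  have g_le: "g t \<le> 2 / (1 + a) * ((1 - t\<^sup>2) * g' t) + 2" if "\<bar>t\<bar> \<le> 1" for t
  proof -
    have t1: "t\<^sup>2 \<le> 1"
      using that by (simp add: abs_square_le_1)
    have ge: "(1 - t\<^sup>2) * ((1 + a) * g t) \<le> (1 - t\<^sup>2) * g' t"
      using t1 by (intro mult_left_mono g'_ge) auto
    have "2 * ((1 - t\<^sup>2) * g t) = 2 / (1 + a) * ((1 - t\<^sup>2) * ((1 + a) * g t))"
      using a by simp
    also have "\<dots> \<le> 2 / (1 + a) * ((1 - t\<^sup>2) * g' t)"
      using a by (intro mult_left_mono ge) auto
    finally have *: "2 * ((1 - t\<^sup>2) * g t) \<le> 2 / (1 + a) * ((1 - t\<^sup>2) * g' t)" .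
    show ?thesis
    proof (cases "t\<^sup>2 \<le> 1 / 2")
      case True
      then have "1 * g t \<le> (2 * (1 - t\<^sup>2)) * g t"
        by (intro mult_right_mono) (auto simp: g_def)
      then have "g t \<le> 2 * ((1 - t\<^sup>2) * g t)"
        by (simp only: mult.assoc mult_1)
      with * show ?thesis
        by linarith
    next
      case False
      have "g t \<le> (1 / 2) powr (a / 2)"
        unfolding g_def using False a e by (intro powr_mono2') (auto intro: add_increasing2)
      also have "\<dots> = 2 powr (- a / 2)"
        by (simp add: powr_minus_divide powr_divide)
      also have "\<dots> \<le> 2 powr 1"
        using a by (intro powr_mono) auto
      finally have "g t \<le> 2"
        by simp
      moreover have "0 \<le> 2 * ((1 - t\<^sup>2) * g t)"
        using t1 by (simp add: g_def)
      ultimately show ?thesis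
        using * by linarith
    qed
  qed
  have "(\<integral>x. (\<xi> \<bullet> x)\<^sup>2 * g (\<xi> \<bullet> x) \<partial>M) \<le> (\<integral>x. 2 \<partial>M)"
    using t2g inner_sphere_le_1[OF \<xi>]
    by (intro integral_mono integrable_continuous_on_sphere continuous_intros) (auto simp: space_M)
  then have I2: "(\<integral>x. (\<xi> \<bullet> x)\<^sup>2 * g (\<xi> \<bullet> x) \<partial>M) \<le> 2 * m"
    by (simp add: m_def space_M)
  have "(\<integral>x. (1 - (\<xi> \<bullet> x)\<^sup>2) * g' (\<xi> \<bullet> x) \<partial>M)
      = (\<integral>x. (real CARD('n) - 1) * (\<xi> \<bullet> x) * ((\<xi> \<bullet> x) * g (\<xi> \<bullet> x)) \<partial>M)"
    using zero by (subst (asm) Bochner_Integration.integral_diff)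
      (auto intro!: integrable_continuous_on_sphere continuous_intros)
  also have "\<dots> = (real CARD('n) - 1) * (\<integral>x. (\<xi> \<bullet> x)\<^sup>2 * g (\<xi> \<bullet> x) \<partial>M)"
    by (simp add: power2_eq_square mult.assoc)
  also have "\<dots> \<le> (real CARD('n) - 1) * (2 * m)"
    using card_ge_2 by (intro mult_left_mono I2) auto
  finally have I1: "(\<integral>x. (1 - (\<xi> \<bullet> x)\<^sup>2) * g' (\<xi> \<bullet> x) \<partial>M) \<le> (real CARD('n) - 1) * (2 * m)" .
  have "(\<integral>x. g (\<xi> \<bullet> x) \<partial>M) \<le> (\<integral>x. 2 / (1 + a) * ((1 - (\<xi> \<bullet> x)\<^sup>2) * g' (\<xi> \<bullet> x)) + 2 \<partial>M)"
    using g_le inner_sphere_le_1[OF \<xi>]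
    by (intro integral_mono integrable_continuous_on_sphere continuous_intros) (auto simp: space_M)
  also have "\<dots> = 2 / (1 + a) * (\<integral>x. (1 - (\<xi> \<bullet> x)\<^sup>2) * g' (\<xi> \<bullet> x) \<partial>M) + 2 * m"
    by (subst Bochner_Integration.integral_add)
      (use a in \<open>auto intro!: integrable_continuous_on_sphere continuous_intros simp: m_def space_M\<close>)
  also have "\<dots> \<le> 2 / (1 + a) * ((real CARD('n) - 1) * (2 * m)) + 2 * m"
    using a by (intro add_right_mono mult_left_mono I1) auto
  finally show "(\<integral>\<omega>. ((\<xi> \<bullet> \<omega>)\<^sup>2 + e\<^sup>2) powr (a / 2) \<partial>M)
      \<le> 2 / (1 + a) * ((real CARD('n) - 1) * (2 * measure M (sphere 0 1))) + 2 * measure M (sphere 0 1)"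
    by (simp add: g_def m_def)
qed

text \<open>On the equator the regularized power with \<open>a = - 1 / 2\<close> equals
  \<open>e powr (- 1 / 2)\<close>, while its integral stays below a constant independent of
  \<open>e\<close>; so the measure of the equator is at most
  \<open>C * e powr (1 / 2)\<close>.\<close>

lemma AE_inner_nonzero:
  fixes \<xi> :: "real^'n"
  assumes \<xi>: "\<xi> \<in> sphere 0 1"
  shows "AE \<omega> in M. \<xi> \<bullet> \<omega> \<noteq> 0"
proof -
  have "\<exists>C. \<forall>e\<in>{0<..1}. (\<integral>\<omega>. ((\<xi> \<bullet> \<omega>)\<^sup>2 + e\<^sup>2) powr ((- 1 / 2) / 2) \<partial>M) \<le> C"
    by (rule integral_regularized_abs_power_le[OF \<xi>]) auto
  then obtain C where C: "\<forall>e\<in>{0<..1}. (\<integral>\<omega>. ((\<xi> \<bullet> \<omega>)\<^sup>2 + e\<^sup>2) powr ((- 1 / 2) / 2) \<partial>M) \<le> C"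
    by blast
  define Z where "Z = {\<omega> \<in> space M. \<xi> \<bullet> \<omega> = 0}"
  have [measurable]: "(\<lambda>\<omega>. \<xi> \<bullet> \<omega>) \<in> borel_measurable M"
    by (intro measurable_continuous_on_sphere continuous_intros)
  have Z: "Z \<in> sets M"
    unfolding Z_def by measurable
  have "measure M Z \<le> C * (inverse (real (Suc k))) powr (1 / 2)" for k
  proof -
    define e where "e = inverse (real (Suc k))"
    have e: "0 < e" "e \<le> 1"
      by (auto simp: e_def field_simps)
    have cont: "continuous_on (sphere 0 1) (\<lambda>\<omega>. ((\<xi> \<bullet> \<omega>)\<^sup>2 + e\<^sup>2) powr ((- 1 / 2) / 2))"
      using e by (intro continuous_intros) (auto simp: add_nonneg_eq_0_iff)
    have "(\<integral>\<omega>. e powr (- 1 / 2) * indicator Z \<omega> \<partial>M) \<le> (\<integral>\<omega>. ((\<xi> \<bullet> \<omega>)\<^sup>2 + e\<^sup>2) powr ((- 1 / 2) / 2) \<partial>M)"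
    proof (rule integral_mono)
      show "integrable M (\<lambda>\<omega>. ((\<xi> \<bullet> \<omega>)\<^sup>2 + e\<^sup>2) powr ((- 1 / 2) / 2))"
        by (rule integrable_continuous_on_sphere[OF cont])
      show "e powr (- 1 / 2) * indicator Z \<omega> \<le> ((\<xi> \<bullet> \<omega>)\<^sup>2 + e\<^sup>2) powr ((- 1 / 2) / 2)" for \<omega>
        using e by (auto simp: indicator_def Z_def powr_powr powr_numeral[symmetric] simp del: powr_numeral)
    qed (use Z in \<open>auto simp: emeasure_eq_measure\<close>)
    also have "\<dots> \<le> C"
      using C e by auto
    finally have "e powr (- 1 / 2) * measure M Z \<le> C"
      using Z by simp
    then show ?thesis
      using e unfolding e_def[symmetric] by (simp add: powr_minus_divide field_simps)
  qed
  moreover have "(\<lambda>k. C * (inverse (real (Suc k))) powr (1 / 2)) \<longlonglongrightarrow> C * 0"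
    by (intro tendsto_intros) (use tendsto_powr'[OF LIMSEQ_inverse_real_of_nat tendsto_const, of "1 / 2"] in simp)
  ultimately have "measure M Z \<le> 0"
    by (intro LIMSEQ_le_const[of "\<lambda>k. C * (inverse (real (Suc k))) powr (1 / 2)"]) auto
  then have "emeasure M Z = 0"
    using measure_nonneg[of M Z] by (simp add: emeasure_eq_measure)
  then show ?thesis
    using Z by (intro AE_I[of _ _ Z]) (auto simp: Z_def)
qed

text \<open>Monotone convergence: for \<open>a \<le> 0\<close> the regularized powers increase as
  \<open>e\<close> decreases, their integrals are bounded, and the limit is right off the null
  equator.\<close>

lemma integrable_abs_inner_powr:
  fixes \<xi> :: "real^'n"
  assumes \<xi>: "\<xi> \<in> sphere 0 1" and a: "- 1 < a" "a \<le> 0"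
  shows "integrable M (\<lambda>\<omega>. \<bar>\<xi> \<bullet> \<omega>\<bar> powr a)"
proof -
  obtain C where C: "\<forall>e\<in>{0<..1}. (\<integral>\<omega>. ((\<xi> \<bullet> \<omega>)\<^sup>2 + e\<^sup>2) powr (a / 2) \<partial>M) \<le> C"
    using integral_regularized_abs_power_le[OF assms] by blast
  define e where "e k = inverse (real (Suc k))" for k
  have e: "0 < e k" "e k \<le> 1" for k
    by (auto simp: e_def field_simps)
  define g where "g k \<omega> = ((\<xi> \<bullet> \<omega>)\<^sup>2 + (e k)\<^sup>2) powr (a / 2)" for k \<omega>
  have int: "integrable M (g k)" for k
    unfolding g_def using e[of k]
    by (intro integrable_continuous_on_sphere continuous_intros) (auto simp: add_nonneg_eq_0_iff)
  have mono: "mono (\<lambda>k. g k \<omega>)" for \<omega>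
  proof (rule monoI)
    fix j k :: nat assume "j \<le> k"
    then have "e k \<le> e j"
      by (simp add: e_def frac_le)
    then have "(e k)\<^sup>2 \<le> (e j)\<^sup>2"
      using e[of k] by (intro power_mono) auto
    moreover have "0 < (\<xi> \<bullet> \<omega>)\<^sup>2 + (e k)\<^sup>2"
      using e[of k] by (simp add: add_nonneg_pos)
    ultimately show "g j \<omega> \<le> g k \<omega>"
      unfolding g_def using a by (intro powr_mono2') auto
  qed
  have "incseq (\<lambda>k. \<integral>\<omega>. g k \<omega> \<partial>M)"
    by (intro incseq_SucI integral_mono int) (use mono in \<open>auto simp: mono_def\<close>)
  moreover have "\<forall>k. (\<integral>\<omega>. g k \<omega> \<partial>M) \<le> C"
    using C e unfolding g_def by auto
  ultimately obtain I where I: "(\<lambda>k. \<integral>\<omega>. g k \<omega> \<partial>M) \<longlonglongrightarrow> I"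
    by (rule incseq_convergent)
  show ?thesis
  proof (rule integrable_monotone_convergence[OF int AE_I2[OF mono] _ I])
    have "(\<lambda>k. g k \<omega>) \<longlonglongrightarrow> \<bar>\<xi> \<bullet> \<omega>\<bar> powr a" if "\<xi> \<bullet> \<omega> \<noteq> 0" for \<omega>
    proof -
      have "e \<longlonglongrightarrow> 0"
        unfolding e_def by (rule LIMSEQ_inverse_real_of_nat)
      then have "(\<lambda>k. g k \<omega>) \<longlonglongrightarrow> ((\<xi> \<bullet> \<omega>)\<^sup>2 + 0\<^sup>2) powr (a / 2)"
        unfolding g_def using that by (intro tendsto_intros) auto
      also have "((\<xi> \<bullet> \<omega>)\<^sup>2 + 0\<^sup>2) powr (a / 2) = (\<bar>\<xi> \<bullet> \<omega>\<bar> powr 2) powr (a / 2)"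
        using that by simp
      also have "\<dots> = \<bar>\<xi> \<bullet> \<omega>\<bar> powr a"
        by (simp only: powr_powr) simp
      finally show ?thesis .
    qed
    then show "AE \<omega> in M. (\<lambda>k. g k \<omega>) \<longlonglongrightarrow> \<bar>\<xi> \<bullet> \<omega>\<bar> powr a"
      using AE_inner_nonzero[OF \<xi>] by (auto elim: eventually_mono)
    have [measurable]: "(\<lambda>\<omega>. \<xi> \<bullet> \<omega>) \<in> borel_measurable M"
      by (intro measurable_continuous_on_sphere continuous_intros)
    show "(\<lambda>\<omega>. \<bar>\<xi> \<bullet> \<omega>\<bar> powr a) \<in> borel_measurable M"
      by measurable
  qed
qed

end

section \<open>Analytic continuation of the transform\<close>

text \<open>The entire function \<open>rGamma\<close> takes over from division by
  \<open>Gamma\<close>. At the poles both sides are 0, since \<open>Gamma\<close> has the default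
  value 0 there and division by 0 gives 0.\<close>

lemma abs_power_kernel_eq: "abs_power_kernel z t = rGamma ((z + 1) / 2) * abs_power z t"
  by (simp add: abs_power_kernel_def abs_power_def rGamma_inverse_Gamma field_simps)

text \<open>Absorbs the factor \<open>z + 1\<close> of the Laplacian of \<open>|t|^(z + 2)\<close>;
  this is why the Gamma normalization makes the continuation entire.\<close>

lemma rGamma_shift: "(z + 1) * rGamma ((z + 2 + 1) / 2) = 2 * rGamma ((z + 1) / 2)"
proof -
  have "(z + 2 + 1) / 2 = (z + 1) / 2 + 1"
    by (simp add: field_simps)
  then show ?thesis
    using rGamma_plus1[of "(z + 1) / 2"] by (simp add: field_simps)
qed

context sphere_measure
begin

definition J_integral :: "(real^'n \<Rightarrow> complex) \<Rightarrow> real^'n \<Rightarrow> complex \<Rightarrow> complex" where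
  "J_integral f \<xi> z = (\<integral>\<omega>. f \<omega> * abs_power_kernel z (\<xi> \<bullet> \<omega>) \<partial>M)"

lemma J_integral_eq: "J_integral f \<xi> z = rGamma ((z + 1) / 2) * (\<integral>\<omega>. f \<omega> * abs_power z (\<xi> \<bullet> \<omega>) \<partial>M)"
proof -
  have "J_integral f \<xi> z = (\<integral>\<omega>. rGamma ((z + 1) / 2) * (f \<omega> * abs_power z (\<xi> \<bullet> \<omega>)) \<partial>M)"
    unfolding J_integral_def abs_power_kernel_eq by (intro Bochner_Integration.integral_cong) simp_all
  then show ?thesis
    by simp
qed

lemma integrable_mult_abs_power:
  fixes f :: "real^'n \<Rightarrow> complex"
  assumes "continuous_on (sphere 0 1) f" "Re z > 0"
  shows "integrable M (\<lambda>\<omega>. f \<omega> * abs_power z (\<xi> \<bullet> \<omega>))"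
  using assms by (intro integrable_continuous_on_sphere continuous_intros) auto

text \<open>The weak identity times \<open>rGamma ((z + 2 + 1) / 2)\<close>. The factor
  \<open>z + 2\<close> cannot be cancelled, because the term with \<open>L\<close> lacks it.\<close>

lemma J_integral_recursion:
  fixes f L :: "real^'n \<Rightarrow> complex"
  assumes "weak_laplacian M f L" "\<xi> \<in> sphere 0 1" "Re z > 0"
  shows "2 * (z + 2) * J_integral f \<xi> z
    = (z + 2) * (z + of_nat CARD('n)) * J_integral f \<xi> (z + 2) + J_integral L \<xi> (z + 2)"
proof -
  note cont = weak_laplacian_continuous[OF assms(1)]
  define I where "I w = (\<integral>\<omega>. f \<omega> * abs_power w (\<xi> \<bullet> \<omega>) \<partial>M)" for w
  have "(\<integral>\<omega>. L \<omega> * abs_power (z + 2) (\<xi> \<bullet> \<omega>) \<partial>M)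
        = (\<integral>\<omega>. f \<omega> * ((z + 2) * ((z + 1) * abs_power z (\<xi> \<bullet> \<omega>)
             - (z + of_nat CARD('n)) * abs_power (z + 2) (\<xi> \<bullet> \<omega>))) \<partial>M)"
    using assms unfolding weak_laplacian_def by blast
  also have "\<dots> = (\<integral>\<omega>. (z + 2) * (z + 1) * (f \<omega> * abs_power z (\<xi> \<bullet> \<omega>))
      - (z + 2) * (z + of_nat CARD('n)) * (f \<omega> * abs_power (z + 2) (\<xi> \<bullet> \<omega>)) \<partial>M)"
    by (intro Bochner_Integration.integral_cong) (simp_all add: algebra_simps)
  also have "\<dots> = (z + 2) * (z + 1) * I z - (z + 2) * (z + of_nat CARD('n)) * I (z + 2)"
    unfolding I_def using assms(3) integrable_mult_abs_power[OF cont(1), of _ \<xi>]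
    by (subst Bochner_Integration.integral_diff) auto
  finally have "J_integral L \<xi> (z + 2)
      = rGamma ((z + 2 + 1) / 2) * ((z + 2) * (z + 1) * I z - (z + 2) * (z + of_nat CARD('n)) * I (z + 2))"
    by (simp only: J_integral_eq)
  also have "\<dots> = (z + 2) * ((z + 1) * rGamma ((z + 2 + 1) / 2)) * I z
        - (z + 2) * (z + of_nat CARD('n)) * J_integral f \<xi> (z + 2)"
    by (simp add: J_integral_eq I_def algebra_simps)
  finally show ?thesis
    unfolding rGamma_shift by (simp add: J_integral_eq I_def algebra_simps)
qed

lemma holomorphic_J_integral:
  fixes f :: "real^'n \<Rightarrow> complex"
  assumes f: "continuous_on (sphere 0 1) f" and \<xi>: "\<xi> \<in> sphere 0 1"
  shows "J_integral f \<xi> holomorphic_on {z. Re z > - 1}"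
proof -
  obtain B where B: "\<And>x. x \<in> sphere 0 1 \<Longrightarrow> norm (f x) \<le> B" "B > 0"
    using bounded_continuous_on_sphere[OF f] by blast
  have [measurable]: "f \<in> borel_measurable M" "(\<lambda>\<omega>. \<xi> \<bullet> \<omega>) \<in> borel_measurable M"
    by (intro measurable_continuous_on_sphere f continuous_intros)+
  have "(\<lambda>z. \<integral>\<omega>. f \<omega> * abs_power z (\<xi> \<bullet> \<omega>) \<partial>M) holomorphic_on {z. Re z > - 1}"
  proof (rule holomorphic_on_integral)
    show "open {z. Re z > - 1}"
      by (rule open_halfspace_Re_gt)
    show "(\<lambda>z. f x * abs_power z (\<xi> \<bullet> x)) holomorphic_on {z. Re z > - 1}" for x
      by (intro holomorphic_intros)
    show "(\<lambda>\<omega>. f \<omega> * abs_power z (\<xi> \<bullet> \<omega>)) \<in> borel_measurable M" for z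
      by measurable
    fix z assume z: "z \<in> {z. Re z > - 1}"
    \<comment> \<open>Half the distance to the line \<open>Re z = - 1\<close>. As
      \<open>|t| \<le> 1\<close>, the smallest real exponent on the disc dominates all others; the
      cap at 0 meets the range of \<open>integrable_abs_inner_powr\<close>.\<close>
    define r where "r = (Re z + 1) / 2"
    define a where "a = min 0 (Re z - r)"
    have a: "- 1 < a" "a \<le> 0" and r: "r > 0"
      using z by (auto simp: a_def r_def field_simps)
    have Re_ge: "Re w \<ge> Re z - r" if "w \<in> cball z r" for w
      using abs_Re_le_cmod[of "z - w"] that by (auto simp: dist_norm)
    show "\<exists>r C. r > 0 \<and> cball z r \<subseteq> {z. Re z > - 1} \<and> integrable M C \<and>
        (\<forall>w\<in>cball z r. \<forall>x\<in>space M. norm (f x * abs_power w (\<xi> \<bullet> x)) \<le> C x)"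
    proof (intro exI conjI ballI)
      show "integrable M (\<lambda>\<omega>. B * \<bar>\<xi> \<bullet> \<omega>\<bar> powr a)"
        by (intro integrable_mult_right integrable_abs_inner_powr \<xi> a)
      show "cball z r \<subseteq> {z. Re z > - 1}"
      proof
        fix w assume "w \<in> cball z r"
        from Re_ge[OF this] z show "w \<in> {z. Re z > - 1}"
          by (simp add: r_def field_simps)
      qed
      fix w x assume w: "w \<in> cball z r" and x: "x \<in> space M"
      then have "\<bar>\<xi> \<bullet> x\<bar> \<le> 1"
        using inner_sphere_le_1[OF \<xi>] by (simp add: space_M)
      then have "\<bar>\<xi> \<bullet> x\<bar> powr Re w \<le> \<bar>\<xi> \<bullet> x\<bar> powr a"
        using Re_ge[OF w] by (intro powr_mono') (auto simp: a_def)
      then show "norm (f x * abs_power w (\<xi> \<bullet> x)) \<le> B * \<bar>\<xi> \<bullet> x\<bar> powr a"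
        using B x by (auto simp: norm_mult norm_abs_power space_M intro!: mult_mono)
    qed (fact r)
  qed
  then show ?thesis
    unfolding J_integral_eq[abs_def] by (intro holomorphic_intros) auto
qed

lemma continuous_on_J_integral:
  fixes f :: "real^'n \<Rightarrow> complex"
  assumes f: "continuous_on (sphere 0 1) f"
  shows "continuous_on (sphere 0 1 \<times> {z. Re z > 0}) (\<lambda>(\<xi>, z). J_integral f \<xi> z)"
proof -
  have "continuous_on ((sphere 0 1 \<times> {z. Re z > 0}) \<times> sphere 0 1)
      (\<lambda>x. f (snd x) * abs_power (snd (fst x)) (fst (fst x) \<bullet> snd x))"
    by (intro continuous_intros continuous_on_compose2[OF f]) auto
  then have "continuous_on (sphere 0 1 \<times> {z. Re z > 0}) (\<lambda>p. \<integral>\<omega>. f \<omega> * abs_power (snd p) (fst p \<bullet> \<omega>) \<partial>M)"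
    by (intro continuous_on_integral_param) (simp add: case_prod_unfold)
  moreover have "continuous_on (sphere (0::real^'n) 1 \<times> {z. Re z > 0}) (\<lambda>p. rGamma ((snd p + 1) / 2))"
    by (intro continuous_on_compose2[OF holomorphic_on_imp_continuous_on[OF holomorphic_rGamma[of UNIV]]] continuous_intros) auto
  ultimately have "continuous_on (sphere 0 1 \<times> {z. Re z > 0})
      (\<lambda>p. rGamma ((snd p + 1) / 2) * (\<integral>\<omega>. f \<omega> * abs_power (snd p) (fst p \<bullet> \<omega>) \<partial>M))"
    by (intro continuous_intros)
  then show ?thesis
    by (simp add: J_integral_eq case_prod_unfold)
qed

text \<open>\<open>|t|^e\<close> tends to 1 off the null equator. This identifies the value at
  exponent 0 of any extension from \<open>Re z > 0\<close>, and for a Laplacian that value is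
  0.\<close>

lemma tendsto_J_integral_0:
  fixes f :: "real^'n \<Rightarrow> complex"
  assumes f: "continuous_on (sphere 0 1) f" and \<xi>: "\<xi> \<in> sphere 0 1"
  shows "(\<lambda>k. J_integral f \<xi> (of_real (inverse (real (Suc k))))) \<longlonglongrightarrow> rGamma (1 / 2) * (\<integral>\<omega>. f \<omega> \<partial>M)"
proof -
  let ?e = "\<lambda>k. of_real (inverse (real (Suc k))) :: complex"
  obtain B where B: "\<And>x. x \<in> sphere 0 1 \<Longrightarrow> norm (f x) \<le> B" "B > 0"
    using bounded_continuous_on_sphere[OF f] by blast
  have e: "?e \<longlonglongrightarrow> 0"
    using tendsto_of_real[OF LIMSEQ_inverse_real_of_nat, where 'a = complex] by simp
  have [measurable]: "f \<in> borel_measurable M" "(\<lambda>\<omega>. \<xi> \<bullet> \<omega>) \<in> borel_measurable M"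
    by (intro measurable_continuous_on_sphere f continuous_intros)+
  have "(\<lambda>k. \<integral>\<omega>. f \<omega> * abs_power (?e k) (\<xi> \<bullet> \<omega>) \<partial>M) \<longlonglongrightarrow> (\<integral>\<omega>. f \<omega> \<partial>M)"
  proof (rule integral_dominated_convergence)
    show "AE x in M. (\<lambda>k. f x * abs_power (?e k) (\<xi> \<bullet> x)) \<longlonglongrightarrow> f x"
      using AE_inner_nonzero[OF \<xi>]
    proof eventually_elim
      case (elim x)
      have "(\<lambda>k. f x * abs_power (?e k) (\<xi> \<bullet> x)) \<longlonglongrightarrow> f x * abs_power 0 (\<xi> \<bullet> x)"
        unfolding abs_power_def using elim by (intro tendsto_intros e) auto
      then show ?case
        using elim by (simp add: abs_power_def)
    qed
    show "AE x in M. norm (f x * abs_power (?e k) (\<xi> \<bullet> x)) \<le> B" for k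
    proof (rule AE_I2)
      fix x assume x: "x \<in> space M"
      have "\<bar>\<xi> \<bullet> x\<bar> powr Re (?e k) \<le> 1 powr Re (?e k)"
        using inner_sphere_le_1[OF \<xi>, of x] x by (intro powr_mono2) (auto simp: space_M)
      then show "norm (f x * abs_power (?e k) (\<xi> \<bullet> x)) \<le> B"
        using B x mult_mono[of "norm (f x)" B "\<bar>\<xi> \<bullet> x\<bar> powr Re (?e k)" 1]
        by (auto simp: norm_mult norm_abs_power space_M simp del: of_nat_Suc)
    qed
  qed auto
  moreover have "(\<lambda>k. rGamma ((?e k + 1) / 2)) \<longlonglongrightarrow> rGamma ((0 + 1) / 2)"
  proof (rule isCont_tendsto_compose[where g = rGamma])
    show "isCont rGamma ((0 + 1) / 2 :: complex)"
      using holomorphic_on_imp_continuous_on[OF holomorphic_rGamma[of UNIV]]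
      by (simp add: continuous_on_eq_continuous_at)
    show "(\<lambda>k. (?e k + 1) / 2) \<longlonglongrightarrow> (0 + 1) / 2"
      by (intro tendsto_intros e) auto
  qed
  ultimately have "(\<lambda>k. rGamma ((?e k + 1) / 2) * (\<integral>\<omega>. f \<omega> * abs_power (?e k) (\<xi> \<bullet> \<omega>) \<partial>M))
      \<longlonglongrightarrow> rGamma ((0 + 1) / 2) * (\<integral>\<omega>. f \<omega> \<partial>M)"
    by (rule tendsto_mult[rotated])
  then show ?thesis
    by (simp add: J_integral_eq)
qed

text \<open>Agreement is demanded for \<open>Re z > 0\<close>, where the kernels are continuous and
  the recursion is available. Joint continuity is carried along because the transform at a fixed
  exponent must again be continuous on the sphere, also where no integral represents it.\<close>

definition J_extension :: "real \<Rightarrow> (real^'n \<Rightarrow> complex) \<Rightarrow> (real^'n \<Rightarrow> complex \<Rightarrow> complex) \<Rightarrow> bool" where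
  "J_extension b f \<Phi> \<longleftrightarrow> continuous_on (sphere 0 1 \<times> {z. Re z > b}) (\<lambda>(\<xi>, z). \<Phi> \<xi> z) \<and>
     (\<forall>\<xi>\<in>sphere 0 1. \<Phi> \<xi> holomorphic_on {z. Re z > b} \<and> (\<forall>z. Re z > 0 \<longrightarrow> \<Phi> \<xi> z = J_integral f \<xi> z))"

text \<open>The induction runs over all \<open>f\<close> at once: the next strip for
  \<open>f\<close> uses the half-plane already reached both for \<open>f\<close> and for its weak
  Laplacian.\<close>

lemma J_extension_exists:
  fixes f :: "real^'n \<Rightarrow> complex"
  assumes "weakly_smooth M f"
  shows "\<exists>\<Phi>. J_extension (- 2 * real k) f \<Phi>"
  using assms
proof (induction k arbitrary: f)
  case 0
  have "J_integral f \<xi> holomorphic_on {z. Re z > 0}" if "\<xi> \<in> sphere 0 1" for \<xi>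
    by (rule holomorphic_on_subset[OF holomorphic_J_integral])
      (use that weakly_smooth_continuous[OF 0] in auto)
  then show ?case
    using continuous_on_J_integral[OF weakly_smooth_continuous[OF 0]]
    by (intro exI[of _ "J_integral f"]) (auto simp: J_extension_def)
next
  case (Suc k)
  obtain L where L: "weak_laplacian M f L" and smL: "weakly_smooth M L"
    using weakly_smoothE[OF Suc.prems] by blast
  define b where "b = - 2 * real k"
  define U where "U = {z. Re z > b - 2}"
  have U: "open U"
    unfolding U_def by (rule open_halfspace_Re_gt)
  obtain \<Phi> where \<Phi>: "J_extension b f \<Phi>"
    using Suc.IH[OF Suc.prems] unfolding b_def by blast
  obtain \<Psi> where \<Psi>: "J_extension b L \<Psi>"
    using Suc.IH[OF smL] unfolding b_def by blast
  have shift: "(\<lambda>z. z + 2) ` U \<subseteq> {z. Re z > b}"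
    by (auto simp: U_def)
  define G where "G \<xi> z = \<Psi> \<xi> (z + 2)" for \<xi> z
  define Q where "Q = (\<lambda>\<xi> z. if z = - 2 then deriv (G \<xi>) (- 2) else G \<xi> z / (z - (- 2)))"
  have hol2: "(\<lambda>z. F (z + 2)) holomorphic_on U" if "F holomorphic_on {z. Re z > b}" for F
    using holomorphic_on_compose_gen[OF _ that shift] by (simp add: o_def holomorphic_intros)
  have cont2: "continuous_on (sphere 0 1 \<times> U) (\<lambda>x. F (fst x) (snd x + 2))"
    if "continuous_on (sphere 0 1 \<times> {z. Re z > b}) (\<lambda>(\<xi>, z). F \<xi> z)" for F :: "real^'n \<Rightarrow> complex \<Rightarrow> complex"
    by (rule continuous_on_compose2[OF that, of _ "\<lambda>x. (fst x, snd x + 2)", simplified case_prod_unfold fst_conv snd_conv])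
      (auto intro!: continuous_intros simp: U_def)
  have holG: "G \<xi> holomorphic_on U" if "\<xi> \<in> sphere 0 1" for \<xi>
    unfolding G_def using hol2 \<Psi> that by (simp add: J_extension_def)
  have contG: "continuous_on (sphere 0 1 \<times> U) (\<lambda>(\<xi>, z). G \<xi> z)"
    unfolding G_def case_prod_unfold using cont2 \<Psi> by (simp add: J_extension_def)
  \<comment> \<open>In the first step \<open>U\<close> is the half-plane \<open>Re z > - 2\<close>
    and the point is still outside; afterwards the value is that of the extension for
    \<open>L\<close> at exponent 0, a multiple of the integral of \<open>L\<close>.\<close>
  have zero: "G \<xi> (- 2) = 0" if \<xi>: "\<xi> \<in> sphere 0 1" and "- 2 \<in> U" for \<xi>
  proof -
    have b: "b < 0"
      using that by (simp add: U_def)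
    have "continuous_on {z. Re z > b} (\<Psi> \<xi>)"
      using \<Psi> \<xi> by (auto simp: J_extension_def intro: holomorphic_on_imp_continuous_on)
    then have "isCont (\<Psi> \<xi>) 0"
      using b open_halfspace_Re_gt by (subst (asm) continuous_on_eq_continuous_at) auto
    moreover have "(\<lambda>k. of_real (inverse (real (Suc k))) :: complex) \<longlonglongrightarrow> 0"
      using tendsto_of_real[OF LIMSEQ_inverse_real_of_nat, where 'a = complex] by simp
    ultimately have "(\<lambda>k. \<Psi> \<xi> (of_real (inverse (real (Suc k))))) \<longlonglongrightarrow> \<Psi> \<xi> 0"
      by (rule isCont_tendsto_compose)
    moreover have "\<Psi> \<xi> (of_real (inverse (real (Suc k)))) = J_integral L \<xi> (of_real (inverse (real (Suc k))))" for k
      using \<Psi> \<xi> by (simp add: J_extension_def)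
    ultimately have "\<Psi> \<xi> 0 = rGamma (1 / 2) * (\<integral>\<omega>. L \<omega> \<partial>M)"
      using tendsto_J_integral_0[OF weak_laplacian_continuous(2)[OF L] \<xi>] by (simp add: LIMSEQ_unique)
    then show ?thesis
      using L by (simp add: G_def weak_laplacian_def)
  qed
  have holQ: "Q \<xi> holomorphic_on U" if "\<xi> \<in> sphere 0 1" for \<xi>
    using removable_quotient_family(1)[OF U compact_sphere holG contG zero that] unfolding Q_def by simp
  have contQ: "continuous_on (sphere 0 1 \<times> U) (\<lambda>(\<xi>, z). Q \<xi> z)"
    using removable_quotient_family(2)[OF U compact_sphere holG contG zero] unfolding Q_def by simp
  define \<Phi>' where "\<Phi>' \<xi> z = ((z + of_nat CARD('n)) * \<Phi> \<xi> (z + 2) + Q \<xi> z) / 2" for \<xi> z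
  have "J_extension (b - 2) f \<Phi>'"
    unfolding J_extension_def U_def[symmetric]
  proof (intro conjI ballI allI impI)
    have "continuous_on (sphere 0 1 \<times> U) (\<lambda>x. ((snd x + of_nat CARD('n)) * \<Phi> (fst x) (snd x + 2) + Q (fst x) (snd x)) / 2)"
      using cont2[of \<Phi>] \<Phi> contQ by (intro continuous_intros) (auto simp: J_extension_def case_prod_unfold)
    then show "continuous_on (sphere 0 1 \<times> U) (\<lambda>(\<xi>, z). \<Phi>' \<xi> z)"
      by (simp add: \<Phi>'_def case_prod_unfold)
    fix \<xi> :: "real^'n" assume \<xi>: "\<xi> \<in> sphere 0 1"
    show "\<Phi>' \<xi> holomorphic_on U"
      unfolding \<Phi>'_def using \<Phi> \<xi> by (intro holomorphic_intros hol2 holQ) (auto simp: J_extension_def)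
    fix z :: complex assume z: "Re z > 0"
    then have z2: "z + 2 \<noteq> 0" "z \<noteq> - 2"
      by (auto simp: complex_eq_iff)
    have "\<Phi> \<xi> (z + 2) = J_integral f \<xi> (z + 2)" "G \<xi> z = J_integral L \<xi> (z + 2)"
      using \<Phi> \<Psi> \<xi> z by (simp_all add: J_extension_def G_def)
    then have "(z + 2) * \<Phi>' \<xi> z = ((z + 2) * (z + of_nat CARD('n)) * J_integral f \<xi> (z + 2)
        + (z + 2) * (J_integral L \<xi> (z + 2) / (z + 2))) / 2"
      using z2 by (simp add: \<Phi>'_def Q_def algebra_simps)
    also have "\<dots> = (2 * (z + 2) * J_integral f \<xi> z) / 2"
      unfolding J_integral_recursion[OF L \<xi> z] using z2 by simp
    also have "\<dots> = (z + 2) * J_integral f \<xi> z"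
      by (simp add: field_simps)
    finally have "(z + 2) * \<Phi>' \<xi> z = (z + 2) * J_integral f \<xi> z" .
    then show "\<Phi>' \<xi> z = J_integral f \<xi> z"
      using z2 by simp
  qed
  moreover have "b - 2 = - 2 * real (Suc k)"
    by (simp add: b_def)
  ultimately show ?case
    by metis
qed

lemma J_continuation_exists:
  fixes f :: "real^'n \<Rightarrow> complex"
  assumes "weakly_smooth M f"
  shows "\<exists>\<Phi>. continuous_on (sphere 0 1 \<times> UNIV) (\<lambda>(\<xi>, z). \<Phi> \<xi> z) \<and>
    (\<forall>\<xi>\<in>sphere 0 1. entire_continuation_of (\<Phi> \<xi>) (J_integral f \<xi>))"
proof -
  obtain \<Phi> where \<Phi>: "\<And>k. J_extension (- 2 * real k) f (\<Phi> k)"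
    using J_extension_exists[OF assms] by metis
  define H where "H k = {z. Re z > - 2 * real k}" for k
  have H: "open (H k)" "convex (H k)" for k
    unfolding H_def by (rule open_halfspace_Re_gt convex_halfspace_Re_gt)+
  have cont: "continuous_on (sphere 0 1 \<times> H k) (\<lambda>(\<xi>, z). \<Phi> k \<xi> z)"
    and hol: "\<xi> \<in> sphere 0 1 \<Longrightarrow> \<Phi> k \<xi> holomorphic_on H k"
    and eq: "\<xi> \<in> sphere 0 1 \<Longrightarrow> Re z > 0 \<Longrightarrow> \<Phi> k \<xi> z = J_integral f \<xi> z" for k \<xi> z
    using \<Phi>[of k] by (auto simp: J_extension_def H_def)
  have H0: "open {z::complex. Re z > 0}" "{z::complex. Re z > 0} \<noteq> {}"
    using open_halfspace_Re_gt[of 0] by (auto intro: exI[of _ 1])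
  have agree: "\<Phi> j \<xi> z = \<Phi> k \<xi> z" if "\<xi> \<in> sphere 0 1" "z \<in> H j" "z \<in> H k" for j k \<xi> z
  proof -
    have sub: "H (min j k) \<subseteq> H j" "H (min j k) \<subseteq> H k" "z \<in> H (min j k)"
      using that by (auto simp: H_def min_def)
    show ?thesis
      by (rule analytic_continuation_open[OF H0(1) H(1)[of "min j k"] H0(2)])
        (use sub that eq in \<open>auto intro: holomorphic_on_subset[OF hol] convex_connected[OF H(2)] simp: H_def\<close>)
  qed
  \<comment> \<open>By \<open>agree\<close> every index whose half-plane contains \<open>z\<close>
    gives the same value; a definite choice makes \<Psi> a total function.\<close>
  define \<Psi> where "\<Psi> \<xi> z = \<Phi> (nat \<lceil>\<bar>Re z\<bar>\<rceil> + 1) \<xi> z" for \<xi> z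
  have inH: "z \<in> H (nat \<lceil>\<bar>Re z\<bar>\<rceil> + 1)" for z
  proof -
    have "- 2 * (k + 1) < x" if "\<bar>x\<bar> \<le> k" for x k :: real
      using that by (simp add: abs_le_iff)
    from this[OF real_nat_ceiling_ge] show ?thesis
      unfolding H_def mem_Collect_eq of_nat_add of_nat_1 .
  qed
  have \<Psi>: "\<Psi> \<xi> z = \<Phi> k \<xi> z" if "\<xi> \<in> sphere 0 1" "z \<in> H k" for \<xi> z k
    unfolding \<Psi>_def by (rule agree[OF that(1) inH that(2)])
  have UN: "(\<Union>k. H k) = UNIV"
    using inH by blast
  have hol\<Psi>: "\<Psi> \<xi> holomorphic_on UNIV" if "\<xi> \<in> sphere 0 1" for \<xi>
  proof -
    have "\<Psi> \<xi> holomorphic_on (\<Union>k. H k)"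
      by (intro holomorphic_on_UN_open H holomorphic_transform[OF hol[OF that]])
        (rule \<Psi>[OF that, symmetric])
    then show ?thesis
      by (simp add: UN)
  qed
  have "continuous_on (sphere 0 1 \<times> UNIV) (\<lambda>(\<xi>, z). \<Psi> \<xi> z)"
    unfolding continuous_on_eq_continuous_within
  proof clarsimp
    fix \<xi> :: "real^'n" and z assume \<xi>: "norm \<xi> = 1"
    obtain k where k: "z \<in> H k"
      using inH by blast
    have "continuous_on (sphere 0 1 \<times> H k) (\<lambda>(\<xi>, z). \<Psi> \<xi> z)"
      by (rule continuous_on_eq[OF cont]) (auto intro!: \<Psi>[symmetric])
    then have "continuous (at (\<xi>, z) within sphere 0 1 \<times> H k) (\<lambda>(\<xi>, z). \<Psi> \<xi> z)"
      using \<xi> k by (simp add: continuous_on_eq_continuous_within)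
    moreover have "at (\<xi>, z) within sphere 0 1 \<times> UNIV = at (\<xi>, z) within sphere 0 1 \<times> H k"
      by (rule at_within_nhd[of _ "UNIV \<times> H k"]) (use k H in \<open>auto intro: open_Times\<close>)
    ultimately show "continuous (at (\<xi>, z) within sphere 0 1 \<times> UNIV) (\<lambda>(\<xi>, z). \<Psi> \<xi> z)"
      by simp
  qed
  moreover have "entire_continuation_of (\<Psi> \<xi>) (J_integral f \<xi>)" if \<xi>: "\<xi> \<in> sphere 0 1" for \<xi>
    unfolding entire_continuation_of_def
  proof (intro conjI allI impI)
    show "\<Psi> \<xi> holomorphic_on UNIV"
      by (rule hol\<Psi>[OF \<xi>])
    fix z assume z: "- 1 < Re z"
    show "\<Psi> \<xi> z = J_integral f \<xi> z"
    \<comment> \<open>The extensions were matched with the integral only for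
      \<open>Re z > 0\<close>; holomorphy of the integral itself for \<open>Re z > - 1\<close>
      closes the gap.\<close>
    proof (rule analytic_continuation_open[OF H0(1) _ H0(2), of "{z. Re z > - 1}" "\<Psi> \<xi>" "J_integral f \<xi>"])
      show "\<Psi> \<xi> holomorphic_on {z. - 1 < Re z}"
        by (rule holomorphic_on_subset[OF hol\<Psi>[OF \<xi>]]) auto
      show "J_integral f \<xi> holomorphic_on {z. - 1 < Re z}"
        by (rule holomorphic_J_integral[OF weakly_smooth_continuous[OF assms] \<xi>])
      show "\<Psi> \<xi> z = J_integral f \<xi> z" if "z \<in> {z. 0 < Re z}" for z
        using \<Psi>[OF \<xi>, of z 0] eq[OF \<xi>, of z 0] that by (simp add: H_def)
    qed (use z in \<open>auto intro: open_halfspace_Re_gt convex_connected[OF convex_halfspace_Re_gt]\<close>)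
  qed
  ultimately show ?thesis
    by blast
qed

section \<open>The transform as the unique entire continuation\<close>

lemma J_transform_eqI:
  assumes "entire_continuation_of F (J_integral f \<xi>)"
  shows "J_transform M z f \<xi> = F z"
proof -
  have "(THE G. entire_continuation_of G (J_integral f \<xi>)) = F"
    using assms entire_continuation_of_unique by blast
  moreover have "J_integral f \<xi> = (\<lambda>z. \<integral>\<omega>. f \<omega> * abs_power_kernel z (\<xi> \<bullet> \<omega>) \<partial>M)"
    by (simp add: fun_eq_iff J_integral_def)
  ultimately show ?thesis
    by (simp add: J_transform_def)
qed

lemma entire_continuation_of_J_transform:
  fixes f :: "real^'n \<Rightarrow> complex"
  assumes "weakly_smooth M f" "\<xi> \<in> sphere 0 1"
  shows "entire_continuation_of (\<lambda>z. J_transform M z f \<xi>) (J_integral f \<xi>)"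
  using J_continuation_exists[OF assms(1)] assms(2) J_transform_eqI by (metis (no_types, lifting) ext)

lemma holomorphic_J_transform:
  fixes f :: "real^'n \<Rightarrow> complex"
  assumes "weakly_smooth M f" "\<xi> \<in> sphere 0 1"
  shows "(\<lambda>z. J_transform M z f \<xi>) holomorphic_on UNIV"
  using entire_continuation_of_J_transform[OF assms] by (simp add: entire_continuation_of_def)

lemma J_transform_eq_integral:
  fixes f :: "real^'n \<Rightarrow> complex"
  assumes "weakly_smooth M f" "\<xi> \<in> sphere 0 1" "Re z > - 1"
  shows "J_transform M z f \<xi> = J_integral f \<xi> z"
  using entire_continuation_of_J_transform[OF assms(1,2)] assms(3) by (simp add: entire_continuation_of_def)

lemma continuous_on_J_transform:
  fixes f :: "real^'n \<Rightarrow> complex"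
  assumes "weakly_smooth M f"
  shows "continuous_on (sphere 0 1 \<times> UNIV) (\<lambda>(\<xi>, z). J_transform M z f \<xi>)"
proof -
  obtain \<Phi> where \<Phi>: "continuous_on (sphere 0 1 \<times> UNIV) (\<lambda>(\<xi>, z). \<Phi> \<xi> z)"
    "\<And>\<xi>. \<xi> \<in> sphere 0 1 \<Longrightarrow> entire_continuation_of (\<Phi> \<xi>) (J_integral f \<xi>)"
    using J_continuation_exists[OF assms] by blast
  show ?thesis
    by (rule continuous_on_eq[OF \<Phi>(1)]) (use J_transform_eqI[OF \<Phi>(2)] in auto)
qed

end

text \<open>The bound \<open>b\<close> is free, so that identities may be checked where all kernels
  involved are continuous.\<close>

lemma entire_eqI:
  assumes "F holomorphic_on UNIV" "G holomorphic_on UNIV" "\<And>z. Re z > b \<Longrightarrow> F z = G z"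
  shows "F z = G z"
proof (rule analytic_continuation_open[of "{z. Re z > b}" UNIV F G])
  show "{z. Re z > b} \<noteq> {}"
    by (auto intro: exI[of _ "of_real (b + 1)"])
qed (use assms open_halfspace_Re_gt in auto)

section \<open>Approximate identities\<close>

context sphere_measure
begin

section \<open>Algebraic rules for the continued transform\<close>

lemma J_transform_minus: "J_transform M z f (- \<xi>) = J_transform M z f \<xi>"
  by (simp add: J_transform_def abs_power_kernel_def)

lemma J_transform_cmult:
  assumes "weakly_smooth M f" "\<xi> \<in> sphere 0 1"
  shows "J_transform M z (\<lambda>x. c * f x) \<xi> = c * J_transform M z f \<xi>"
proof (rule J_transform_eqI)
  have "J_integral (\<lambda>x. c * f x) \<xi> z = c * J_integral f \<xi> z" for z
    by (simp add: J_integral_def mult.assoc)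
  then show "entire_continuation_of (\<lambda>z. c * J_transform M z f \<xi>) (J_integral (\<lambda>x. c * f x) \<xi>)"
    using entire_continuation_of_J_transform[OF assms]
    by (auto simp: entire_continuation_of_def intro!: holomorphic_intros)
qed

lemma J_transform_recursion:
  assumes "weak_laplacian M f L" "weakly_smooth M f" "weakly_smooth M L" "\<xi> \<in> sphere 0 1"
  shows "2 * (z + 2) * J_transform M z f \<xi>
    = (z + 2) * (z + of_nat CARD('n)) * J_transform M (z + 2) f \<xi> + J_transform M (z + 2) L \<xi>"
proof (rule entire_eqI[of "\<lambda>z. 2 * (z + 2) * J_transform M z f \<xi>"
        "\<lambda>z. (z + 2) * (z + of_nat CARD('n)) * J_transform M (z + 2) f \<xi> + J_transform M (z + 2) L \<xi>" 0])
  have *: "(\<lambda>z. J_transform M (z + 2) g \<xi>) holomorphic_on UNIV" if "weakly_smooth M g" for g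
    using holomorphic_on_compose_gen[OF _ holomorphic_J_transform[OF that assms(4)], of "\<lambda>z. z + 2" UNIV]
    by (simp add: o_def holomorphic_intros)
  show "(\<lambda>z. 2 * (z + 2) * J_transform M z f \<xi>) holomorphic_on UNIV"
    by (intro holomorphic_intros holomorphic_J_transform assms)
  show "(\<lambda>z. (z + 2) * (z + of_nat CARD('n)) * J_transform M (z + 2) f \<xi> + J_transform M (z + 2) L \<xi>) holomorphic_on UNIV"
    by (intro holomorphic_intros * assms)
  show "2 * (z + 2) * J_transform M z f \<xi>
    = (z + 2) * (z + of_nat CARD('n)) * J_transform M (z + 2) f \<xi> + J_transform M (z + 2) L \<xi>" if "Re z > 0" for z
    using J_integral_recursion[OF assms(1,4) that] that assms by (simp add: J_transform_eq_integral)
qed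

lemma weak_laplacian_cmult:
  assumes "weak_laplacian M f L"
  shows "weak_laplacian M (\<lambda>x. c * f x) (\<lambda>x. c * L x)"
  using assms unfolding weak_laplacian_def by (auto intro!: continuous_intros simp: mult.assoc)

text \<open>The iterated Laplacians are the multiples \<open>\<mu> ^ k * f\<close>, so one
  eigenvalue equation supplies the whole chain.\<close>

lemma weakly_smooth_eigenfunction:
  assumes "weak_laplacian M f (\<lambda>x. \<mu> * f x)"
  shows "weakly_smooth M f"
proof -
  have "weak_laplacian M (\<lambda>x. \<mu> ^ k * f x) (\<lambda>x. \<mu> ^ Suc k * f x)" for k
    using weak_laplacian_cmult[OF assms, of "\<mu> ^ k"] by (simp add: mult_ac)
  then show ?thesis
    unfolding weakly_smooth_def by (intro exI[of _ "\<lambda>k x. \<mu> ^ k * f x"]) simp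
qed

lemma weakly_smooth_const: "weakly_smooth M (\<lambda>x. c)"
  using weakly_smooth_eigenfunction[of "\<lambda>x. c" 0] weak_laplacian_if_has_laplacian[OF has_laplacian_const] by simp

lemma cnj_abs_power: "cnj (abs_power z t) = abs_power (cnj z) t"
  unfolding abs_power_def by (cases "t = 0") (simp_all add: cnj_powr)

lemma weak_laplacian_cnj:
  assumes "weak_laplacian M f L"
  shows "weak_laplacian M (\<lambda>x. cnj (f x)) (\<lambda>x. cnj (L x))"
  unfolding weak_laplacian_def
proof (intro conjI ballI allI impI)
  show "continuous_on (sphere 0 1) (\<lambda>x. cnj (f x))" "continuous_on (sphere 0 1) (\<lambda>x. cnj (L x))"
    using weak_laplacian_continuous[OF assms] by (auto intro!: continuous_intros)
  have "(\<integral>\<omega>. L \<omega> \<partial>M) = 0"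
    using assms by (simp add: weak_laplacian_def)
  then show "(\<integral>\<omega>. cnj (L \<omega>) \<partial>M) = 0"
    by simp
  fix \<xi> :: "real^'n" and z :: complex assume "\<xi> \<in> sphere 0 1" "0 < Re z"
  then have "(\<integral>\<omega>. L \<omega> * abs_power (cnj z + 2) (\<xi> \<bullet> \<omega>) \<partial>M)
        = (\<integral>\<omega>. f \<omega> * ((cnj z + 2) * ((cnj z + 1) * abs_power (cnj z) (\<xi> \<bullet> \<omega>)
             - (cnj z + of_nat CARD('n)) * abs_power (cnj z + 2) (\<xi> \<bullet> \<omega>))) \<partial>M)"
    using assms by (simp add: weak_laplacian_def)
  from arg_cong[OF this, of cnj]
  show "(\<integral>\<omega>. cnj (L \<omega>) * abs_power (z + 2) (\<xi> \<bullet> \<omega>) \<partial>M)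
        = (\<integral>\<omega>. cnj (f \<omega>) * ((z + 2) * ((z + 1) * abs_power z (\<xi> \<bullet> \<omega>)
             - (z + of_nat CARD('n)) * abs_power (z + 2) (\<xi> \<bullet> \<omega>))) \<partial>M)"
    unfolding Bochner_Integration.integral_cnj[symmetric] by (simp add: cnj_abs_power)
qed

lemma weakly_smooth_cnj:
  assumes "weakly_smooth M f"
  shows "weakly_smooth M (\<lambda>x. cnj (f x))"
proof -
  obtain F where "F 0 = f" "\<And>k. weak_laplacian M (F k) (F (Suc k))"
    using assms unfolding weakly_smooth_def by blast
  then show ?thesis
    unfolding weakly_smooth_def by (intro exI[of _ "\<lambda>k x. cnj (F k x)"]) (auto intro: weak_laplacian_cnj)
qed

lemma J_transform_cnj:
  assumes "weakly_smooth M f" "\<xi> \<in> sphere 0 1"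
  shows "J_transform M (cnj z) (\<lambda>x. cnj (f x)) \<xi> = cnj (J_transform M z f \<xi>)"
proof -
  have "J_transform M w (\<lambda>x. cnj (f x)) \<xi> = cnj (J_transform M (cnj w) f \<xi>)" for w
  proof (rule J_transform_eqI)
    have "J_integral (\<lambda>x. cnj (f x)) \<xi> w = cnj (J_integral f \<xi> (cnj w))" for w
      unfolding J_integral_def Bochner_Integration.integral_cnj[symmetric]
      by (simp add: cnj_abs_power_kernel)
    moreover have "cnj \<circ> (\<lambda>w. J_transform M w f \<xi>) \<circ> cnj holomorphic_on UNIV"
      by (intro holomorphic_on_compose_cnj_cnj holomorphic_on_subset[OF holomorphic_J_transform[OF assms]]) auto
    then have "(\<lambda>w. cnj (J_transform M (cnj w) f \<xi>)) holomorphic_on UNIV"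
      by (simp add: o_def)
    ultimately show "entire_continuation_of (\<lambda>w. cnj (J_transform M (cnj w) f \<xi>)) (J_integral (\<lambda>x. cnj (f x)) \<xi>)"
      using entire_continuation_of_J_transform[OF assms] by (simp add: entire_continuation_of_def)
  qed
  from this[of "cnj z"] show ?thesis
    by simp
qed

section \<open>Zonal integrals and concentration at antipodal points\<close>

lemma rotation_matrix_inner:
  fixes Q :: "real^'n^'n"
  shows "rotation_matrix Q \<Longrightarrow> (Q *v x) \<bullet> (Q *v y) = x \<bullet> y"
  using orthogonal_transformation_matrix[of "(*v) Q"]
  by (simp add: rotation_matrix_def orthogonal_transformation_def)

lemma integral_zonal_eq:
  fixes g :: "real \<Rightarrow> 'b::{banach,second_countable_topology}" and \<xi> \<eta> :: "real^'n"
  assumes "\<xi> \<in> sphere 0 1" "\<eta> \<in> sphere 0 1" "g \<in> borel_measurable borel"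
  shows "(\<integral>\<omega>. g (\<xi> \<bullet> \<omega>) \<partial>M) = (\<integral>\<omega>. g (\<eta> \<bullet> \<omega>) \<partial>M)"
proof -
  obtain Q where Q: "rotation_matrix Q" "Q *v \<xi> = \<eta>"
    using rotation_to[OF assms(1,2)] .
  have "(\<lambda>\<omega>. \<eta> \<bullet> \<omega>) \<in> borel_measurable M"
    by (intro measurable_continuous_on_sphere continuous_intros)
  then have "(\<lambda>\<omega>. g (\<eta> \<bullet> \<omega>)) \<in> borel_measurable M"
    using assms(3) by (rule measurable_compose)
  from integral_rotation[OF Q(1) this] show ?thesis
    using rotation_matrix_inner[OF Q(1), of \<xi>] Q(2) by simp
qed

text \<open>A zonal integral does not depend on the axis. The common value is the eigenvalue of the
  transform on constants, the unit for all other eigenvalues.\<close>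

lemma J_transform_one_eq:
  assumes "\<xi> \<in> sphere 0 1" "\<eta> \<in> sphere 0 1"
  shows "J_transform M z (\<lambda>x. 1) \<xi> = J_transform M z (\<lambda>x. 1) \<eta>"
proof (rule entire_eqI[of "\<lambda>z. J_transform M z (\<lambda>x. 1) \<xi>" "\<lambda>z. J_transform M z (\<lambda>x. 1) \<eta>" 0])
  show "J_transform M z (\<lambda>x. 1) \<xi> = J_transform M z (\<lambda>x. 1) \<eta>" if "Re z > 0" for z
    using that assms integral_zonal_eq[OF assms borel_measurable_abs_power, of z]
    by (simp add: J_transform_eq_integral weakly_smooth_const J_integral_eq)
qed (intro holomorphic_J_transform weakly_smooth_const assms)+

text \<open>Caps of equal size have equal measure by rotation, and finitely many cover the compact
  sphere; if one were null, so would be the sphere.\<close>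

lemma cap_measure_pos:
  fixes \<xi> :: "real^'n"
  assumes \<xi>: "\<xi> \<in> sphere 0 1" and c: "c < 1"
  shows "0 < measure M {\<omega> \<in> space M. c < \<xi> \<bullet> \<omega>}"
proof (rule ccontr)
  assume "\<not> ?thesis"
  then have null: "measure M {\<omega> \<in> space M. c < \<xi> \<bullet> \<omega>} = 0"
    using measure_nonneg[of M] by (simp add: not_less antisym)
  have meas: "{\<omega> \<in> space M. c < \<eta> \<bullet> \<omega>} \<in> sets M" for \<eta> :: "real^'n"
  proof -
    have [measurable]: "(\<lambda>\<omega>. \<eta> \<bullet> \<omega>) \<in> borel_measurable M"
      by (intro measurable_continuous_on_sphere continuous_intros)
    show ?thesis
      by measurable
  qed
  have eq: "(\<integral>\<omega>. indicator {c<..} (\<eta> \<bullet> \<omega>) \<partial>M) = measure M {\<omega> \<in> space M. c < \<eta> \<bullet> \<omega>}" for \<eta> :: "real^'n"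
  proof -
    have "(\<integral>\<omega>. indicator {c<..} (\<eta> \<bullet> \<omega>) \<partial>M) = (\<integral>\<omega>. indicator {\<omega> \<in> space M. c < \<eta> \<bullet> \<omega>} \<omega> \<partial>M :: real)"
      by (intro Bochner_Integration.integral_cong) (auto simp: indicator_def)
    then show ?thesis
      using meas by simp
  qed
  have null': "{\<omega> \<in> space M. c < \<eta> \<bullet> \<omega>} \<in> null_sets M" if "\<eta> \<in> sphere 0 1" for \<eta> :: "real^'n"
    using integral_zonal_eq[OF \<xi> that, of "indicator {c<..} :: real \<Rightarrow> real"] null meas
    by (simp add: eq null_sets_def emeasure_eq_measure)
  have cover: "sphere 0 1 \<subseteq> (\<Union>\<eta>\<in>sphere 0 1. {\<omega> :: real^'n. c < \<eta> \<bullet> \<omega>})"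
  proof
    fix \<omega> :: "real^'n" assume \<omega>: "\<omega> \<in> sphere 0 1"
    then have "c < \<omega> \<bullet> \<omega>"
      using c by (simp add: dot_square_norm)
    with \<omega> show "\<omega> \<in> (\<Union>\<eta>\<in>sphere 0 1. {\<omega>. c < \<eta> \<bullet> \<omega>})"
      by blast
  qed
  obtain T where T: "T \<subseteq> sphere 0 1" "finite T" "sphere 0 1 \<subseteq> (\<Union>\<eta>\<in>T. {\<omega> :: real^'n. c < \<eta> \<bullet> \<omega>})"
    by (rule compactE_image[OF compact_sphere open_halfspace_gt cover])
  have "sphere 0 1 = (\<Union>\<eta>\<in>T. {\<omega> \<in> space M. c < \<eta> \<bullet> \<omega>})"
    unfolding space_M using T(3) by blast
  moreover have "(\<Union>\<eta>\<in>T. {\<omega> \<in> space M. c < \<eta> \<bullet> \<omega>}) \<in> null_sets M"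
    using T null' by (intro null_sets_UN' countable_finite) auto
  ultimately show False
    using measure_pos by (simp add: null_sets_def emeasure_eq_measure)
qed

text \<open>Outside the set \<open>|\<xi> \<bullet> \<omega>| > r\<close> the weight is at most
  \<open>r ^ j\<close>, while the total weight is at least \<open>s ^ j\<close> times the measure of
  a smaller cap, with \<open>s > r\<close>. Only neighbourhoods of \<xi> and of
  \<open>- \<xi>\<close> survive, where \<open>v\<close> has the same limit.\<close>

lemma approximate_identity:
  fixes v :: "real^'n \<Rightarrow> complex"
  assumes v: "continuous_on (sphere 0 1) v" and \<xi>: "\<xi> \<in> sphere 0 1" and even: "v (- \<xi>) = v \<xi>"
  shows "(\<lambda>j. (\<integral>\<omega>. v \<omega> * of_real (\<bar>\<xi> \<bullet> \<omega>\<bar> ^ j) \<partial>M) / of_real (\<integral>\<omega>. \<bar>\<xi> \<bullet> \<omega>\<bar> ^ j \<partial>M)) \<longlonglongrightarrow> v \<xi>"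
    and "0 < (\<integral>\<omega>. \<bar>\<xi> \<bullet> \<omega>\<bar> ^ j \<partial>M)"
proof -
  define I where "I j = (\<integral>\<omega>. \<bar>\<xi> \<bullet> \<omega>\<bar> ^ j \<partial>M)" for j
  have intI: "integrable M (\<lambda>\<omega>. \<bar>\<xi> \<bullet> \<omega>\<bar> ^ j)" for j
    by (intro integrable_continuous_on_sphere continuous_intros)
  have I_ge: "r ^ j * measure M {\<omega> \<in> space M. r < \<xi> \<bullet> \<omega>} \<le> I j" if "0 \<le> r" for r j
  proof -
    have [measurable]: "(\<lambda>\<omega>. \<xi> \<bullet> \<omega>) \<in> borel_measurable M"
      by (intro measurable_continuous_on_sphere continuous_intros)
    have "(\<integral>\<omega>. r ^ j * indicator {\<omega> \<in> space M. r < \<xi> \<bullet> \<omega>} \<omega> \<partial>M) \<le> I j"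
      unfolding I_def using that
      by (intro integral_mono intI integrable_mult_right integrable_real_indicator)
        (auto simp: indicator_def emeasure_eq_measure intro!: power_mono)
    then show ?thesis
      by simp
  qed
  have Ipos: "0 < I j" for j
  proof (rule less_le_trans)
    show "0 < (1 / 2) ^ j * measure M {\<omega> \<in> space M. 1 / 2 < \<xi> \<bullet> \<omega>}"
      by (intro mult_pos_pos cap_measure_pos \<xi>) auto
  qed (rule I_ge, simp)
  then show "0 < (\<integral>\<omega>. \<bar>\<xi> \<bullet> \<omega>\<bar> ^ j \<partial>M)"
    by (simp add: I_def)
  obtain B where B: "\<And>x. x \<in> sphere 0 1 \<Longrightarrow> norm (v x) \<le> B" "B > 0"
    using bounded_continuous_on_sphere[OF v] by blast
  define m where "m = measure M (sphere 0 1)"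
  show "(\<lambda>j. (\<integral>\<omega>. v \<omega> * of_real (\<bar>\<xi> \<bullet> \<omega>\<bar> ^ j) \<partial>M) / of_real (\<integral>\<omega>. \<bar>\<xi> \<bullet> \<omega>\<bar> ^ j \<partial>M)) \<longlonglongrightarrow> v \<xi>"
    unfolding I_def[symmetric]
  proof (rule LIMSEQ_I)
    fix e :: real assume e: "e > 0"
    have minus: "- \<xi> \<in> sphere 0 1"
      using \<xi> by simp
    have "\<exists>d>0. \<forall>x\<in>sphere 0 1. dist x \<eta> < d \<longrightarrow> dist (v x) (v \<eta>) < e / 2" if "\<eta> \<in> sphere 0 1" for \<eta>
      using v[unfolded continuous_on_iff, THEN bspec, OF that, THEN spec, of "e / 2"] e by simp
    then obtain d1 d2 where
      d1: "d1 > 0" "\<And>x. x \<in> sphere 0 1 \<Longrightarrow> dist x \<xi> < d1 \<Longrightarrow> dist (v x) (v \<xi>) < e / 2" and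
      d2: "d2 > 0" "\<And>x. x \<in> sphere 0 1 \<Longrightarrow> dist x (- \<xi>) < d2 \<Longrightarrow> dist (v x) (v (- \<xi>)) < e / 2"
      using \<xi> minus by meson
    define d where "d = min d1 d2"
    have d: "d > 0"
      using d1 d2 by (simp add: d_def)
    \<comment> \<open>For unit vectors the squared distance is
      \<open>2 - 2 * (\<eta> \<bullet> \<omega>)\<close>, so an inner product above
      \<open>1 - d\<^sup>2 / 2\<close> forces distance below \<open>d\<close>; the 1/2 keeps
      \<open>r\<close> positive.\<close>
    define r where "r = max (1 - d\<^sup>2 / 2) (1 / 2)"
    have r: "0 < r" "r < 1" "1 - d\<^sup>2 / 2 \<le> r"
      using d by (auto simp: r_def)
    have near: "norm (v \<omega> - v \<xi>) \<le> e / 2" if \<omega>: "\<omega> \<in> sphere 0 1" and gt: "r < \<bar>\<xi> \<bullet> \<omega>\<bar>" for \<omega>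
    proof -
      have dist2: "(dist \<omega> \<eta>)\<^sup>2 = 2 - 2 * (\<eta> \<bullet> \<omega>)" if "\<eta> \<in> sphere 0 1" for \<eta>
      proof -
        have "(dist \<omega> \<eta>)\<^sup>2 = (\<omega> - \<eta>) \<bullet> (\<omega> - \<eta>)"
          by (simp only: dist_norm power2_norm_eq_inner)
        also have "\<dots> = \<omega> \<bullet> \<omega> + \<eta> \<bullet> \<eta> - 2 * (\<eta> \<bullet> \<omega>)"
          by (simp add: inner_diff_left inner_diff_right inner_commute[of \<omega> \<eta>])
        also have "\<dots> = 2 - 2 * (\<eta> \<bullet> \<omega>)"
          using that \<omega> by (simp add: norm_eq_1)
        finally show ?thesis .
      qed
      have near': "dist \<omega> \<eta> < d" if "\<eta> \<in> sphere 0 1" "r < \<eta> \<bullet> \<omega>" for \<eta>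
      proof (rule power2_less_imp_less)
        show "(dist \<omega> \<eta>)\<^sup>2 < d\<^sup>2"
          unfolding dist2[OF that(1)] using r(3) that(2) by linarith
      qed (use d in simp)
      consider "r < \<xi> \<bullet> \<omega>" | "r < (- \<xi>) \<bullet> \<omega>"
        using gt by (auto simp: abs_if split: if_splits)
      then show ?thesis
      proof cases
        case 1
        then show ?thesis
          using d1(2)[OF \<omega>] near'[OF \<xi>] by (simp add: d_def dist_norm)
      next
        case 2
        then show ?thesis
          using d2(2)[OF \<omega>] near'[of "- \<xi>"] \<xi> by (simp add: d_def dist_norm even)
      qed
    qed
    define s where "s = (1 + r) / 2"
    have s: "r < s" "s < 1" "0 < s"
      using r by (auto simp: s_def)
    define m' where "m' = measure M {\<omega> \<in> space M. s < \<xi> \<bullet> \<omega>}"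
    have m': "m' > 0"
      unfolding m'_def by (rule cap_measure_pos[OF \<xi> s(2)])
    have est: "norm ((\<integral>\<omega>. v \<omega> * of_real (\<bar>\<xi> \<bullet> \<omega>\<bar> ^ j) \<partial>M) / of_real (I j) - v \<xi>)
        \<le> e / 2 + 2 * B * m / m' * (r / s) ^ j" for j
    proof -
      have int: "integrable M (\<lambda>\<omega>. v \<omega> * of_real (\<bar>\<xi> \<bullet> \<omega>\<bar> ^ j))" "integrable M (\<lambda>\<omega>. v \<xi> * complex_of_real (\<bar>\<xi> \<bullet> \<omega>\<bar> ^ j))"
        by (intro integrable_continuous_on_sphere continuous_intros v)+
      have "(\<integral>\<omega>. (v \<omega> - v \<xi>) * of_real (\<bar>\<xi> \<bullet> \<omega>\<bar> ^ j) \<partial>M)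
          = (\<integral>\<omega>. v \<omega> * of_real (\<bar>\<xi> \<bullet> \<omega>\<bar> ^ j) - v \<xi> * of_real (\<bar>\<xi> \<bullet> \<omega>\<bar> ^ j) \<partial>M)"
        by (simp add: left_diff_distrib)
      also have "\<dots> = (\<integral>\<omega>. v \<omega> * of_real (\<bar>\<xi> \<bullet> \<omega>\<bar> ^ j) \<partial>M) - v \<xi> * of_real (I j)"
        using int by (simp add: I_def integral_complex_of_real[symmetric] del: integral_complex_of_real of_real_power)
      finally have eq: "(\<integral>\<omega>. v \<omega> * of_real (\<bar>\<xi> \<bullet> \<omega>\<bar> ^ j) \<partial>M) / of_real (I j) - v \<xi>
          = (\<integral>\<omega>. (v \<omega> - v \<xi>) * of_real (\<bar>\<xi> \<bullet> \<omega>\<bar> ^ j) \<partial>M) / of_real (I j)"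
        using Ipos[of j] by (simp add: field_simps)
      have "norm (\<integral>\<omega>. (v \<omega> - v \<xi>) * of_real (\<bar>\<xi> \<bullet> \<omega>\<bar> ^ j) \<partial>M)
          \<le> (\<integral>\<omega>. norm ((v \<omega> - v \<xi>) * of_real (\<bar>\<xi> \<bullet> \<omega>\<bar> ^ j)) \<partial>M)"
        by (rule integral_norm_bound)
      also have "\<dots> \<le> (\<integral>\<omega>. e / 2 * \<bar>\<xi> \<bullet> \<omega>\<bar> ^ j + 2 * B * r ^ j \<partial>M)"
      proof (rule integral_mono)
        show "integrable M (\<lambda>\<omega>. norm ((v \<omega> - v \<xi>) * of_real (\<bar>\<xi> \<bullet> \<omega>\<bar> ^ j)))"
          by (intro integrable_continuous_on_sphere continuous_intros v)
        show "integrable M (\<lambda>\<omega>. e / 2 * \<bar>\<xi> \<bullet> \<omega>\<bar> ^ j + 2 * B * r ^ j)"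
          by (intro integrable_continuous_on_sphere continuous_intros)
        fix \<omega> assume "\<omega> \<in> space M"
        then have \<omega>: "\<omega> \<in> sphere 0 1"
          by (simp add: space_M)
        show "norm ((v \<omega> - v \<xi>) * of_real (\<bar>\<xi> \<bullet> \<omega>\<bar> ^ j)) \<le> e / 2 * \<bar>\<xi> \<bullet> \<omega>\<bar> ^ j + 2 * B * r ^ j"
        proof (cases "r < \<bar>\<xi> \<bullet> \<omega>\<bar>")
          case True
          have "norm (v \<omega> - v \<xi>) * \<bar>\<xi> \<bullet> \<omega>\<bar> ^ j \<le> e / 2 * \<bar>\<xi> \<bullet> \<omega>\<bar> ^ j"
            by (intro mult_right_mono near[OF \<omega> True]) auto
          moreover have "0 \<le> 2 * B * r ^ j"
            using B r by simp
          ultimately show ?thesis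
            by (simp add: norm_mult norm_power)
        next
          case False
          have "norm (v \<omega> - v \<xi>) \<le> 2 * B"
            using norm_triangle_ineq4[of "v \<omega>" "v \<xi>"] B(1)[OF \<omega>] B(1)[OF \<xi>] by linarith
          then have "norm (v \<omega> - v \<xi>) * \<bar>\<xi> \<bullet> \<omega>\<bar> ^ j \<le> 2 * B * r ^ j"
            using False B by (intro mult_mono power_mono) auto
          moreover have "0 \<le> e / 2 * \<bar>\<xi> \<bullet> \<omega>\<bar> ^ j"
            using e by simp
          ultimately show ?thesis
            by (simp add: norm_mult norm_power)
        qed
      qed
      also have "\<dots> = e / 2 * I j + 2 * B * r ^ j * m"
        using intI by (simp add: I_def m_def space_M)
      finally have "norm (\<integral>\<omega>. (v \<omega> - v \<xi>) * of_real (\<bar>\<xi> \<bullet> \<omega>\<bar> ^ j) \<partial>M) / I j \<le> (e / 2 * I j + 2 * B * r ^ j * m) / I j"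
        using Ipos[of j] by (intro divide_right_mono) auto
      also have "\<dots> = e / 2 + 2 * B * r ^ j * m / I j"
        using Ipos[of j] by (simp add: add_divide_distrib)
      also have "2 * B * r ^ j * m / I j \<le> 2 * B * r ^ j * m / (s ^ j * m')"
        using I_ge[of s j] s m' B r by (intro divide_left_mono) (auto simp: m'_def m_def intro!: mult_pos_pos Ipos)
      also have "\<dots> = 2 * B * m / m' * (r / s) ^ j"
        by (simp add: power_divide mult_ac)
      finally show ?thesis
        unfolding eq norm_divide using Ipos[of j] by simp
    qed
    have "(\<lambda>j. 2 * B * m / m' * (r / s) ^ j) \<longlonglongrightarrow> 2 * B * m / m' * 0"
      using r s by (intro tendsto_intros LIMSEQ_realpow_zero) auto
    then have "\<forall>\<^sub>F j in sequentially. 2 * B * m / m' * (r / s) ^ j < e / 2"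
      using e by (intro order_tendstoD(2)) auto
    then have "\<forall>\<^sub>F j in sequentially. norm ((\<integral>\<omega>. v \<omega> * of_real (\<bar>\<xi> \<bullet> \<omega>\<bar> ^ j) \<partial>M) / of_real (I j) - v \<xi>) < e"
    proof eventually_elim
      case (elim j)
      with est[of j] show ?case
        by linarith
    qed
    then show "\<exists>no. \<forall>j\<ge>no. norm ((\<integral>\<omega>. v \<omega> * of_real (\<bar>\<xi> \<bullet> \<omega>\<bar> ^ j) \<partial>M) / of_real (I j) - v \<xi>) < e"
      by (simp add: eventually_sequentially)
  qed
qed

end

section \<open>Self-adjointness\<close>

text \<open>Transforms with respect to \<open>M\<close> are functions to be integrated against
  \<open>N\<close> and vice versa; the pair is also used with the roles exchanged.\<close>

locale sphere_measure_pair = M: sphere_measure M + N: sphere_measure N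
  for M N :: "(real^'n) measure"
begin

lemma integral_swap:
  fixes K :: "real^'n \<Rightarrow> real^'n \<Rightarrow> complex"
  assumes K: "continuous_on (sphere 0 1 \<times> sphere 0 1) (\<lambda>(\<xi>, \<omega>). K \<xi> \<omega>)"
  shows "(\<integral>\<xi>. (\<integral>\<omega>. K \<xi> \<omega> \<partial>M) \<partial>N) = (\<integral>\<omega>. (\<integral>\<xi>. K \<xi> \<omega> \<partial>N) \<partial>M)"
proof -
  interpret pair_sigma_finite M N ..
  interpret MN: finite_measure "M \<Otimes>\<^sub>M N"
    by (rule finite_measure_pair_measure) unfold_locales
  have sp: "space (M \<Otimes>\<^sub>M N) = sphere 0 1 \<times> sphere 0 1"
    by (simp add: space_pair_measure M.space_M N.space_M)
  have id: "(\<lambda>x. x) \<in> borel_measurable M" "(\<lambda>x. x) \<in> borel_measurable N"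
    by (auto intro: M.measurable_continuous_on_sphere N.measurable_continuous_on_sphere)
  have "(\<lambda>p. (snd p, fst p)) \<in> measurable (M \<Otimes>\<^sub>M N) (borel :: ((real^'n) \<times> (real^'n)) measure)"
    unfolding borel_prod[symmetric]
    by (intro measurable_Pair measurable_compose[OF measurable_fst id(1)] measurable_compose[OF measurable_snd id(2)])
  then have "(\<lambda>p. (snd p, fst p)) \<in> measurable (M \<Otimes>\<^sub>M N) (restrict_space borel (sphere 0 1 \<times> sphere 0 1))"
    by (intro measurable_restrict_space2) (auto simp: sp)
  from measurable_compose[OF this borel_measurable_continuous_on_restrict[OF K]]
  have meas: "(\<lambda>(\<omega>, \<xi>). K \<xi> \<omega>) \<in> borel_measurable (M \<Otimes>\<^sub>M N)"
    by (simp add: case_prod_unfold)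
  have "bounded ((\<lambda>(\<xi>, \<omega>). K \<xi> \<omega>) ` (sphere 0 1 \<times> sphere 0 1))"
    by (intro compact_imp_bounded compact_continuous_image K compact_Times compact_sphere)
  then obtain B where B: "\<And>\<xi> \<omega>. \<xi> \<in> sphere 0 1 \<Longrightarrow> \<omega> \<in> sphere 0 1 \<Longrightarrow> norm (K \<xi> \<omega>) \<le> B"
    unfolding bounded_iff by fastforce
  have "integrable (M \<Otimes>\<^sub>M N) (\<lambda>(\<omega>, \<xi>). K \<xi> \<omega>)"
    by (rule MN.integrable_const_bound[OF AE_I2 meas, of B]) (auto simp: sp intro: B)
  from Fubini_integral[OF this] show ?thesis .
qed

lemma holomorphic_integral_J_transform:
  assumes f: "weakly_smooth M f" and q: "continuous_on (sphere 0 1) q"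
  shows "(\<lambda>z. \<integral>\<xi>. J_transform M z f \<xi> * q \<xi> \<partial>N) holomorphic_on UNIV"
proof -
  have "continuous_on (UNIV \<times> sphere 0 1) (\<lambda>x. J_transform M (fst x) f (snd x))"
    by (rule continuous_on_compose2[OF M.continuous_on_J_transform[OF f], of _ "\<lambda>x. (snd x, fst x)", simplified case_prod_unfold fst_conv snd_conv])
      (auto intro!: continuous_intros)
  then show ?thesis
    using M.holomorphic_J_transform[OF f]
    by (intro N.holomorphic_on_integral_continuous holomorphic_intros)
      (auto simp: case_prod_unfold intro!: continuous_intros continuous_on_compose2[OF q])
qed

text \<open>The kernel is symmetric in its two points, so for \<open>Re z > 0\<close> this is
  Fubini; both sides are entire in \<open>z\<close>.\<close>

lemma J_transform_self_adjoint:
  assumes f: "weakly_smooth M f" and g: "weakly_smooth N g"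
  shows "(\<integral>\<xi>. J_transform M z f \<xi> * g \<xi> \<partial>N) = (\<integral>\<omega>. f \<omega> * J_transform N z g \<omega> \<partial>M)"
proof (rule entire_eqI[of "\<lambda>z. \<integral>\<xi>. J_transform M z f \<xi> * g \<xi> \<partial>N" "\<lambda>z. \<integral>\<omega>. f \<omega> * J_transform N z g \<omega> \<partial>M" 0])
  note cf = weakly_smooth_continuous[OF f] and cg = weakly_smooth_continuous[OF g]
  show "(\<lambda>z. \<integral>\<xi>. J_transform M z f \<xi> * g \<xi> \<partial>N) holomorphic_on UNIV"
    by (rule holomorphic_integral_J_transform[OF f cg])
  interpret NM: sphere_measure_pair N M
    by unfold_locales
  show "(\<lambda>z. \<integral>\<omega>. f \<omega> * J_transform N z g \<omega> \<partial>M) holomorphic_on UNIV"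
    using NM.holomorphic_integral_J_transform[OF g cf] by (simp only: mult.commute)
  fix z :: complex assume z: "Re z > 0"
  have K: "continuous_on (sphere 0 1 \<times> sphere 0 1) (\<lambda>(\<xi>, \<omega>). f \<omega> * abs_power_kernel z (\<xi> \<bullet> \<omega>) * g \<xi>)"
    unfolding abs_power_kernel_eq case_prod_unfold using z
    by (auto intro!: continuous_intros continuous_on_compose2[OF cf] continuous_on_compose2[OF cg])
  have "(\<integral>\<xi>. J_transform M z f \<xi> * g \<xi> \<partial>N) = (\<integral>\<xi>. (\<integral>\<omega>. f \<omega> * abs_power_kernel z (\<xi> \<bullet> \<omega>) * g \<xi> \<partial>M) \<partial>N)"
    using z by (intro Bochner_Integration.integral_cong)
      (simp_all add: N.space_M M.J_transform_eq_integral[OF f] M.J_integral_def)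
  also have "\<dots> = (\<integral>\<omega>. (\<integral>\<xi>. f \<omega> * abs_power_kernel z (\<xi> \<bullet> \<omega>) * g \<xi> \<partial>N) \<partial>M)"
    by (rule integral_swap[OF K])
  also have "\<dots> = (\<integral>\<omega>. (\<integral>\<xi>. f \<omega> * (g \<xi> * abs_power_kernel z (\<omega> \<bullet> \<xi>)) \<partial>N) \<partial>M)"
    by (simp add: inner_commute mult_ac)
  also have "\<dots> = (\<integral>\<omega>. f \<omega> * J_transform N z g \<omega> \<partial>M)"
    using z by (intro Bochner_Integration.integral_cong)
      (simp_all add: M.space_M N.J_transform_eq_integral[OF g] N.J_integral_def)
  finally show "(\<integral>\<xi>. J_transform M z f \<xi> * g \<xi> \<partial>N) = (\<integral>\<omega>. f \<omega> * J_transform N z g \<omega> \<partial>M)" .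
qed

text \<open>The kernel depends only on \<open>\<eta> \<bullet> \<omega>\<close>, so its Laplacians
  in \<omega> and in \<eta> coincide. The weak identity moves the Laplacian from \<open>f\<close>
  onto the kernel in \<omega>; read in \<eta>, Green's identity for \<open>N\<close> moves it on to
  the test kernel.\<close>

lemma integral_J_transform_laplacian:
  assumes W: "weak_laplacian M f L" and f: "weakly_smooth M f" and L: "weakly_smooth M L"
    and \<xi>: "\<xi> \<in> sphere 0 1" and w: "Re w > 0"
  shows "(\<integral>\<eta>. J_transform M z L \<eta> * abs_power (w + 2) (\<xi> \<bullet> \<eta>) \<partial>N)
        = (\<integral>\<eta>. J_transform M z f \<eta> * ((w + 2) * ((w + 1) * abs_power w (\<xi> \<bullet> \<eta>)
             - (w + of_nat CARD('n)) * abs_power (w + 2) (\<xi> \<bullet> \<eta>))) \<partial>N)"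
proof -
  define D where "D w t = (w + 2) * ((w + 1) * abs_power w t - (w + of_nat CARD('n)) * abs_power (w + 2) t)" for w t
  have contD [continuous_intros]: "continuous_on A (\<lambda>x. D v (h x))" if "continuous_on A h" "Re v > 0"
    for A v and h :: "'b::topological_space \<Rightarrow> real"
    unfolding D_def using that by (intro continuous_intros) auto
  have lap: "has_laplacian (\<lambda>x. abs_power (v + 2) (\<eta> \<bullet> x)) (\<lambda>x. D v (\<eta> \<bullet> x))" if "\<eta> \<in> sphere 0 1" "Re v > 0" for \<eta> :: "real^'n" and v
    unfolding D_def by (rule has_laplacian_abs_power[OF that])
  note cf = weakly_smooth_continuous[OF f] and cL = weakly_smooth_continuous[OF L]
  have "(\<integral>\<eta>. J_transform M z L \<eta> * abs_power (w + 2) (\<xi> \<bullet> \<eta>) \<partial>N)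
      = (\<integral>\<eta>. J_transform M z f \<eta> * D w (\<xi> \<bullet> \<eta>) \<partial>N)"
  proof (rule entire_eqI[of "\<lambda>z. \<integral>\<eta>. J_transform M z L \<eta> * abs_power (w + 2) (\<xi> \<bullet> \<eta>) \<partial>N"
        "\<lambda>z. \<integral>\<eta>. J_transform M z f \<eta> * D w (\<xi> \<bullet> \<eta>) \<partial>N" 2])
    show "(\<lambda>z. \<integral>\<eta>. J_transform M z L \<eta> * abs_power (w + 2) (\<xi> \<bullet> \<eta>) \<partial>N) holomorphic_on UNIV"
      using w by (intro holomorphic_integral_J_transform L continuous_intros) auto
    show "(\<lambda>z. \<integral>\<eta>. J_transform M z f \<eta> * D w (\<xi> \<bullet> \<eta>) \<partial>N) holomorphic_on UNIV"
      using w by (intro holomorphic_integral_J_transform f continuous_intros)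
    fix z :: complex assume "Re z > 2"
    \<comment> \<open>\<open>Re z > 2\<close> lets the exponent of the transform be written
      \<open>v + 2\<close> with \<open>Re v > 0\<close>, as the weak identity requires.\<close>
    define v where "v = z - 2"
    define c where "c = rGamma ((z + 1) / 2)"
    have v: "Re v > 0" "z = v + 2"
      using \<open>Re z > 2\<close> by (simp_all add: v_def)
    have JL: "J_transform M z L \<eta> = (\<integral>\<omega>. c * (f \<omega> * D v (\<eta> \<bullet> \<omega>)) \<partial>M)" if \<eta>: "\<eta> \<in> sphere 0 1" for \<eta>
    proof -
      have "(\<integral>\<omega>. L \<omega> * abs_power (v + 2) (\<eta> \<bullet> \<omega>) \<partial>M) = (\<integral>\<omega>. f \<omega> * D v (\<eta> \<bullet> \<omega>) \<partial>M)"
        using W \<eta> v(1) unfolding weak_laplacian_def D_def by blast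
      then show ?thesis
        using \<open>Re z > 2\<close> by (simp add: M.J_transform_eq_integral[OF L \<eta>] M.J_integral_eq c_def v(2))
    qed
    have Jf: "J_transform M z f \<eta> = (\<integral>\<omega>. c * (f \<omega> * abs_power z (\<eta> \<bullet> \<omega>)) \<partial>M)" if \<eta>: "\<eta> \<in> sphere 0 1" for \<eta>
      using \<open>Re z > 2\<close> by (simp add: M.J_transform_eq_integral[OF f \<eta>] M.J_integral_eq c_def)
    have "(\<integral>\<eta>. J_transform M z L \<eta> * abs_power (w + 2) (\<xi> \<bullet> \<eta>) \<partial>N)
        = (\<integral>\<eta>. (\<integral>\<omega>. c * (f \<omega> * D v (\<eta> \<bullet> \<omega>)) * abs_power (w + 2) (\<xi> \<bullet> \<eta>) \<partial>M) \<partial>N)"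
      by (intro Bochner_Integration.integral_cong refl) (simp add: N.space_M JL)
    also have "\<dots> = (\<integral>\<omega>. (\<integral>\<eta>. c * (f \<omega> * D v (\<eta> \<bullet> \<omega>)) * abs_power (w + 2) (\<xi> \<bullet> \<eta>) \<partial>N) \<partial>M)"
      using w v by (intro integral_swap)
        (auto simp: case_prod_unfold intro!: continuous_intros continuous_on_compose2[OF cf])
    also have "\<dots> = (\<integral>\<omega>. (\<integral>\<eta>. c * (f \<omega> * abs_power z (\<eta> \<bullet> \<omega>)) * D w (\<xi> \<bullet> \<eta>) \<partial>N) \<partial>M)"
    proof (rule Bochner_Integration.integral_cong[OF refl])
      fix \<omega> assume "\<omega> \<in> space M"
      then have \<omega>: "\<omega> \<in> sphere 0 1"
        by (simp add: M.space_M)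
      have "(\<integral>\<eta>. c * (f \<omega> * D v (\<eta> \<bullet> \<omega>)) * abs_power (w + 2) (\<xi> \<bullet> \<eta>) \<partial>N)
          = (\<integral>\<eta>. c * f \<omega> * (D v (\<omega> \<bullet> \<eta>) * abs_power (w + 2) (\<xi> \<bullet> \<eta>)) \<partial>N)"
        by (simp add: inner_commute mult_ac)
      also have "\<dots> = c * f \<omega> * (\<integral>\<eta>. D v (\<omega> \<bullet> \<eta>) * abs_power (w + 2) (\<xi> \<bullet> \<eta>) \<partial>N)"
        by simp
      also have "\<dots> = c * f \<omega> * (\<integral>\<eta>. abs_power z (\<omega> \<bullet> \<eta>) * D w (\<xi> \<bullet> \<eta>) \<partial>N)"
        unfolding v(2) by (simp only: N.green_identity[OF lap[OF \<omega> v(1)] lap[OF \<xi> w]])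
      also have "\<dots> = (\<integral>\<eta>. c * f \<omega> * (abs_power z (\<omega> \<bullet> \<eta>) * D w (\<xi> \<bullet> \<eta>)) \<partial>N)"
        by simp
      also have "\<dots> = (\<integral>\<eta>. c * (f \<omega> * abs_power z (\<eta> \<bullet> \<omega>)) * D w (\<xi> \<bullet> \<eta>) \<partial>N)"
        by (simp add: inner_commute mult_ac)
      finally show "(\<integral>\<eta>. c * (f \<omega> * D v (\<eta> \<bullet> \<omega>)) * abs_power (w + 2) (\<xi> \<bullet> \<eta>) \<partial>N)
          = (\<integral>\<eta>. c * (f \<omega> * abs_power z (\<eta> \<bullet> \<omega>)) * D w (\<xi> \<bullet> \<eta>) \<partial>N)" .
    qed
    also have "\<dots> = (\<integral>\<eta>. (\<integral>\<omega>. c * (f \<omega> * abs_power z (\<eta> \<bullet> \<omega>)) * D w (\<xi> \<bullet> \<eta>) \<partial>M) \<partial>N)"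
      using w \<open>Re z > 2\<close> by (intro integral_swap[symmetric])
        (auto simp: case_prod_unfold intro!: continuous_intros continuous_on_compose2[OF cf])
    also have "\<dots> = (\<integral>\<eta>. J_transform M z f \<eta> * D w (\<xi> \<bullet> \<eta>) \<partial>N)"
      by (intro Bochner_Integration.integral_cong refl) (simp add: N.space_M Jf)
    finally show "(\<integral>\<eta>. J_transform M z L \<eta> * abs_power (w + 2) (\<xi> \<bullet> \<eta>) \<partial>N)
      = (\<integral>\<eta>. J_transform M z f \<eta> * D w (\<xi> \<bullet> \<eta>) \<partial>N)" .
  qed
  then show ?thesis
    by (simp add: D_def)
qed

lemma continuous_on_J_transform_at:
  assumes "weakly_smooth M f"
  shows "continuous_on (sphere 0 1) (J_transform M z f)"
  by (rule continuous_on_compose2[OF M.continuous_on_J_transform[OF assms], of _ "\<lambda>x. (x, z)", simplified case_prod_unfold fst_conv snd_conv])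
    (auto intro!: continuous_intros)

lemma weak_laplacian_J_transform:
  assumes W: "weak_laplacian M f L" and f: "weakly_smooth M f" and L: "weakly_smooth M L"
  shows "weak_laplacian N (J_transform M z f) (J_transform M z L)"
  unfolding weak_laplacian_def
proof (intro conjI ballI allI impI)
  show "continuous_on (sphere 0 1) (J_transform M z f)" "continuous_on (sphere 0 1) (J_transform M z L)"
    by (intro continuous_on_J_transform_at f L)+
  obtain e :: "real^'n" where e: "e \<in> sphere 0 1"
    using vector_choose_size[of 1] by auto
  \<comment> \<open>Self-adjointness against 1 leaves the integral of \<open>L\<close> times a
    constant.\<close>
  have "(\<integral>\<xi>. J_transform M z L \<xi> \<partial>N) = (\<integral>\<omega>. L \<omega> * J_transform N z (\<lambda>x. 1) \<omega> \<partial>M)"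
    using J_transform_self_adjoint[OF L N.weakly_smooth_const[of 1]] by simp
  also have "\<dots> = (\<integral>\<omega>. L \<omega> * J_transform N z (\<lambda>x. 1) e \<partial>M)"
    using N.J_transform_one_eq[OF _ e] by (intro Bochner_Integration.integral_cong) (auto simp: M.space_M)
  also have "\<dots> = 0"
    using W by (simp add: weak_laplacian_def)
  finally show "(\<integral>\<xi>. J_transform M z L \<xi> \<partial>N) = 0" .
qed (rule integral_J_transform_laplacian[OF assms])

text \<open>Guarantees that the second transform, in \<open>N\<close>, of a first transform has an
  entire continuation.\<close>

lemma weakly_smooth_J_transform:
  assumes "weakly_smooth M f"
  shows "weakly_smooth N (J_transform M z f)"
proof -
  obtain F where F: "F 0 = f" "\<And>k. weak_laplacian M (F k) (F (Suc k))"
    using assms unfolding weakly_smooth_def by blast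
  have "weakly_smooth M (F k)" for k
    unfolding weakly_smooth_def by (intro exI[of _ "\<lambda>j. F (j + k)"]) (simp add: F(2))
  then have "weak_laplacian N (J_transform M z (F k)) (J_transform M z (F (Suc k)))" for k
    by (intro weak_laplacian_J_transform F(2))
  then show ?thesis
    unfolding weakly_smooth_def by (intro exI[of _ "\<lambda>k. J_transform M z (F k)"]) (simp add: F(1))
qed

end

section \<open>Eigenfunctions\<close>

lemma tendsto_linear_ratio:
  "(\<lambda>j. (z + 2 * of_nat j + a) / (z + 2 * of_nat j + b :: complex)) \<longlonglongrightarrow> 1"
proof -
  have inf: "filterlim (\<lambda>j. z + 2 * of_nat j + b :: complex) at_infinity sequentially"
  proof -
    have "filterlim (\<lambda>j. 2 * of_nat j :: complex) at_infinity sequentially"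
      by (rule tendsto_mult_filterlim_at_infinity[OF tendsto_const]) (auto intro: tendsto_of_nat)
    from tendsto_add_filterlim_at_infinity[OF tendsto_const[of "z + b"] this] show ?thesis
      by (simp add: algebra_simps)
  qed
  have "(\<lambda>j. 1 + (a - b) / (z + 2 * of_nat j + b)) \<longlonglongrightarrow> 1 + 0"
    by (intro tendsto_add tendsto_const tendsto_divide_0[OF tendsto_const inf])
  then have "(\<lambda>j. 1 + (a - b) / (z + 2 * of_nat j + b)) \<longlonglongrightarrow> 1"
    by simp
  moreover have "\<forall>\<^sub>F j in sequentially. 1 + (a - b) / (z + 2 * of_nat j + b) = (z + 2 * of_nat j + a) / (z + 2 * of_nat j + b)"
    using filterlim_at_infinity_imp_eventually_ne[OF inf, of 0] by eventually_elim (simp add: field_simps)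
  ultimately show ?thesis
    by (rule Lim_transform_eventually)
qed

context sphere_measure
begin

lemma integral_abs_power_shift:
  "(\<integral>\<omega>. v \<omega> * abs_power (z + 2 * of_nat j) (\<xi> \<bullet> \<omega>) \<partial>M)
    = (\<integral>\<omega>. (v \<omega> * abs_power z (\<xi> \<bullet> \<omega>)) * of_real (\<bar>\<xi> \<bullet> \<omega>\<bar> ^ (2 * j)) \<partial>M)"
proof (intro Bochner_Integration.integral_cong refl)
  fix \<omega>
  show "v \<omega> * abs_power (z + 2 * of_nat j) (\<xi> \<bullet> \<omega>) = (v \<omega> * abs_power z (\<xi> \<bullet> \<omega>)) * of_real (\<bar>\<xi> \<bullet> \<omega>\<bar> ^ (2 * j))"
    using abs_power_of_nat[of "\<xi> \<bullet> \<omega>" "2 * j"] by (cases "\<xi> \<bullet> \<omega> = 0") (simp_all add: abs_power_add)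
qed

text \<open>The fixed factor \<open>|t|^z\<close> joins the function \<open>v\<close>: it equals 1
  at \<xi> and \<open>- \<xi>\<close>, so the limit is unchanged.\<close>

lemma tendsto_integral_abs_power:
  fixes v :: "real^'n \<Rightarrow> complex"
  assumes v: "continuous_on (sphere 0 1) v" and \<xi>: "\<xi> \<in> sphere 0 1" and even: "v (- \<xi>) = v \<xi>" and z: "Re z > 0"
  shows "(\<lambda>j. (\<integral>\<omega>. v \<omega> * abs_power (z + 2 * of_nat j) (\<xi> \<bullet> \<omega>) \<partial>M)
      / of_real (\<integral>\<omega>. \<bar>\<xi> \<bullet> \<omega>\<bar> ^ (2 * j) \<partial>M)) \<longlonglongrightarrow> v \<xi>"
proof -
  have one: "\<xi> \<bullet> \<xi> = 1"
    using \<xi> by (simp add: norm_eq_1)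
  have "continuous_on (sphere 0 1) (\<lambda>\<omega>. v \<omega> * abs_power z (\<xi> \<bullet> \<omega>))"
    using z by (intro continuous_intros v) auto
  from approximate_identity(1)[OF this \<xi>] have
    "(\<lambda>j. (\<integral>\<omega>. (v \<omega> * abs_power z (\<xi> \<bullet> \<omega>)) * of_real (\<bar>\<xi> \<bullet> \<omega>\<bar> ^ j) \<partial>M) / of_real (\<integral>\<omega>. \<bar>\<xi> \<bullet> \<omega>\<bar> ^ j \<partial>M)) \<longlonglongrightarrow> v \<xi>"
    by (simp add: one even)
  from LIMSEQ_subseq_LIMSEQ[OF this, of "\<lambda>j. 2 * j"] show ?thesis
    unfolding integral_abs_power_shift by (simp add: strict_mono_def o_def)
qed

section \<open>The transform of the constant 1 and of eigenfunctions\<close>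

lemma J_transform_one_recursion:
  assumes "\<xi> \<in> sphere 0 1"
  shows "J_transform M z (\<lambda>x. 1) \<xi> = (z + of_nat CARD('n)) / 2 * J_transform M (z + 2) (\<lambda>x. 1) \<xi>"
proof (rule entire_eqI[of "\<lambda>z. J_transform M z (\<lambda>x. 1) \<xi>" "\<lambda>z. (z + of_nat CARD('n)) / 2 * J_transform M (z + 2) (\<lambda>x. 1) \<xi>" 0])
  note sm = weakly_smooth_const[of 1]
  show "(\<lambda>z. J_transform M z (\<lambda>x. 1) \<xi>) holomorphic_on UNIV"
    by (rule holomorphic_J_transform[OF sm assms])
  have "(\<lambda>z. J_transform M (z + 2) (\<lambda>x. 1) \<xi>) holomorphic_on UNIV"
    using holomorphic_on_compose_gen[OF _ holomorphic_J_transform[OF sm assms], of "\<lambda>z. z + 2" UNIV]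
    by (simp add: o_def holomorphic_intros)
  then show "(\<lambda>z. (z + of_nat CARD('n)) / 2 * J_transform M (z + 2) (\<lambda>x. 1) \<xi>) holomorphic_on UNIV"
    by (intro holomorphic_intros) auto
  fix z :: complex assume "Re z > 0"
  then have z: "z + 2 \<noteq> 0"
    by (auto simp: complex_eq_iff)
  have "J_transform M (z + 2) (\<lambda>x. 0) \<xi> = 0"
    using J_transform_cmult[OF sm assms, of "z + 2" 0] by simp
  then have "2 * (z + 2) * J_transform M z (\<lambda>x. 1) \<xi> = (z + 2) * (z + of_nat CARD('n)) * J_transform M (z + 2) (\<lambda>x. 1) \<xi>"
    using J_transform_recursion[OF weak_laplacian_if_has_laplacian[OF has_laplacian_const] sm weakly_smooth_const assms, of z]
    by (simp only: add_0_right)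
  then have "(z + 2) * (2 * J_transform M z (\<lambda>x. 1) \<xi>) = (z + 2) * ((z + of_nat CARD('n)) * J_transform M (z + 2) (\<lambda>x. 1) \<xi>)"
    by (simp only: mult_ac)
  then have "2 * J_transform M z (\<lambda>x. 1) \<xi> = (z + of_nat CARD('n)) * J_transform M (z + 2) (\<lambda>x. 1) \<xi>"
    using z by (simp only: mult_cancel_left) auto
  then show "J_transform M z (\<lambda>x. 1) \<xi> = (z + of_nat CARD('n)) / 2 * J_transform M (z + 2) (\<lambda>x. 1) \<xi>"
    by (simp add: field_simps)
qed

text \<open>Far to the right, along steps of 2, concentration at the poles makes the integral
  nonzero. The recursion brings this back to \<open>z\<close>; the hypothesis says that none of its
  factors vanishes.\<close>

lemma J_transform_one_nonzero:
  assumes \<xi>: "\<xi> \<in> sphere 0 1" and z: "\<And>j::nat. z + 2 * of_nat j + of_nat CARD('n) \<noteq> 0"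
  shows "J_transform M z (\<lambda>x. 1) \<xi> \<noteq> 0"
proof -
  define m where "m = nat \<lceil>\<bar>Re z\<bar>\<rceil> + 1"
  define w where "w = z + 2 * of_nat m"
  have "\<bar>Re z\<bar> < real m"
    unfolding m_def of_nat_add of_nat_1 using real_nat_ceiling_ge[of "\<bar>Re z\<bar>"] by linarith
  then have w: "Re w > 0"
    by (simp add: w_def)
  have "(\<lambda>j. (\<integral>\<omega>. 1 * abs_power (w + 2 * of_nat j) (\<xi> \<bullet> \<omega>) \<partial>M)
      / of_real (\<integral>\<omega>. \<bar>\<xi> \<bullet> \<omega>\<bar> ^ (2 * j) \<partial>M)) \<longlonglongrightarrow> 1"
    by (rule tendsto_integral_abs_power[OF _ \<xi> _ w]) auto
  then have "\<forall>\<^sub>F j in sequentially. (\<integral>\<omega>. 1 * abs_power (w + 2 * of_nat j) (\<xi> \<bullet> \<omega>) \<partial>M)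
      / of_real (\<integral>\<omega>. \<bar>\<xi> \<bullet> \<omega>\<bar> ^ (2 * j) \<partial>M) \<noteq> 0"
    by (rule tendsto_imp_eventually_ne) simp
  then obtain j where "(\<integral>\<omega>. 1 * abs_power (w + 2 * of_nat j) (\<xi> \<bullet> \<omega>) \<partial>M)
      / of_real (\<integral>\<omega>. \<bar>\<xi> \<bullet> \<omega>\<bar> ^ (2 * j) \<partial>M) \<noteq> 0"
    by (rule exE[OF eventually_happens'[OF sequentially_bot]])
  then have j: "(\<integral>\<omega>. 1 * abs_power (w + 2 * of_nat j) (\<xi> \<bullet> \<omega>) \<partial>M) \<noteq> 0"
    by auto
  have "(w + 2 * of_nat j + 1) / 2 \<notin> \<int>\<^sub>\<le>\<^sub>0"
    using w by (auto elim!: nonpos_Ints_cases simp: complex_eq_iff)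
  then have "rGamma ((w + 2 * of_nat j + 1) / 2) \<noteq> 0"
    by (simp add: rGamma_eq_zero_iff)
  then have *: "J_transform M (w + 2 * of_nat j) (\<lambda>x. 1) \<xi> \<noteq> 0"
    using j w by (simp add: J_transform_eq_integral[OF weakly_smooth_const \<xi>] J_integral_eq)
  have "J_transform M (z + 2 * of_nat i) (\<lambda>x. 1) \<xi> \<noteq> 0 \<Longrightarrow> J_transform M z (\<lambda>x. 1) \<xi> \<noteq> 0" for i
  proof (induction i)
    case (Suc i)
    have "J_transform M (z + 2 * of_nat i) (\<lambda>x. 1) \<xi>
        = (z + 2 * of_nat i + of_nat CARD('n)) / 2 * J_transform M (z + 2 * of_nat (Suc i)) (\<lambda>x. 1) \<xi>"
      using J_transform_one_recursion[OF \<xi>, of "z + 2 * of_nat i"] by (simp add: algebra_simps)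
    then have "J_transform M (z + 2 * of_nat i) (\<lambda>x. 1) \<xi> \<noteq> 0"
      by (rule ssubst) (use Suc.prems z[of i] in \<open>simp del: of_nat_Suc\<close>)
    then show ?case
      by (rule Suc.IH)
  qed simp
  from this[of "m + j"] * show ?thesis
    by (simp add: w_def algebra_simps)
qed

text \<open>The quotient formula for the eigenvalue, cleared of denominators so that it is an
  identity between entire functions and holds at every \<open>z\<close>.\<close>

lemma weak_laplacian_eigenfunction_J:
  fixes f :: "real^'n \<Rightarrow> complex"
  defines "d \<equiv> of_nat CARD('n) :: complex"
  assumes W: "weak_laplacian M f (\<lambda>x. - (2 * of_nat k * (2 * of_nat k + d - 2)) * f x)"
    and even: "\<And>x. f (- x) = f x" and \<xi>: "\<xi> \<in> sphere 0 1"
  shows "J_transform M z f \<xi> * (\<Prod>i<k. z + d + 2 * of_nat i)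
    = (\<Prod>i<k. z - 2 * of_nat i) * J_transform M z (\<lambda>x. 1) \<xi> * f \<xi>"
proof -
  define A where "A z = (\<Prod>i<k. z + d + 2 * of_nat i)" for z
  define B where "B z = (\<Prod>i<k. z - 2 * of_nat i)" for z :: complex
  define E where "E z = J_transform M z f \<xi>" for z
  define \<alpha> where "\<alpha> z = J_transform M z (\<lambda>x. 1) \<xi>" for z
  note cont = weak_laplacian_continuous(1)[OF W]
  have smf: "weakly_smooth M f"
    by (rule weakly_smooth_eigenfunction[OF W])
  have smL: "weakly_smooth M (\<lambda>x. - (2 * of_nat k * (2 * of_nat k + d - 2)) * f x)"
    by (rule weakly_smooth_eigenfunction[OF weak_laplacian_cmult[OF W]])
  \<comment> \<open>The eigenvalue is such that \<open>(z + 2) * (z + d) - 2k * (2k + d - 2)\<close>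
    factors as \<open>(z + 2 - 2k) * (z + d + 2k)\<close>.\<close>
  have recE: "2 * (z + 2) * E z = (z + 2 - 2 * of_nat k) * (z + d + 2 * of_nat k) * E (z + 2)" for z
    using J_transform_recursion[OF W smf smL \<xi>, of z] J_transform_cmult[OF smf \<xi>, of "z + 2" "- (2 * of_nat k * (2 * of_nat k + d - 2))"]
    unfolding E_def[symmetric] d_def[symmetric] by (simp add: algebra_simps)
  have rec\<alpha>: "2 * \<alpha> z = (z + d) * \<alpha> (z + 2)" for z
    using J_transform_one_recursion[OF \<xi>, of z] by (simp add: \<alpha>_def d_def mult.commute[of 2])
  \<comment> \<open>Shifting by 2 moves the products by one index; \<open>A\<close> and
    \<open>B\<close> are made to absorb the factors in which the recursions of \<open>E\<close> and
    \<alpha> differ.\<close>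
  have recA: "A z * (z + d + 2 * of_nat k) = (z + d) * A (z + 2)" for z
    using prod.lessThan_Suc_shift[of "\<lambda>i. z + d + 2 * of_nat i" k] by (simp add: A_def algebra_simps)
  have recB: "B (z + 2) * (z + 2 - 2 * of_nat k) = (z + 2) * B z" for z
    using prod.lessThan_Suc_shift[of "\<lambda>i. z + 2 - 2 * of_nat i" k] by (simp add: B_def algebra_simps)
  \<comment> \<open>All possible zeros are real; off the real axis the quotient \<open>R\<close> can
    be formed and shifted freely.\<close>
  have A0: "A w \<noteq> 0" and B0: "B w \<noteq> 0" and \<alpha>0: "\<alpha> w \<noteq> 0" if "Im w \<noteq> 0" for w
  proof -
    show "A w \<noteq> 0" "B w \<noteq> 0"
      using that unfolding A_def B_def d_def prod_zero_iff[OF finite_lessThan]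
      by (auto simp: complex_eq_iff)
    show "\<alpha> w \<noteq> 0"
      unfolding \<alpha>_def using that by (intro J_transform_one_nonzero \<xi>) (auto simp: complex_eq_iff)
  qed
  define R where "R z = E z * A z / (B z * \<alpha> z)" for z
  have R2: "R w = R (w + 2)" if w: "Im w \<noteq> 0" for w
  proof -
    have ne: "w + 2 \<noteq> 0" "w + d \<noteq> 0" "w + d + 2 * of_nat k \<noteq> 0" "w + 2 - 2 * of_nat k \<noteq> 0"
      using w by (auto simp: d_def complex_eq_iff)
    note ne' = A0[OF w] B0[OF w] \<alpha>0[OF w] B0[of "w + 2"] \<alpha>0[of "w + 2"]
    have "(E w * A w) * (B (w + 2) * \<alpha> (w + 2)) = (E (w + 2) * A (w + 2)) * (B w * \<alpha> w)"
    proof -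
      have "2 * (w + 2) * (w + d) * ((E w * A w) * (B (w + 2) * \<alpha> (w + 2)))
          = (2 * (w + 2) * E w) * A w * B (w + 2) * ((w + d) * \<alpha> (w + 2))"
        by (simp add: mult_ac)
      also have "\<dots> = E (w + 2) * (A w * (w + d + 2 * of_nat k)) * (B (w + 2) * (w + 2 - 2 * of_nat k)) * (2 * \<alpha> w)"
        unfolding recE rec\<alpha>[symmetric] by (simp add: mult_ac)
      also have "\<dots> = 2 * (w + 2) * (w + d) * ((E (w + 2) * A (w + 2)) * (B w * \<alpha> w))"
        unfolding recA recB by (simp add: mult_ac)
      finally show ?thesis
        using ne by (simp only: mult_cancel_left mult_eq_0_iff) auto
    qed
    then show ?thesis
      using ne' w unfolding R_def by (simp add: frac_eq_eq)
  qed
  have Rj: "R w = R (w + 2 * of_nat j)" if w: "Im w \<noteq> 0" for w j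
  proof (induction j)
    case (Suc j)
    have "R (w + 2 * of_nat j) = R (w + 2 * of_nat j + 2)"
      using w by (intro R2) simp
    also have "w + 2 * of_nat j + 2 = w + 2 * of_nat (Suc j)"
      by (simp add: algebra_simps)
    finally show ?case
      using Suc by simp
  qed simp
  have limR: "(\<lambda>j. R (w + 2 * of_nat j)) \<longlonglongrightarrow> f \<xi>" if w: "Im w \<noteq> 0" "Re w > 0" for w
  proof -
    define I where "I j = complex_of_real (\<integral>\<omega>. \<bar>\<xi> \<bullet> \<omega>\<bar> ^ (2 * j) \<partial>M)" for j
    have I0: "I j \<noteq> 0" for j
      using approximate_identity(2)[OF cont \<xi> even] unfolding I_def by (metis less_irrefl of_real_eq_0_iff)
    define e where "e j = (\<integral>\<omega>. f \<omega> * abs_power (w + 2 * of_nat j) (\<xi> \<bullet> \<omega>) \<partial>M)" for j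
    define a where "a j = (\<integral>\<omega>. 1 * abs_power (w + 2 * of_nat j) (\<xi> \<bullet> \<omega>) \<partial>M)" for j
    have "(\<lambda>j. e j / I j) \<longlonglongrightarrow> f \<xi>"
      unfolding e_def I_def by (rule tendsto_integral_abs_power[OF cont \<xi> even w(2)])
    moreover have "(\<lambda>j. a j / I j) \<longlonglongrightarrow> 1"
      unfolding a_def I_def by (rule tendsto_integral_abs_power[OF _ \<xi> _ w(2)]) auto
    ultimately have "(\<lambda>j. (e j / I j) / (a j / I j)) \<longlonglongrightarrow> f \<xi> / 1"
      by (intro tendsto_divide) auto
    moreover have "(e j / I j) / (a j / I j) = E (w + 2 * of_nat j) / \<alpha> (w + 2 * of_nat j)" for j
    proof -
      have Re: "Re (w + 2 * of_nat j) > - 1"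
        using w by simp
      have "(w + 2 * of_nat j + 1) / 2 \<notin> \<int>\<^sub>\<le>\<^sub>0"
        using w by (auto elim!: nonpos_Ints_cases simp: complex_eq_iff)
      then have "rGamma ((w + 2 * of_nat j + 1) / 2) \<noteq> 0"
        by (simp add: rGamma_eq_zero_iff)
      then show ?thesis
        unfolding E_def \<alpha>_def J_transform_eq_integral[OF smf \<xi> Re] J_transform_eq_integral[OF weakly_smooth_const \<xi> Re]
          J_integral_eq e_def[symmetric] a_def[symmetric] using I0[of j] by simp
    qed
    ultimately have lim1: "(\<lambda>j. E (w + 2 * of_nat j) / \<alpha> (w + 2 * of_nat j)) \<longlonglongrightarrow> f \<xi>"
      by simp
    \<comment> \<open>\<open>A\<close> and \<open>B\<close> are monic of the same degree
      \<open>k\<close>, so their quotient tends to 1.\<close>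
    have "(\<lambda>j. \<Prod>i<k. (w + 2 * of_nat j + (d + 2 * of_nat i)) / (w + 2 * of_nat j + - (2 * of_nat i))) \<longlonglongrightarrow> (\<Prod>i<k. 1)"
      by (intro tendsto_prod tendsto_linear_ratio)
    then have "(\<lambda>j. A (w + 2 * of_nat j) / B (w + 2 * of_nat j)) \<longlonglongrightarrow> 1"
      by (simp add: A_def B_def prod_dividef add.assoc)
    from tendsto_mult[OF lim1 this] show ?thesis
      by (simp add: R_def mult.commute)
  qed
  have R_eq: "R w = f \<xi>" if w: "Im w \<noteq> 0" for w
  proof -
    define m where "m = nat \<lceil>\<bar>Re w\<bar>\<rceil> + 1"
    have "\<bar>Re w\<bar> < real m"
      unfolding m_def of_nat_add of_nat_1 using real_nat_ceiling_ge[of "\<bar>Re w\<bar>"] by linarith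
    then have m: "Re (w + 2 * of_nat m) > 0"
      by simp
    have "R (w + 2 * of_nat m + 2 * of_nat j) = R (w + 2 * of_nat m)" for j
      using Rj[of "w + 2 * of_nat m" j] w by simp
    with limR[of "w + 2 * of_nat m"] m w have "R (w + 2 * of_nat m) = f \<xi>"
      by (simp add: LIMSEQ_const_iff)
    then show ?thesis
      using Rj[OF w, of m] by simp
  qed
  have "E z * A z = B z * \<alpha> z * f \<xi>"
  proof (rule analytic_continuation_open[of "{z. Im z > 0}" UNIV "\<lambda>z. E z * A z" "\<lambda>z. B z * \<alpha> z * f \<xi>"])
    show "open {z. Im z > 0}"
      by (rule open_halfspace_Im_gt)
    show "{z. Im z > 0} \<noteq> {}"
      by (auto intro: exI[of _ \<i>])
    show "(\<lambda>z. E z * A z) holomorphic_on UNIV" "(\<lambda>z. B z * \<alpha> z * f \<xi>) holomorphic_on UNIV"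
      unfolding E_def A_def B_def \<alpha>_def
      by (intro holomorphic_intros holomorphic_J_transform smf weakly_smooth_const \<xi>)+
    show "E z * A z = B z * \<alpha> z * f \<xi>" if "z \<in> {z. Im z > 0}" for z
      using R_eq[of z] that B0[of z] \<alpha>0[of z] by (simp add: R_def field_simps)
  qed auto
  then show ?thesis
    by (simp add: E_def A_def B_def \<alpha>_def)
qed

end

lemma has_laplacian_sum:
  assumes "finite I" "\<And>i. i \<in> I \<Longrightarrow> has_laplacian (f i) (L i)"
  shows "has_laplacian (\<lambda>x::real^'n. \<Sum>i\<in>I. f i x) (\<lambda>x. \<Sum>i\<in>I. L i x)"
  using assms
proof (induction I rule: finite_induct)
  case empty
  show ?case
    using has_laplacian_inner_power[of "axis undefined 1 :: real^'n" 0]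
      has_laplacian_cmult[of "\<lambda>x. 1" "\<lambda>x. 0" 0] by simp
next
  case (insert i I)
  then show ?case
    using has_laplacian_add[of "f i" "L i"] by simp
qed

text \<open>The expansion of a zonal even power into zonal harmonics. The Laplacian of
  \<open>t^(2k + 2)\<close> is its eigenvalue multiple plus \<open>b * t^(2k)\<close>, and the lower
  power is already decomposed, so subtracting multiples of its components leaves an
  eigenfunction.\<close>

lemma inner_power_eigen_decomposition:
  fixes a :: "real^'n"
  assumes a: "a \<in> sphere 0 1" and card: "CARD('n) \<ge> 2"
  defines "\<mu> \<equiv> \<lambda>k. - (2 * of_nat k * (2 * of_nat k + of_nat CARD('n) - 2)) :: complex"
  shows "\<exists>e. (\<forall>j x. e j (- x) = e j x) \<and> (\<forall>j\<le>k. has_laplacian (e j) (\<lambda>x. \<mu> j * e j x)) \<and>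
    (\<forall>x. of_real (a \<bullet> x) ^ (2 * k) = (\<Sum>j\<le>k. e j x))"
proof (induction k)
  case 0
  have "has_laplacian (\<lambda>x::real^'n. 1) (\<lambda>x. \<mu> 0 * 1)"
    using has_laplacian_inner_power[OF a, of 0] by (simp add: \<mu>_def)
  then show ?case
    by (intro exI[of _ "\<lambda>j x. 1"]) simp
next
  case (Suc k)
  then obtain e :: "nat \<Rightarrow> real^'n \<Rightarrow> complex" where even: "\<And>j x. e j (- x) = e j x"
    and e: "\<And>j. j \<le> k \<Longrightarrow> has_laplacian (e j) (\<lambda>x. \<mu> j * e j x)"
    and sum: "\<And>x. of_real (a \<bullet> x) ^ (2 * k) = (\<Sum>j\<le>k. e j x)"
    by blast
  have \<mu>_ne: "\<mu> j \<noteq> \<mu> (Suc k)" if "j \<le> k" for j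
  proof -
    have less: "2 * real j * (2 * real j + real CARD('n) - 2) < 2 * real (Suc k) * (2 * real (Suc k) + real CARD('n) - 2)"
    proof (rule mult_strict_mono)
      have "real CARD('n) \<ge> real 2"
        using card by (simp only: of_nat_le_iff)
      then show "0 \<le> 2 * real j + real CARD('n) - 2"
        by simp
    qed (use that in auto)
    have \<mu>_real: "\<mu> i = of_real (- (2 * real i * (2 * real i + real CARD('n) - 2)))" for i
      by (simp add: \<mu>_def)
    show ?thesis
      unfolding \<mu>_real of_real_eq_iff neg_equal_iff_equal by (rule less_imp_neq[OF less])
  qed
  define b where "b = complex_of_nat (2 * Suc k) * (of_nat (2 * Suc k) - 1)"
  \<comment> \<open>Solves \<open>b = c j * (\<mu> j - \<mu> (Suc k))\<close>, the condition that
    the unwanted component along \<open>e j\<close> cancels; this needs the eigenvalues to be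
    distinct.\<close>
  define c where "c j = b / (\<mu> j - \<mu> (Suc k))" for j
  define p where "p x = complex_of_real (a \<bullet> x) ^ (2 * Suc k)" for x
  define g where "g x = p x + (\<Sum>j\<le>k. - c j * e j x)" for x
  define e' where "e' j x = (if j \<le> k then c j * e j x else g x)" for j x
  have lap_p: "has_laplacian p (\<lambda>x. b * (\<Sum>j\<le>k. e j x) + \<mu> (Suc k) * p x)"
    unfolding p_def using has_laplacian_inner_power[OF a, of "2 * Suc k"]
    by (rule has_laplacian_cong) (simp add: b_def \<mu>_def sum[symmetric] algebra_simps)
  have "has_laplacian g (\<lambda>x. (b * (\<Sum>j\<le>k. e j x) + \<mu> (Suc k) * p x) + (\<Sum>j\<le>k. - c j * (\<mu> j * e j x)))"
    unfolding g_def[abs_def] by (intro has_laplacian_add lap_p has_laplacian_sum has_laplacian_cmult e) auto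
  then have lap_g: "has_laplacian g (\<lambda>x. \<mu> (Suc k) * g x)"
  proof (rule has_laplacian_cong)
    fix x
    have eq: "(\<Sum>j\<le>k. b * e j x + - c j * (\<mu> j * e j x)) = (\<Sum>j\<le>k. \<mu> (Suc k) * (- c j * e j x))"
    proof (intro sum.cong refl)
      fix j assume "j \<in> {..k}"
      then have "b = c j * (\<mu> j - \<mu> (Suc k))"
        using \<mu>_ne[of j] by (simp add: c_def)
      then show "b * e j x + - c j * (\<mu> j * e j x) = \<mu> (Suc k) * (- c j * e j x)"
        by (rule ssubst) (simp add: algebra_simps)
    qed
    have "(b * (\<Sum>j\<le>k. e j x) + \<mu> (Suc k) * p x) + (\<Sum>j\<le>k. - c j * (\<mu> j * e j x))
        = \<mu> (Suc k) * p x + (\<Sum>j\<le>k. b * e j x + - c j * (\<mu> j * e j x))"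
      by (simp only: sum.distrib sum_distrib_left add_ac)
    also have "\<dots> = \<mu> (Suc k) * g x"
      unfolding eq by (simp only: g_def distrib_left sum_distrib_left)
    finally show "(b * (\<Sum>j\<le>k. e j x) + \<mu> (Suc k) * p x) + (\<Sum>j\<le>k. - c j * (\<mu> j * e j x))
        = \<mu> (Suc k) * g x" .
  qed
  have "has_laplacian (e' j) (\<lambda>x. \<mu> j * e' j x)" if "j \<le> Suc k" for j
  proof (cases "j \<le> k")
    case True
    then show ?thesis
      using has_laplacian_cmult[OF e[OF True], of "c j"] by (simp add: e'_def[abs_def] mult.left_commute)
  next
    case False
    then have "j = Suc k"
      using that by simp
    then show ?thesis
      using lap_g by (simp add: e'_def[abs_def])
  qed
  moreover have "e' j (- x) = e' j x" for j x
    by (simp add: e'_def g_def p_def even)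
  moreover have "of_real (a \<bullet> x) ^ (2 * Suc k) = (\<Sum>j\<le>Suc k. e' j x)" for x
  proof -
    have "(\<Sum>j\<le>Suc k. e' j x) = (\<Sum>j\<le>k. c j * e j x) + g x"
      by (simp add: e'_def)
    then show ?thesis
      by (simp add: g_def p_def sum_negf)
  qed
  ultimately show ?case
    by blast
qed

section \<open>Inversion and the Plancherel formula\<close>

context sphere_measure_pair
begin

text \<open>Self-adjointness for 1 against 1: what proportionality of \<open>M\<close> and
  \<open>N\<close> would give, obtained without it.\<close>

lemma J_transform_one_ratio:
  assumes "e \<in> sphere 0 1"
  shows "J_transform M z (\<lambda>x. 1) e * of_real (measure N (sphere 0 1))
    = J_transform N z (\<lambda>x. 1) e * of_real (measure M (sphere 0 1))"
proof -
  have "(\<integral>\<xi>. J_transform M z (\<lambda>x. 1) \<xi> * 1 \<partial>N) = (\<integral>\<xi>. J_transform M z (\<lambda>x. 1) e \<partial>N)"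
    using M.J_transform_one_eq[OF _ assms] by (intro Bochner_Integration.integral_cong) (auto simp: N.space_M)
  moreover have "(\<integral>\<omega>. 1 * J_transform N z (\<lambda>x. 1) \<omega> \<partial>M) = (\<integral>\<omega>. J_transform N z (\<lambda>x. 1) e \<partial>M)"
    using N.J_transform_one_eq[OF _ assms] by (intro Bochner_Integration.integral_cong) (auto simp: M.space_M)
  ultimately show ?thesis
    using J_transform_self_adjoint[OF M.weakly_smooth_const[of 1] N.weakly_smooth_const[of 1], of z]
    by (simp add: M.space_M N.space_M scaleR_conv_of_real mult.commute)
qed

lemma J_transform_inversion:
  fixes f :: "real^'n \<Rightarrow> complex"
  assumes f: "weakly_smooth M f" and even: "even_on_sphere f"
    and lam: "Re lam = - real CARD('n) / 2"
    and a: "a \<in> sphere 0 1"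
  shows "J_transform N (cnj lam) (J_transform M lam f) a
    = J_transform M (cnj lam) (\<lambda>x. 1) a * J_transform N lam (\<lambda>x. 1) a * f a"
proof -
  interpret NM: sphere_measure_pair N M
    by unfold_locales
  define d where "d = complex_of_nat CARD('n)"
  define C where "C = J_transform M (cnj lam) (\<lambda>x. 1) a * J_transform N lam (\<lambda>x. 1) a"
  define u where "u = J_transform M lam f"
  define w where "w x = J_transform N (cnj lam) u x - C * f x" for x
  have cnj_lam: "cnj lam = - d - lam"
    using lam by (simp add: d_def complex_eq_iff)
  have u: "weakly_smooth N u"
    unfolding u_def by (rule weakly_smooth_J_transform[OF f])
  note [continuous_intros] = NM.continuous_on_J_transform_at[OF u] weakly_smooth_continuous[OF f]
  have w: "continuous_on (sphere 0 1) w"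
    unfolding w_def[abs_def] by (intro continuous_intros)
  have eigen: "(\<integral>\<omega>. w \<omega> * e \<omega> \<partial>M) = 0"
    if lap: "has_laplacian e (\<lambda>x. - (2 * of_nat k * (2 * of_nat k + of_nat CARD('n) - 2)) * e x)"
      and even_e: "\<And>x. e (- x) = e x" for e k
  proof -
    have WM: "weak_laplacian M e (\<lambda>x. - (2 * of_nat k * (2 * of_nat k + of_nat CARD('n) - 2)) * e x)"
      and WN: "weak_laplacian N e (\<lambda>x. - (2 * of_nat k * (2 * of_nat k + of_nat CARD('n) - 2)) * e x)"
      by (intro M.weak_laplacian_if_has_laplacian N.weak_laplacian_if_has_laplacian lap)+
    have eM: "weakly_smooth M e" and eN: "weakly_smooth N e"
      using M.weakly_smooth_eigenfunction[OF WM] N.weakly_smooth_eigenfunction[OF WN] by auto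
    note [continuous_intros] = weakly_smooth_continuous[OF eM]
    define A where "A z = (\<Prod>i<k. z + d + 2 * of_nat i)" for z
    define B where "B z = (\<Prod>i<k. z - 2 * of_nat i)" for z :: complex
    have swap: "B (- d - z) = (- 1) ^ k * A z" for z
    proof -
      have "B (- d - z) = (\<Prod>i<k. - 1 * (z + d + 2 * of_nat i))"
        by (simp add: B_def algebra_simps)
      then show ?thesis
        by (simp only: A_def prod.distrib prod_constant card_lessThan)
    qed
    \<comment> \<open>On this line every factor \<open>z + d + 2i\<close> has real part
      \<open>d / 2 + 2i > 0\<close>.\<close>
    have A0: "A z \<noteq> 0" if "Re z = - real CARD('n) / 2" for z
    proof -
      have "real CARD('n) / 2 + 2 * real i \<noteq> 0" for i
        using zero_less_card_finite[where 'a = 'n] by (simp add: add_pos_nonneg less_imp_neq[symmetric])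
      then show ?thesis
        using that unfolding A_def d_def prod_zero_iff[OF finite_lessThan]
        by (auto simp: complex_eq_iff)
    qed
    have "Re (cnj lam) = - real CARD('n) / 2"
      using lam by simp
    note A0' = A0[OF lam] A0[OF this]
    define \<beta> \<beta>' where "\<beta> = B lam / A lam" and "\<beta>' = B (cnj lam) / A (cnj lam)"
    have "B (cnj lam) = (- 1) ^ k * A lam" "B lam = (- 1) ^ k * A (cnj lam)"
      using swap[of lam] swap[of "cnj lam"] by (simp_all add: cnj_lam)
    \<comment> \<open>The sign \<open>(- 1) ^ k\<close> enters once for each exponent and cancels in
      the product.\<close>
    then have \<beta>: "\<beta> * \<beta>' = 1"
      using A0' by (simp add: \<beta>_def \<beta>'_def power_mult_distrib[symmetric])
    have JN: "J_transform N lam e x = \<beta> * J_transform N lam (\<lambda>x. 1) a * e x" if x: "x \<in> sphere 0 1" for x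
    proof -
      have "J_transform N lam e x * A lam = B lam * J_transform N lam (\<lambda>x. 1) x * e x"
        unfolding A_def B_def d_def by (rule N.weak_laplacian_eigenfunction_J[OF WN even_e x])
      then show ?thesis
        using A0' N.J_transform_one_eq[OF x a] by (simp add: \<beta>_def field_simps)
    qed
    have JM: "J_transform M (cnj lam) e x = \<beta>' * J_transform M (cnj lam) (\<lambda>x. 1) a * e x" if x: "x \<in> sphere 0 1" for x
    proof -
      have "J_transform M (cnj lam) e x * A (cnj lam) = B (cnj lam) * J_transform M (cnj lam) (\<lambda>x. 1) x * e x"
        unfolding A_def B_def d_def by (rule M.weak_laplacian_eigenfunction_J[OF WM even_e x])
      then show ?thesis
        using A0' M.J_transform_one_eq[OF x a] by (simp add: \<beta>'_def field_simps)
    qed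
    have "(\<integral>\<omega>. J_transform N (cnj lam) u \<omega> * e \<omega> \<partial>M) = (\<integral>\<xi>. u \<xi> * J_transform M (cnj lam) e \<xi> \<partial>N)"
      by (rule NM.J_transform_self_adjoint[OF u eM])
    also have "\<dots> = (\<integral>\<xi>. \<beta>' * J_transform M (cnj lam) (\<lambda>x. 1) a * (u \<xi> * e \<xi>) \<partial>N)"
      by (intro Bochner_Integration.integral_cong refl) (simp add: N.space_M JM mult_ac)
    also have "\<dots> = \<beta>' * J_transform M (cnj lam) (\<lambda>x. 1) a * (\<integral>\<xi>. J_transform M lam f \<xi> * e \<xi> \<partial>N)"
      by (simp add: u_def)
    also have "(\<integral>\<xi>. J_transform M lam f \<xi> * e \<xi> \<partial>N) = (\<integral>\<omega>. f \<omega> * J_transform N lam e \<omega> \<partial>M)"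
      by (rule J_transform_self_adjoint[OF f eN])
    also have "\<dots> = (\<integral>\<omega>. \<beta> * J_transform N lam (\<lambda>x. 1) a * (f \<omega> * e \<omega>) \<partial>M)"
      by (intro Bochner_Integration.integral_cong refl) (simp add: M.space_M JN mult_ac)
    also have "\<dots> = \<beta> * J_transform N lam (\<lambda>x. 1) a * (\<integral>\<omega>. f \<omega> * e \<omega> \<partial>M)"
      by simp
    also have "\<beta>' * J_transform M (cnj lam) (\<lambda>x. 1) a * \<dots> = (\<beta> * \<beta>') * C * (\<integral>\<omega>. f \<omega> * e \<omega> \<partial>M)"
      by (simp add: C_def mult_ac)
    finally have "(\<integral>\<omega>. J_transform N (cnj lam) u \<omega> * e \<omega> \<partial>M) = C * (\<integral>\<omega>. f \<omega> * e \<omega> \<partial>M)"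
      by (simp add: \<beta>)
    moreover have "(\<integral>\<omega>. w \<omega> * e \<omega> \<partial>M)
        = (\<integral>\<omega>. J_transform N (cnj lam) u \<omega> * e \<omega> - C * (f \<omega> * e \<omega>) \<partial>M)"
      by (simp add: w_def algebra_simps)
    moreover have "\<dots> = (\<integral>\<omega>. J_transform N (cnj lam) u \<omega> * e \<omega> \<partial>M) - C * (\<integral>\<omega>. f \<omega> * e \<omega> \<partial>M)"
      by (subst Bochner_Integration.integral_diff)
        (auto intro!: M.integrable_continuous_on_sphere continuous_intros)
    ultimately show ?thesis
      by simp
  qed
  have powers: "(\<integral>\<omega>. w \<omega> * of_real (\<bar>a \<bullet> \<omega>\<bar> ^ (2 * k)) \<partial>M) = 0" for k
  proof -
    obtain e :: "nat \<Rightarrow> real^'n \<Rightarrow> complex" where even_e: "\<And>j x. e j (- x) = e j x"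
      and lap: "\<And>j. j \<le> k \<Longrightarrow> has_laplacian (e j) (\<lambda>x. - (2 * of_nat j * (2 * of_nat j + of_nat CARD('n) - 2)) * e j x)"
      and sum: "\<And>x. of_real (a \<bullet> x) ^ (2 * k) = (\<Sum>j\<le>k. e j x)"
      using inner_power_eigen_decomposition[OF a M.card_ge_2, of k] by blast
    have "(\<integral>\<omega>. w \<omega> * of_real (\<bar>a \<bullet> \<omega>\<bar> ^ (2 * k)) \<partial>M) = (\<integral>\<omega>. (\<Sum>j\<le>k. w \<omega> * e j \<omega>) \<partial>M)"
      by (intro Bochner_Integration.integral_cong refl)
        (simp add: sum[symmetric] sum_distrib_left[symmetric] power_mult)
    also have "\<dots> = (\<Sum>j\<le>k. (\<integral>\<omega>. w \<omega> * e j \<omega> \<partial>M))"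
      using has_laplacian_continuous(1)[OF lap]
      by (intro Bochner_Integration.integral_sum M.integrable_continuous_on_sphere continuous_intros w) auto
    also have "\<dots> = 0"
      by (intro sum.neutral ballI eigen[OF lap even_e]) auto
    finally show ?thesis .
  qed
  \<comment> \<open>Even powers concentrate at \<open>a\<close> and \<open>- a\<close> alike, so the
    defect must agree there: the transform does because its kernel is even, \<open>f\<close> by
    hypothesis.\<close>
  have "w (- a) = w a"
    using even a by (simp add: w_def N.J_transform_minus even_on_sphere_def)
  from LIMSEQ_subseq_LIMSEQ[OF M.approximate_identity(1)[OF w a this], of "\<lambda>k. 2 * k"]
  have "(\<lambda>k. 0) \<longlonglongrightarrow> w a"
    by (simp add: strict_mono_def o_def powers del: of_real_power)
  then have "w a = 0"
    by (simp add: LIMSEQ_const_iff)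
  then show ?thesis
    by (simp add: w_def u_def C_def)
qed

text \<open>The conjugate of a transform is the transform of the conjugate with conjugate exponent;
  self-adjointness moves it onto the first factor, where inversion applies.\<close>

lemma J_transform_plancherel:
  fixes f g :: "real^'n \<Rightarrow> complex"
  assumes f: "weakly_smooth M f" and even: "even_on_sphere f" and g: "weakly_smooth M g"
    and lam: "Re lam = - real CARD('n) / 2"
    and one: "\<And>a. a \<in> sphere 0 1 \<Longrightarrow> J_transform M (cnj lam) (\<lambda>x. 1) a * J_transform N lam (\<lambda>x. 1) a = 1"
  shows "(\<integral>\<omega>. f \<omega> * cnj (g \<omega>) \<partial>M) = (\<integral>\<xi>. J_transform M lam f \<xi> * cnj (J_transform M lam g \<xi>) \<partial>N)"
proof -
  interpret NM: sphere_measure_pair N M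
    by unfold_locales
  have "(\<integral>\<xi>. J_transform M lam f \<xi> * cnj (J_transform M lam g \<xi>) \<partial>N)
      = (\<integral>\<xi>. J_transform M lam f \<xi> * J_transform M (cnj lam) (\<lambda>x. cnj (g x)) \<xi> \<partial>N)"
    by (intro Bochner_Integration.integral_cong refl) (simp add: N.space_M M.J_transform_cnj[OF g])
  also have "\<dots> = (\<integral>\<omega>. J_transform N (cnj lam) (J_transform M lam f) \<omega> * cnj (g \<omega>) \<partial>M)"
    by (rule NM.J_transform_self_adjoint[symmetric])
      (intro weakly_smooth_J_transform f M.weakly_smooth_cnj g)+
  also have "\<dots> = (\<integral>\<omega>. f \<omega> * cnj (g \<omega>) \<partial>M)"
    by (intro Bochner_Integration.integral_cong refl)
      (simp add: M.space_M J_transform_inversion[OF f even lam] one)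
  finally show ?thesis
    by simp
qed

end

section \<open>Normalization of the measures\<close>

lemma (in sphere_measure) invariant_sphere_measure_scale:
  assumes d: "d > 0"
  shows "invariant_sphere_measure (scale_measure (ennreal d) M)"
  unfolding invariant_sphere_measure_def
proof (intro conjI allI impI)
  show "sets (scale_measure (ennreal d) M) = sets (restrict_space borel (sphere 0 1))"
    by (simp add: sets_M)
  show "0 < emeasure (scale_measure (ennreal d) M) (sphere 0 1)"
    using invariant d by (auto simp: invariant_sphere_measure_def ennreal_zero_less_mult_iff)
  show "emeasure (scale_measure (ennreal d) M) (sphere 0 1) < \<infinity>"
    using invariant d by (auto simp: invariant_sphere_measure_def ennreal_mult_less_top)
  fix Q :: "real^'n^'n" assume Q: "rotation_matrix Q"
  then have inv: "distr M M ((*v) Q) = M"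
    using invariant by (simp add: invariant_sphere_measure_def)
  note [measurable] = measurable_rotation[OF Q]
  show "distr (scale_measure (ennreal d) M) (scale_measure (ennreal d) M) ((*v) Q) = scale_measure (ennreal d) M"
  proof (rule measure_eqI)
    fix X assume "X \<in> sets (distr (scale_measure (ennreal d) M) (scale_measure (ennreal d) M) ((*v) Q))"
    then have X: "X \<in> sets M"
      by simp
    have "emeasure M ((*v) Q -` X \<inter> space M) = emeasure (distr M M ((*v) Q)) X"
      using X by (simp add: emeasure_distr measurable_rotation[OF Q])
    then show "emeasure (distr (scale_measure (ennreal d) M) (scale_measure (ennreal d) M) ((*v) Q)) X
        = emeasure (scale_measure (ennreal d) M) X"
      using X by (subst emeasure_distr) (simp_all add: inv space_scale_measure measurable_rotation[OF Q] cong: measurable_cong_sets)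
  qed simp
qed

theorem mainTheorem2:
  fixes n :: nat and \<rho> :: real and lam :: complex
    and M N :: "(real^'n) measure"
  assumes "n \<ge> 1" and "CARD('n) = n + 1"
    and "lam = - (of_nat n + 1) / 2 + \<i> * of_real \<rho>"
    and "invariant_sphere_measure M" and "invariant_sphere_measure N"
  shows "\<exists>c d :: real. c > 0 \<and> d > 0 \<and>
    (let d\<omega> = scale_measure (ennreal c) M; d\<xi> = scale_measure (ennreal d) N;
         J = J_transform d\<omega> lam; J' = J_conj_transform d\<xi> lam
     in (\<forall>f. smooth_on_sphere f \<and> even_on_sphere f \<longrightarrow>
           (\<forall>\<omega>\<in>sphere 0 1. f \<omega> = J' (J f) \<omega>)) \<and>
        (\<forall>f g. smooth_on_sphere f \<and> even_on_sphere f \<and> smooth_on_sphere g \<and> even_on_sphere g \<longrightarrow>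
           (\<integral>\<omega>. f \<omega> * cnj (g \<omega>) \<partial>d\<omega>) = (\<integral>\<xi>. J f \<xi> * cnj (J g \<xi>) \<partial>d\<xi>)))"
proof -
  have card: "CARD('n) \<ge> 2"
    using assms by simp
  have lam: "Re lam = - real CARD('n) / 2"
    using assms by (simp add: assms(3))
  interpret M: sphere_measure M
    using assms card by unfold_locales
  interpret N: sphere_measure N
    using assms card by unfold_locales
  obtain e :: "real^'n" where e: "e \<in> sphere 0 1"
    using vector_choose_size[of 1] by auto
  define \<alpha> where "\<alpha> = J_transform M lam (\<lambda>x. 1) e"
  have \<alpha>: "\<alpha> \<noteq> 0"
    unfolding \<alpha>_def by (rule M.J_transform_one_nonzero[OF e]) (use lam card in \<open>auto simp: complex_eq_iff\<close>)
  \<comment> \<open>With \<open>N'\<close> in place of \<open>N\<close> the inversion constant is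
    \<open>(norm \<alpha>)\<^sup>2\<close> times the ratio of the total masses of \<open>N'\<close>
    and \<open>M\<close>; this \<open>d\<close> makes it 1.\<close>
  define d where "d = measure M (sphere 0 1) / (measure N (sphere 0 1) * (norm \<alpha>)\<^sup>2)"
  have d: "d > 0"
    using \<alpha> M.measure_pos N.measure_pos by (simp add: d_def)
  define N' where "N' = scale_measure (ennreal d) N"
  interpret N': sphere_measure N'
    unfolding N'_def using N.invariant_sphere_measure_scale[OF d] card by unfold_locales
  interpret MN': sphere_measure_pair M N'
    by unfold_locales
  have mN': "measure N' (sphere 0 1) * (norm \<alpha>)\<^sup>2 = measure M (sphere 0 1)"
    using d \<alpha> N.measure_pos by (simp add: N'_def measure_scale_measure d_def)
  have one: "J_transform M (cnj lam) (\<lambda>x. 1) a * J_transform N' lam (\<lambda>x. 1) a = 1" if a: "a \<in> sphere 0 1" for a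
  proof -
    have "J_transform M (cnj lam) (\<lambda>x. 1) a = cnj \<alpha>"
      using M.J_transform_cnj[OF M.weakly_smooth_const[of 1] a, of lam] M.J_transform_one_eq[OF a e, of lam]
      by (simp add: \<alpha>_def)
    moreover have "J_transform N' lam (\<lambda>x. 1) a * of_real (measure M (sphere 0 1)) = \<alpha> * of_real (measure N' (sphere 0 1))"
      using MN'.J_transform_one_ratio[OF a, of lam] M.J_transform_one_eq[OF a e, of lam] by (simp add: \<alpha>_def)
    ultimately have "J_transform M (cnj lam) (\<lambda>x. 1) a * J_transform N' lam (\<lambda>x. 1) a * of_real (measure M (sphere 0 1))
        = (\<alpha> * cnj \<alpha>) * of_real (measure N' (sphere 0 1))"
      by simp
    also have "\<dots> = of_real (measure M (sphere 0 1))"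
      unfolding complex_norm_square[symmetric] mN'[symmetric] by simp
    finally show ?thesis
      using M.measure_pos by simp
  qed
  show ?thesis
  \<comment> \<open>Only the product of the two scalings enters the constant, so \<open>M\<close>
    keeps its normalization.\<close>
  proof (rule exI[of _ 1], rule exI[of _ d], intro conjI)
    show "let d\<omega> = scale_measure (ennreal 1) M; d\<xi> = scale_measure (ennreal d) N;
         J = J_transform d\<omega> lam; J' = J_conj_transform d\<xi> lam
     in (\<forall>f. smooth_on_sphere f \<and> even_on_sphere f \<longrightarrow>
           (\<forall>\<omega>\<in>sphere 0 1. f \<omega> = J' (J f) \<omega>)) \<and>
        (\<forall>f g. smooth_on_sphere f \<and> even_on_sphere f \<and> smooth_on_sphere g \<and> even_on_sphere g \<longrightarrow>
           (\<integral>\<omega>. f \<omega> * cnj (g \<omega>) \<partial>d\<omega>) = (\<integral>\<xi>. J f \<xi> * cnj (J g \<xi>) \<partial>d\<xi>))"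
      unfolding Let_def ennreal_1 scale_measure_1 N'_def[symmetric] J_conj_transform_def
    proof (intro conjI allI impI ballI; elim conjE)
      fix f :: "real^'n \<Rightarrow> complex" and a :: "real^'n"
      assume f: "smooth_on_sphere f" "even_on_sphere f" and a: "a \<in> sphere 0 1"
      show "f a = J_transform N' (cnj lam) (J_transform M lam f) a"
        using MN'.J_transform_inversion[OF M.weakly_smooth_if_smooth_on_sphere[OF f(1)] f(2) lam a] one[OF a]
        by simp
    next
      fix f g :: "real^'n \<Rightarrow> complex"
      assume f: "smooth_on_sphere f" "even_on_sphere f" and g: "smooth_on_sphere g"
      show "(\<integral>\<omega>. f \<omega> * cnj (g \<omega>) \<partial>M) = (\<integral>\<xi>. J_transform M lam f \<xi> * cnj (J_transform M lam g \<xi>) \<partial>N')"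
        by (rule MN'.J_transform_plancherel[OF M.weakly_smooth_if_smooth_on_sphere[OF f(1)] f(2)
              M.weakly_smooth_if_smooth_on_sphere[OF g] lam one])
    qed
  qed (use d in auto)
qed

end
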